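(* Let $\theta>0$, let $f:S^1\to\mathbb{C}$ be a real analytic function on $S^1=\{z\in\mathbb{C}:|z|=1\}$, let $x\in S^1$, and let the symmetric group $S_n$ be endowed with the Ewens measure with parameter $\theta$. Let $w^n(f)(x)=\sum_{m=1}^n C_m^{(n)}\log\bigl(f(x^m)\bigr)$ and let $m(f)(x)$ be defined as in the context. (i) If $x$ is not a root of unity and is of finite type, and all zeros of $f$ are roots of unity, then, as $n\to\infty$, $$\frac{w^n(f)(x)}{\sqrt{\log n}}-\theta\sqrt{\log n}\; m(f)(x)\ \xrightarrow{d}\ \mathcal{N},$$ where $\mathcal{N}$ is a complex normal distributed random variable. The covariance of the real and the imaginary part of $\mathcal{N}$ is $$\frac{\theta}{2}\,\mathrm{Im}\left(\int_0^1 \log^2\bigl(f(e^{2\pi i s})\bigr)\,ds\right).$$ The real and the imaginary part of $\mathcal{N}$ are independent if and only if this covariance equals $0$. (ii) If $x$ is a root of unity of order $p$ and $f(x^m)\neq 0$ for all $1\le m\le p$, then, as $n\to\infty$, $$\frac{w^n(f)(x)}{\sqrt{\log n}}-\theta\sqrt{\log n}\; m(f)(x)\ \xrightarrow{d}\ \mathcal{N},$$ where $\mathcal{N}$ is a complex normal distributed random variable. The covariance of the real and the imaginary part of $\mathcal{N}$ is $$\frac{\theta}{2}\,\mathrm{Im}\left(\frac1p\sum_{m=1}^{p} \log^2\bigl(f(x^m)\bigr)\right).$$ The real and the imaginary part of $\mathcal{N}$ are independent if and only if this covariance equals $0$.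
   Context: Ewens measure: for $\theta>0$ the Ewens measure $\mathbb{P}_\theta$ on $S_n$ is $\mathbb{P}_\theta[\sigma]=\frac{\theta^{\ell(\sigma)}}{\theta(\theta+1)\cdots(\theta+n-1)}$, where $\ell(\sigma)$ is the total number of cycles of $\sigma$ (fixed points included). $C_m^{(n)}=C_m^{(n)}(\sigma)$ denotes the number of cycles of length $m$ of $\sigma\in S_n$. Logarithm: $\log$ is the principal branch, with $\log(-y)=\log(y)+i\pi$ for $y>0$ (so its imaginary part lies in $(-\pi,\pi]$), and $\log(0)=\infty$. $\log^2(z)$ means $(\log z)^2$. Definition of $m(f)(x)$: if $x$ is a root of unity of order $p$ (i.e. $x^p=1$ with $p\geq 1$ minimal), $m(f)(x)=\frac1p\sum_{m=1}^p\log(f(x^m))$; if $x\in S^1$ is not a root of unity, $m(f)(x)=\int_0^1\log(f(e^{2\pi i s}))\,ds$. Finite type: $x=e^{2\pi i t}$ ($t\in\mathbb{R}$) is of finite type if there exist constants $K,\gamma>0$ such that $\|\{mt\}\|>\frac{K}{|m|^\gamma}$ for all $m\in\mathbb{Z}\setminus\{0\}$, where $\{s\}=s-\lfloor s\rfloor$ is the fractional part and $\|s\|=\min\{s,1-s\}$ for $s\in[0,1]$. A complex normal random variable is a complex random variable whose real and imaginary parts are jointly Gaussian (possibly degenerate); $\xrightarrow{d}$ is convergence in distribution (in $\mathbb{C}\cong\mathbb{R}^2$). *)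

theory Defs
  imports "HOL-Probability.Probability" "HOL-Combinatorics.Permutations" "HOL-Combinatorics.Orbits"
begin

definition perm_cycles :: "nat \<Rightarrow> (nat \<Rightarrow> nat) \<Rightarrow> nat set set" where
  "perm_cycles n \<sigma> = orbit \<sigma> ` {1..n}"

definition num_cycles :: "nat \<Rightarrow> (nat \<Rightarrow> nat) \<Rightarrow> nat" where
  "num_cycles n \<sigma> = card (perm_cycles n \<sigma>)"

definition num_cycles_len :: "nat \<Rightarrow> nat \<Rightarrow> (nat \<Rightarrow> nat) \<Rightarrow> nat" where
  "num_cycles_len n m \<sigma> = card {c \<in> perm_cycles n \<sigma>. card c = m}"

text \<open>The group \<open>S\<^sub>n\<close> is the set of permutations of \<open>{1..n}\<close>; \<open>pochhammer \<theta> n\<close> is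
  \<open>\<theta> (\<theta> + 1) \<cdots> (\<theta> + n - 1)\<close>.\<close>

definition ewens :: "real \<Rightarrow> nat \<Rightarrow> (nat \<Rightarrow> nat) measure" where
  "ewens \<theta> n = point_measure {\<sigma>. \<sigma> permutes {1..n}}
     (\<lambda>\<sigma>. ennreal (\<theta> ^ num_cycles n \<sigma> / pochhammer \<theta> n))"

definition root_of_unity :: "complex \<Rightarrow> bool" where
  "root_of_unity x \<longleftrightarrow> (\<exists>p\<ge>1. x ^ p = 1)"

definition unity_order :: "complex \<Rightarrow> nat" where
  "unity_order x = (LEAST p. 1 \<le> p \<and> x ^ p = 1)"

text \<open>A function on the circle is a function on \<open>\<complex>\<close> of which only the values on
  \<open>sphere 0 1\<close> matter. Real analyticity is analyticity in the angular coordinate \<open>t\<close> of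
  \<open>e\<^bsup>2\<pi>it\<^esup>\<close>.\<close>

definition real_analytic_on_circle :: "(complex \<Rightarrow> complex) \<Rightarrow> bool" where
  "real_analytic_on_circle f \<longleftrightarrow>
     (\<forall>t\<^sub>0::real. \<exists>r>0. \<exists>a::nat \<Rightarrow> complex. \<forall>t. \<bar>t - t\<^sub>0\<bar> < r \<longrightarrow>
        (\<lambda>k. a k * of_real (t - t\<^sub>0) ^ k) sums f (cis (2 * pi * t)))"

text \<open>The angle \<open>t\<close> is determined by \<open>x\<close> up to an integer, on which the bound does not depend.\<close>

definition finite_type :: "complex \<Rightarrow> bool" where
  "finite_type x \<longleftrightarrow> (\<exists>t::real. x = cis (2 * pi * t) \<and>
     (\<exists>K>0. \<exists>\<gamma>>0. \<forall>m::int. m \<noteq> 0 \<longrightarrow>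
        min (frac (of_int m * t)) (1 - frac (of_int m * t)) > K / \<bar>of_int m\<bar> powr \<gamma>))"

text \<open>\<open>Ln\<close> is the principal branch with imaginary part in \<open>(-\<pi>, \<pi>]\<close>. The convention
  \<open>log 0 = \<infinity>\<close> is replaced by the library value \<open>Ln 0 = 0\<close>: this affects only the values of
  the integrands below on the zeros of \<open>f\<close>, and sums in which some \<open>f (x ^ m)\<close> is zero.\<close>

definition log_mean :: "(complex \<Rightarrow> complex) \<Rightarrow> complex \<Rightarrow> complex" where
  "log_mean f x =
     (if root_of_unity x
      then (\<Sum>m=1..unity_order x. Ln (f (x ^ m))) / of_nat (unity_order x)
      else (LINT s:{0..1}|lborel. Ln (f (cis (2 * pi * s)))))"

definition w_log :: "nat \<Rightarrow> (complex \<Rightarrow> complex) \<Rightarrow> complex \<Rightarrow> (nat \<Rightarrow> nat) \<Rightarrow> complex" where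
  "w_log n f x \<sigma> = (\<Sum>m=1..n. of_nat (num_cycles_len n m \<sigma>) * Ln (f (x ^ m)))"

definition converges_in_distribution ::
    "(nat \<Rightarrow> 'a measure) \<Rightarrow> (nat \<Rightarrow> 'a \<Rightarrow> complex) \<Rightarrow> 'b measure \<Rightarrow> ('b \<Rightarrow> complex) \<Rightarrow> bool" where
  "converges_in_distribution M X M' Y \<longleftrightarrow>
     (\<forall>g :: complex \<Rightarrow> real. continuous_on UNIV g \<and> bounded (range g) \<longrightarrow>
        (\<lambda>n. integral\<^sup>L (M n) (\<lambda>\<omega>. g (X n \<omega>))) \<longlonglongrightarrow> integral\<^sup>L M' (\<lambda>\<omega>. g (Y \<omega>)))"

definition real_normal :: "'a measure \<Rightarrow> ('a \<Rightarrow> real) \<Rightarrow> bool" where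
  "real_normal M X \<longleftrightarrow> X \<in> borel_measurable M \<and>
     ((\<exists>\<mu> \<sigma>. 0 < \<sigma> \<and> distributed M lborel X (\<lambda>y. ennreal (normal_density \<mu> \<sigma> y)))
      \<or> (\<exists>\<mu>. AE \<omega> in M. X \<omega> = \<mu>))"

text \<open>Jointly Gaussian: every real linear combination is Gaussian, point masses included.\<close>

definition complex_normal :: "'a measure \<Rightarrow> ('a \<Rightarrow> complex) \<Rightarrow> bool" where
  "complex_normal M N \<longleftrightarrow> N \<in> borel_measurable M \<and>
     (\<forall>a b::real. real_normal M (\<lambda>\<omega>. a * Re (N \<omega>) + b * Im (N \<omega>)))"

definition covariance :: "'a measure \<Rightarrow> ('a \<Rightarrow> real) \<Rightarrow> ('a \<Rightarrow> real) \<Rightarrow> real" where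
  "covariance M X Y =
     integral\<^sup>L M (\<lambda>\<omega>. (X \<omega> - integral\<^sup>L M X) * (Y \<omega> - integral\<^sup>L M Y))"

end

theory Submission
  imports Defs "HOL-Complex_Analysis.Cauchy_Integral_Formula" "HOL-Real_Asymp.Real_Asymp"
begin

text \<open>Let \<open>g m = Ln (f (x ^ m))\<close>. Splitting off the cycles of length at most \<open>b\<close> from the cycle
  generating function shows that, up to an error \<open>O(b / n)\<close>, the short cycle counts behave like
  independent Poisson variables with means \<open>\<theta> / m\<close>; for \<open>b\<close> slightly smaller than \<open>n\<close>
  the longer cycles are few and rarely carry a large value of \<open>g\<close>. The characteristic
  function of the sum is then governed by the weighted sums of \<open>g m / m\<close> and
  \<open>(g m)\<^sup>2 / m\<close> over \<open>m \<le> n\<close>. These have the required asymptotics because \<open>g\<close> is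
  periodic if \<open>x\<close> is a root of unity, and otherwise because the powers of \<open>x\<close> have polynomially
  small discrepancy: there \<open>Ln \<circ> f\<close> is, on each side of every point of the circle,
  Lipschitz up to a logarithmic singularity, and the singularities are roots of unity, which the powers of \<open>x\<close>
  approach only polynomially fast.\<close>

section \<open>Equidistribution of multiples of a badly approximable number\<close>

text \<open>The obstacle is that \<open>Ln \<circ> f\<close> is unbounded, while the Poisson
  approximation is good only for lengths up to b with b / n tending to 0. The cut b about n / (ln
  n)^(1/8) reconciles three demands: the error b / n vanishes; ln (n / b) is negligible against sqrt
  (ln n), so the mean is not shifted; and at most n / b cycles are longer than b, so together they
  contribute only O((ln n)^(1/4 + 1/8 - 1/2)) as long as none of their values exceeds (ln n)^(1/4).
  Larger values are rare because exp (\<kappa> |g m|) has a finite mean for some \<kappa> > 0, which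
  also bounds the cubic remainder of the characteristic function. Equidistribution is therefore
  proved for all test functions of small exponential growth at once: they turn a logarithmic
  singularity into a power singularity of order at most 1/2, which is integrable. The limit
  covariances are uncentred second moments, since Poisson counts with means \<theta> / m and
  coefficients g m have as variance the sum of \<theta> (g m)^2 / m.\<close>

definition badly_approximable :: "real \<Rightarrow> real \<Rightarrow> real \<Rightarrow> bool" where
  "badly_approximable K \<gamma> t \<longleftrightarrow> (\<forall>m::int. \<forall>z::int. m \<noteq> 0 \<longrightarrow> \<bar>of_int m * t - of_int z\<bar> > K / \<bar>of_int m\<bar> powr \<gamma>)"

text \<open>The bound is uniform over all intervals, which later allows cells whose length shrinks
  with n. Half-open intervals can be concatenated without counting a point twice.\<close>

definition low_discrepancy :: "(nat \<Rightarrow> real) \<Rightarrow> real \<Rightarrow> real \<Rightarrow> bool" where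
  "low_discrepancy x C \<delta> \<longleftrightarrow> (\<forall>n u v. 1 \<le> n \<longrightarrow> 0 \<le> u \<longrightarrow> u \<le> v \<longrightarrow> v \<le> 1 \<longrightarrow>
     \<bar>(\<Sum>m=1..n. indicator {u..<v} (x m)) - real n * (v - u)\<bar> \<le> C * real n powr (1 - \<delta>))"

lemma card_int_interval_le:
  fixes A B :: real
  assumes "S \<subseteq> {r :: int. A \<le> of_int r \<and> of_int r < B}" "A \<le> B"
  shows "finite S" "real (card S) \<le> B - A + 1"
proof -
  have sub: "S \<subseteq> {\<lceil>A\<rceil>..<\<lceil>B\<rceil>}" using assms(1) by (auto simp: ceiling_le_iff less_ceiling_iff)
  then show "finite S" using finite_subset by blast
  have "card S \<le> nat (\<lceil>B\<rceil> - \<lceil>A\<rceil>)" using card_mono[OF _ sub] by simp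
  moreover have "\<lceil>A\<rceil> \<le> \<lceil>B\<rceil>" using assms(2) by (rule ceiling_mono)
  ultimately have "real (card S) \<le> of_int \<lceil>B\<rceil> - of_int \<lceil>A\<rceil>" by linarith
  then show "real (card S) \<le> B - A + 1" by linarith
qed

text \<open>Over a block of \<open>q\<close> consecutive indices the points are, up to an error \<open>1 / q\<close>, a
  translate of the multiples of \<open>1 / q\<close>.\<close>

lemma block_count_le:
  fixes t y u v :: real and a :: int and q :: nat
  assumes cop: "coprime a (int q)" and q: "q \<ge> 1" and approx: "\<bar>real q * t - of_int a\<bar> \<le> 1 / real q" and uv: "u \<le> v"
  shows "real (card {i \<in> {1..q}. frac (y + real i * t) \<in> {u..<v}}) \<le> real q * (v - u) + 3"
proof -
  define I where "I = {i \<in> {1..q}. frac (y + real i * t) \<in> {u..<v}}"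
  \<comment> \<open>\<open>r i\<close> is congruent to \<open>i * a\<close> modulo \<open>q\<close>,
    hence injective on a block, and it differs from \<open>q * (frac (y + i * t) - y)\<close> by
    \<open>i * (q * t - a)\<close>, which is at most 1 in absolute value.\<close>
  define r where "r i = int i * a - \<lfloor>y + real i * t\<rfloor> * int q" for i
  have inj: "inj_on r I"
  proof (rule inj_onI)
    fix i j assume ij: "i \<in> I" "j \<in> I" "r i = r j"
    have "(int i - int j) * a = (\<lfloor>y + real i * t\<rfloor> - \<lfloor>y + real j * t\<rfloor>) * int q"
      using ij(3) by (simp add: r_def algebra_simps)
    then have "int q dvd (int i - int j) * a" by simp
    then have "int q dvd int i - int j" using cop by (simp add: coprime_dvd_mult_left_iff coprime_commute)
    moreover have "\<bar>int i - int j\<bar> < int q" using ij(1,2) by (auto simp: I_def)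
    ultimately have "int i - int j = 0" using dvd_imp_le_int[of "int i - int j" "int q"] by fastforce
    then show "i = j" by simp
  qed
  have "r ` I \<subseteq> {r. real q * (u - y) - 1 \<le> of_int r \<and> of_int r < real q * (v - y) + 1}"
  proof
    fix s assume "s \<in> r ` I"
    then obtain i where i: "i \<in> I" "s = r i" by blast
    have iq: "1 \<le> i" "i \<le> q" and fr: "u \<le> frac (y + real i * t)" "frac (y + real i * t) < v"
      using i(1) by (auto simp: I_def)
    have e: "\<bar>real i * (real q * t - of_int a)\<bar> \<le> 1"
    proof -
      have "\<bar>real i * (real q * t - of_int a)\<bar> = real i * \<bar>real q * t - of_int a\<bar>" by (simp add: abs_mult)
      also have "\<dots> \<le> real q * (1 / real q)" using iq approx by (intro mult_mono) auto
      finally show ?thesis using q by simp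
    qed
    have "of_int s = real q * frac (y + real i * t) - real q * y - real i * (real q * t - of_int a)"
      by (simp add: i(2) r_def frac_def algebra_simps)
    moreover have "real q * u \<le> real q * frac (y + real i * t)" "real q * frac (y + real i * t) < real q * v"
      using fr q by auto
    ultimately show "s \<in> {r. real q * (u - y) - 1 \<le> of_int r \<and> of_int r < real q * (v - y) + 1}"
      using e by (simp add: algebra_simps) linarith
  qed
  moreover have "real q * (u - y) - 1 \<le> real q * (v - y) + 1"
    using uv mult_left_mono[of "u - y" "v - y" "real q"] by simp
  ultimately have "real (card (r ` I)) \<le> (real q * (v - y) + 1) - (real q * (u - y) - 1) + 1"
    by (rule card_int_interval_le)
  then have "real (card I) \<le> (real q * (v - y) + 1) - (real q * (u - y) - 1) + 1"
    unfolding card_image[OF inj] .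
  then show ?thesis unfolding I_def by (simp add: algebra_simps)
qed

text \<open>The lower bound is the upper bound for the complement: the q points of the block fall
  into the three intervals cut out by u and v, and the two outer ones hold at most their share plus
  3 each.\<close>

lemma block_count:
  fixes t y u v :: real and a :: int and q :: nat
  assumes *: "coprime a (int q)" "q \<ge> 1" "\<bar>real q * t - of_int a\<bar> \<le> 1 / real q" and uv: "0 \<le> u" "u \<le> v" "v \<le> 1"
  shows "\<bar>real (card {i \<in> {1..q}. frac (y + real i * t) \<in> {u..<v}}) - real q * (v - u)\<bar> \<le> 6"
proof -
  let ?S = "\<lambda>u v. {i \<in> {1..q}. frac (y + real i * t) \<in> {u..<v}}"
  have card3: "card (A \<union> (B \<union> C)) \<le> card A + (card B + card C)" for A B C :: "nat set"
    using card_Un_le[of A "B \<union> C"] card_Un_le[of B C] by linarith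
  have "{1..q} = ?S 0 u \<union> (?S u v \<union> ?S v 1)"
  proof (intro equalityI subsetI)
    fix i assume "i \<in> {1..q}"
    then show "i \<in> ?S 0 u \<union> (?S u v \<union> ?S v 1)"
      using frac_ge_0[of "y + real i * t"] frac_lt_1[of "y + real i * t"] by (simp add: not_le) linarith
  qed auto
  then have "card {1..q} \<le> card (?S 0 u) + (card (?S u v) + card (?S v 1))"
    using card3[of "?S 0 u" "?S u v" "?S v 1"] by (simp only:)
  then have "real q \<le> real (card (?S 0 u)) + real (card (?S u v)) + real (card (?S v 1))" by simp
  moreover note block_count_le[OF *, of 0 u y] block_count_le[OF *, of u v y] block_count_le[OF *, of v 1 y]
  ultimately show ?thesis using uv by (simp add: algebra_simps abs_le_iff)
qed

text \<open>The n indices split into \<open>n div q\<close> full blocks, each off by at most 6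
  whatever its starting offset, and a remainder of fewer than q indices that is bounded
  trivially.\<close>

lemma discrepancy_from_approx:
  fixes t u v :: real and a :: int and q n :: nat
  assumes *: "coprime a (int q)" "q \<ge> 1" "\<bar>real q * t - of_int a\<bar> \<le> 1 / real q" and uv: "0 \<le> u" "u \<le> v" "v \<le> 1"
  shows "\<bar>(\<Sum>m=1..n. indicator {u..<v} (frac (real m * t))) - real n * (v - u)\<bar> \<le> 6 * (real n / real q) + real q"
proof -
  define S :: "nat \<Rightarrow> real" where "S n = (\<Sum>m=1..n. indicator {u..<v} (frac (real m * t)))" for n
  have S_add: "S (k + l) = S k + (\<Sum>i=1..l. indicator {u..<v} (frac (real k * t + real i * t)))" for k l
    by (induction l) (simp_all add: S_def distrib_right add.assoc add.left_commute)
  have block: "\<bar>(\<Sum>i=1..q. indicator {u..<v} (frac (y + real i * t))) - real q * (v - u)\<bar> \<le> 6" for y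
  proof -
    have "(\<Sum>i=1..q. indicator {u..<v} (frac (y + real i * t))) = real (card {i \<in> {1..q}. frac (y + real i * t) \<in> {u..<v}})"
      by (simp add: indicator_def sum.If_cases Int_def)
    then show ?thesis using block_count[OF * uv, of y] by simp
  qed
  have blocks: "\<bar>S (B * q) - real (B * q) * (v - u)\<bar> \<le> 6 * real B" for B
  proof (induction B)
    case (Suc B)
    have "Suc B * q = B * q + q" by simp
    then have "S (Suc B * q) = S (B * q) + (\<Sum>i=1..q. indicator {u..<v} (frac (real (B * q) * t + real i * t)))"
      using S_add[of "B * q" q] by (simp only:)
    moreover have "real (Suc B * q) * (v - u) = real (B * q) * (v - u) + real q * (v - u)"
      by (simp add: algebra_simps)
    moreover have "6 * real (Suc B) = 6 * real B + 6" by simp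
    ultimately show ?case using Suc block[of "real (B * q) * t"] by linarith
  qed (simp add: S_def)
  let ?B = "n div q" and ?r = "n mod q"
  have n: "n = ?B * q + ?r" by simp
  define R :: real where "R = (\<Sum>i=1..?r. indicator {u..<v} (frac (real (?B * q) * t + real i * t)))"
  have R: "0 \<le> R" "R \<le> real ?r"
    using sum_bounded_above[of "{1..?r}" "\<lambda>i. indicator {u..<v} (frac (real (?B * q) * t + real i * t))" "1::real"]
    by (auto simp: R_def indicator_def intro!: sum_nonneg)
  have Sn: "S n = S (?B * q) + R" unfolding R_def using S_add[of "?B * q" ?r] by simp
  have "real n = real (?B * q) + real ?r" using n by (metis of_nat_add)
  then have e: "real n * (v - u) = real (?B * q) * (v - u) + real ?r * (v - u)" by (simp add: distrib_right)
  have r: "0 \<le> real ?r * (v - u)" "real ?r * (v - u) \<le> real ?r" using uv by (auto intro: mult_left_le)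
  have rq: "real ?r \<le> real q" using * by (simp add: less_imp_le)
  have "real ?B \<le> real n / real q" by (rule of_nat_div_le_of_nat)
  then show ?thesis using blocks[of ?B] Sn e r R rq unfolding S_def [symmetric] by linarith
qed

text \<open>Dirichlet's theorem with Q about sqrt n gives a denominator q at most Q. Bad
  approximability forbids a small q, since K / q^\<gamma> has to stay below 1 / Q. So q lies between
  a constant times n^\<delta> and sqrt n, and both terms n / q and q save a power of n.\<close>

lemma low_discrepancy_badly_approximable:
  assumes K: "K > 0" and \<gamma>: "\<gamma> > 0" and t: "badly_approximable K \<gamma> t"
  obtains C \<delta> where "C > 0" "0 < \<delta>" "low_discrepancy (\<lambda>m. frac (real m * t)) C \<delta>"
proof -
  \<comment> \<open>Raising the exponent to at least 1 only weakens the lower bound on q and makes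
    \<delta> at most 1/2, so that sqrt n is absorbed by n^(1 - \<delta>).\<close>
  define g where "g = max \<gamma> 1"
  have g: "g \<ge> 1" "g \<ge> \<gamma>" by (auto simp: g_def)
  define \<delta> where "\<delta> = 1 / (2 * g)"
  define C where "C = 6 * (K / 2) powr (-(1 / g)) + 1"
  have \<delta>: "0 < \<delta>" "\<delta> \<le> 1/2" using g by (auto simp: \<delta>_def)
  have C: "C > 0" using K by (simp add: C_def add_nonneg_pos)
  have "low_discrepancy (\<lambda>m. frac (real m * t)) C \<delta>"
    unfolding low_discrepancy_def
  proof (intro allI impI)
    fix n :: nat and u v :: real
    assume n: "1 \<le> n" and uv: "0 \<le> u" "u \<le> v" "v \<le> 1"
    define Q where "Q = nat \<lfloor>sqrt (real n)\<rfloor>"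
    have s1: "sqrt (real n) \<ge> 1" using n by simp
    have Q: "real Q \<le> sqrt (real n)" "sqrt (real n) / 2 \<le> real Q" "Q > 0"
  proof -
      have "\<lfloor>sqrt (real n)\<rfloor> \<ge> 1" using s1 by (simp add: le_floor_iff)
      then have "real Q = of_int \<lfloor>sqrt (real n)\<rfloor>" "of_int \<lfloor>sqrt (real n)\<rfloor> \<ge> (1::real)"
        by (simp_all add: Q_def)
      then show "real Q \<le> sqrt (real n)" "sqrt (real n) / 2 \<le> real Q" "Q > 0" by linarith+
    qed
    obtain a k where ak: "coprime a k" "0 < k" "k \<le> int Q" "\<bar>of_int k * t - of_int a\<bar> < 1 / real Q"
      using Dirichlet_approx_coprime[OF Q(3), of t] by metis
    define q where "q = nat k"
    have q: "q \<ge> 1" "int q = k" "real q \<le> real Q" using ak by (auto simp: q_def)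
    have appr: "\<bar>real q * t - of_int a\<bar> < 1 / real Q" using ak(4) q(2) by (metis of_int_of_nat_eq)
    have "1 / real Q \<le> 1 / real q" using q Q by (intro divide_left_mono) auto
    then have D: "\<bar>(\<Sum>m=1..n. indicator {u..<v} (frac (real m * t))) - real n * (v - u)\<bar> \<le> 6 * (real n / real q) + real q"
      using appr ak(1) q uv by (intro discrepancy_from_approx) auto
    have "K / real q powr \<gamma> < 1 / real Q"
    proof -
      have "K / \<bar>of_int (int q)\<bar> powr \<gamma> < \<bar>of_int (int q) * t - of_int a\<bar>"
        using t[unfolded badly_approximable_def, rule_format, of "int q" a] q by simp
      then show ?thesis using appr by simp
    qed
    then have "K * real Q < real q powr \<gamma>" using q Q by (simp add: field_simps)
    also have "\<dots> \<le> real q powr g" using q g by (intro powr_mono) auto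
    finally have "K * real Q < real q powr g" .
    moreover have "K * (sqrt (real n) / 2) \<le> K * real Q" using Q(2) K by (intro mult_left_mono) auto
    ultimately have "K / 2 * sqrt (real n) \<le> real q powr g" by simp
    then have "(K / 2 * sqrt (real n)) powr (1 / g) \<le> (real q powr g) powr (1 / g)"
      using K g by (intro powr_mono2) auto
    also have "\<dots> = real q" using q g by (simp add: powr_powr)
    finally have "(K / 2 * sqrt (real n)) powr (1 / g) \<le> real q" .
    moreover have "(K / 2 * sqrt (real n)) powr (1 / g) = (K / 2) powr (1 / g) * real n powr \<delta>"
    proof -
      have "sqrt (real n) = real n powr (1/2)" by (simp add: powr_half_sqrt)
      moreover have "1/2 * (1 / g) = \<delta>" by (simp add: \<delta>_def)
      ultimately show ?thesis using K by (simp only: powr_mult powr_powr)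
    qed
    ultimately have ql: "(K / 2) powr (1 / g) * real n powr \<delta> \<le> real q" by simp
    have "6 * (real n / real q) \<le> 6 * (real n / ((K / 2) powr (1 / g) * real n powr \<delta>))"
      using ql K n q by (intro mult_left_mono divide_left_mono) (auto intro!: mult_pos_pos)
    also have "\<dots> = 6 * (K / 2) powr (-(1 / g)) * real n powr (1 - \<delta>)"
      using n by (simp add: powr_diff powr_minus field_simps)
    finally have 1: "6 * (real n / real q) \<le> 6 * (K / 2) powr (-(1 / g)) * real n powr (1 - \<delta>)" .
    have "real q \<le> real n powr (1/2)" using q Q n by (simp add: powr_half_sqrt)
    also have "\<dots> \<le> real n powr (1 - \<delta>)" using n \<delta> by (intro powr_mono) auto
    finally show "\<bar>(\<Sum>m=1..n. indicator {u..<v} (frac (real m * t))) - real n * (v - u)\<bar> \<le> C * real n powr (1 - \<delta>)"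
      using D 1 by (simp add: C_def distrib_right)
  qed
  then show thesis using that C \<delta> by blast
qed

section \<open>Sums of functions along a low-discrepancy sequence\<close>

definition disc_err :: "(nat \<Rightarrow> real) \<Rightarrow> (real \<Rightarrow> real) \<Rightarrow> nat \<Rightarrow> real \<Rightarrow> real \<Rightarrow> real" where
  "disc_err x \<phi> n a b = (\<Sum>m=1..n. indicator {a..<b} (x m) * \<phi> (x m)) - real n * (LINT s:{a..<b}|lborel. \<phi> s)"

lemma disc_err_empty [simp]: "disc_err x \<phi> n a a = 0"
  by (simp add: disc_err_def set_lebesgue_integral_def)

lemma disc_err_add:
  assumes "a \<le> b" "b \<le> c" "set_integrable lborel {a..<c} \<phi>"
  shows "disc_err x \<phi> n a c = disc_err x \<phi> n a b + disc_err x \<phi> n b c"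
proof -
  have u: "{a..<c} = {a..<b} \<union> {b..<c}" using assms by auto
  have i: "indicator {a..<c} s = (indicator {a..<b} s + indicator {b..<c} s :: real)" for s
    unfolding u by (rule indicator_disj_union) auto
  have "(LINT s:{a..<c}|lborel. \<phi> s) = (LINT s:{a..<b}|lborel. \<phi> s) + (LINT s:{b..<c}|lborel. \<phi> s)"
    unfolding u using assms by (intro set_integral_Un set_integrable_subset[OF assms(3)]) auto
  then show ?thesis unfolding disc_err_def i by (simp add: distrib_right distrib_left sum.distrib)
qed

context
  fixes x :: "nat \<Rightarrow> real" and C \<delta> :: real
  assumes ld: "low_discrepancy x C \<delta>"
begin

lemma disc_bound_nonneg: "n \<ge> 1 \<Longrightarrow> 0 \<le> C * real n powr (1 - \<delta>)"
  using ld[unfolded low_discrepancy_def, rule_format, of n 0 0] by simp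

lemma disc_count:
  assumes "n \<ge> 1" "0 \<le> u" "u \<le> v" "v \<le> 1"
  shows "\<bar>(\<Sum>m=1..n. indicator {u..<v} (x m)) - real n * (v - u)\<bar> \<le> C * real n powr (1 - \<delta>)"
  using ld assms unfolding low_discrepancy_def by blast

text \<open>On a short cell \<phi> is replaced by its value at the left end. The constant part costs
  B times the discrepancy D; the oscillation L * (v - u) is paid for each of the at most n * (v - u)
  + D points and once more in the integral.\<close>

lemma disc_err_cell:
  assumes n: "n \<ge> 1" and uv: "0 \<le> u" "u \<le> v" "v \<le> 1" and L: "L \<ge> 0" and B: "B \<ge> 0"
    and bd: "\<And>s. s \<in> {u..<v} \<Longrightarrow> \<bar>\<phi> s\<bar> \<le> B"
    and lip: "\<And>s t. s \<in> {u..<v} \<Longrightarrow> t \<in> {u..<v} \<Longrightarrow> \<bar>\<phi> s - \<phi> t\<bar> \<le> L * \<bar>s - t\<bar>"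
    and int: "set_integrable lborel {u..<v} \<phi>"
    and D: "D = C * real n powr (1 - \<delta>)"
  shows "\<bar>disc_err x \<phi> n u v\<bar> \<le> B * D + L * (v - u) * D + 2 * real n * L * (v - u)\<^sup>2"
\<comment> \<open>For u = v the cell is empty and \<open>bd\<close> gives no bound at u.\<close>
proof (cases "u = v")
  case True
  have "0 \<le> B * D + L * (v - u) * D + 2 * real n * L * (v - u)\<^sup>2"
    using disc_bound_nonneg[OF n, folded D] uv L B by (intro add_nonneg_nonneg mult_nonneg_nonneg) auto
  then show ?thesis using True by simp
next
  case False
  then have lt: "u < v" using uv by simp
  define w where "w = v - u"
  define N where "N = (\<Sum>m=1..n. indicator {u..<v} (x m) :: real)"
  have w: "w > 0" using lt by (simp add: w_def)
  have N: "\<bar>N - real n * w\<bar> \<le> D" unfolding N_def w_def D by (rule disc_count[OF n uv])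
  have near: "\<bar>\<phi> s - \<phi> u\<bar> \<le> L * w" if "s \<in> {u..<v}" for s
  proof -
    have "\<bar>\<phi> s - \<phi> u\<bar> \<le> L * \<bar>s - u\<bar>" using that lt by (intro lip) auto
    also have "\<dots> \<le> L * w" using that L by (intro mult_left_mono) (auto simp: w_def)
    finally show ?thesis .
  qed
  have cint: "set_integrable lborel {u..<v} (\<lambda>_. c :: real)" for c
    unfolding set_integrable_def by (intro integrable_scaleR_left integrable_real_indicator) (simp_all add: uv emeasure_lborel_Ico)
  have mint: "(LINT s:{u..<v}|lborel. c) = w * c" for c :: real
    using lt by (simp add: set_integral_const w_def)
  have "\<bar>(LINT s:{u..<v}|lborel. \<phi> s) - w * \<phi> u\<bar> = \<bar>LINT s:{u..<v}|lborel. \<phi> s - \<phi> u\<bar>"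
    using set_integral_diff(2)[OF int cint[of "\<phi> u"]] by (simp add: mint)
  also have "\<dots> \<le> (LINT s:{u..<v}|lborel. \<bar>\<phi> s - \<phi> u\<bar>)"
    using integral_abs_bound[of lborel "\<lambda>s. indicator {u..<v} s *\<^sub>R (\<phi> s - \<phi> u)"]
    by (simp add: set_lebesgue_integral_def abs_mult)
  also have "\<dots> \<le> (LINT s:{u..<v}|lborel. L * w)"
    by (intro set_integral_mono set_integrable_abs set_integral_diff(1) int cint near)
  also have "\<dots> = w * (L * w)" by (rule mint)
  finally have I: "\<bar>(LINT s:{u..<v}|lborel. \<phi> s) - w * \<phi> u\<bar> \<le> w * (L * w)" .
  have "\<bar>(\<Sum>m=1..n. indicator {u..<v} (x m) * \<phi> (x m)) - N * \<phi> u\<bar> = \<bar>\<Sum>m=1..n. indicator {u..<v} (x m) * (\<phi> (x m) - \<phi> u)\<bar>"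
    by (simp add: N_def sum_distrib_right right_diff_distrib sum_subtractf)
  also have "\<dots> \<le> (\<Sum>m=1..n. indicator {u..<v} (x m) * (L * w))"
    by (intro order.trans[OF sum_abs] sum_mono) (auto simp: abs_mult indicator_def near)
  also have "\<dots> = N * (L * w)" by (simp add: N_def sum_distrib_right)
  also have "\<dots> \<le> (real n * w + D) * (L * w)" using N L w by (intro mult_right_mono) auto
  finally have S: "\<bar>(\<Sum>m=1..n. indicator {u..<v} (x m) * \<phi> (x m)) - N * \<phi> u\<bar> \<le> (real n * w + D) * (L * w)" .
  have "\<bar>real n * (LINT s:{u..<v}|lborel. \<phi> s) - real n * (w * \<phi> u)\<bar> = real n * \<bar>(LINT s:{u..<v}|lborel. \<phi> s) - w * \<phi> u\<bar>"
    by (simp only: right_diff_distrib [symmetric] abs_mult abs_of_nat)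
  also have "\<dots> \<le> real n * (w * (L * w))" using I by (intro mult_left_mono) auto
  finally have I': "\<bar>real n * (LINT s:{u..<v}|lborel. \<phi> s) - real n * (w * \<phi> u)\<bar> \<le> real n * (w * (L * w))" .
  have "\<bar>(N - real n * w) * \<phi> u\<bar> \<le> D * B"
    unfolding abs_mult using N bd[of u] lt by (intro mult_mono) auto
  then have M: "\<bar>N * \<phi> u - real n * (w * \<phi> u)\<bar> \<le> D * B" by (simp add: algebra_simps)
  have "\<bar>disc_err x \<phi> n u v\<bar> \<le> (real n * w + D) * (L * w) + D * B + real n * (w * (L * w))"
    unfolding disc_err_def using S I' M by linarith
  also have "\<dots> = B * D + L * (v - u) * D + 2 * real n * L * (v - u)\<^sup>2"
    by (simp add: w_def [symmetric] power2_eq_square algebra_simps)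
  finally show ?thesis .
qed

text \<open>The interval is cut into N equal cells of length at most 1 / N and the cell estimate is
  added up. N stays free, to balance N * B * D against n * L / N.\<close>

lemma disc_err_far:
  assumes n: "n \<ge> 1" and uv: "0 \<le> u" "u \<le> v" "v \<le> 1" and L: "L \<ge> 0" and B: "B \<ge> 0"
    and bd: "\<And>s. s \<in> {u..<v} \<Longrightarrow> \<bar>\<phi> s\<bar> \<le> B"
    and lip: "\<And>s t. s \<in> {u..<v} \<Longrightarrow> t \<in> {u..<v} \<Longrightarrow> \<bar>\<phi> s - \<phi> t\<bar> \<le> L * \<bar>s - t\<bar>"
    and int: "set_integrable lborel {u..<v} \<phi>"
    and D: "D = C * real n powr (1 - \<delta>)" and N: "N \<ge> 1"
  shows "\<bar>disc_err x \<phi> n u v\<bar> \<le> real N * B * D + L * D + 2 * real n * L / real N"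
proof -
  define w where "w = (v - u) / real N"
  define T where "T = B * D + L / real N * D + 2 * real n * L / (real N)\<^sup>2"
  have w: "0 \<le> w" "w \<le> 1 / real N" "real N * w = v - u"
    using uv N by (auto simp: w_def divide_right_mono)
  have D0: "D \<ge> 0" unfolding D by (rule disc_bound_nonneg[OF n])
  have cells: "\<bar>disc_err x \<phi> n u (u + real k * w)\<bar> \<le> real k * T" if "k \<le> N" for k
    using that
  proof (induction k)
    case (Suc k)
    have kw: "real (Suc k) * w \<le> real N * w" using Suc w by (intro mult_right_mono) auto
    have s: "real (Suc k) * w = real k * w + w" by (simp add: algebra_simps)
    have k0: "0 \<le> real k * w" using w by simp
    have le: "u + real (Suc k) * w \<le> v" using kw w(3) by linarith
    have sub: "{u..<u + real (Suc k) * w} \<subseteq> {u..<v}" "{u + real k * w..<u + real (Suc k) * w} \<subseteq> {u..<v}"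
      using le k0 by auto
    have "disc_err x \<phi> n u (u + real (Suc k) * w) = disc_err x \<phi> n u (u + real k * w)
        + disc_err x \<phi> n (u + real k * w) (u + real (Suc k) * w)"
      using w s sub by (intro disc_err_add set_integrable_subset[OF int]) auto
    moreover have "\<bar>disc_err x \<phi> n (u + real k * w) (u + real (Suc k) * w)\<bar> \<le>
       B * D + L * (u + real (Suc k) * w - (u + real k * w)) * D + 2 * real n * L * (u + real (Suc k) * w - (u + real k * w))\<^sup>2"
    proof (rule disc_err_cell[OF n _ _ _ L B _ _ _ D])
      show "\<bar>\<phi> r\<bar> \<le> B" if "r \<in> {u + real k * w..<u + real (Suc k) * w}" for r
        using that sub(2) bd by blast
      show "\<bar>\<phi> r - \<phi> t\<bar> \<le> L * \<bar>r - t\<bar>" if "r \<in> {u + real k * w..<u + real (Suc k) * w}" "t \<in> {u + real k * w..<u + real (Suc k) * w}" for r t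
        using that sub(2) lip by blast
      show "set_integrable lborel {u + real k * w..<u + real (Suc k) * w} \<phi>"
        using sub(2) by (intro set_integrable_subset[OF int]) auto
    qed (use k0 uv le s w in auto)
    moreover have "B * D + L * (u + real (Suc k) * w - (u + real k * w)) * D + 2 * real n * L * (u + real (Suc k) * w - (u + real k * w))\<^sup>2 \<le> T"
    proof -
      have "L * w * D \<le> L * (1 / real N) * D" using w L D0 by (intro mult_right_mono mult_left_mono) auto
      moreover have "2 * real n * L * w\<^sup>2 \<le> 2 * real n * L * (1 / real N)\<^sup>2"
        using w L by (intro mult_left_mono power_mono) auto
      moreover have "u + real (Suc k) * w - (u + real k * w) = w" using s by linarith
      ultimately show ?thesis unfolding T_def by (simp add: power_divide)
    qed
    moreover have "real (Suc k) * T = real k * T + T" by (simp add: algebra_simps)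
    ultimately show ?case using Suc by linarith
  qed simp
  have "u + real N * w = v" using w(3) by simp
  then have "\<bar>disc_err x \<phi> n u v\<bar> \<le> real N * T" using cells[of N] by simp
  also have "\<dots> = real N * B * D + L * D + 2 * real n * L / real N"
    using N by (simp add: T_def power2_eq_square field_simps)
  finally show ?thesis .
qed

text \<open>Next to a singularity neither boundedness nor regularity of \<phi> can be expected. The
  sum is controlled by the number of points in the interval and a bound at the sample points alone,
  the integral separately by J.\<close>

lemma disc_err_near:
  assumes n: "n \<ge> 1" and uv: "0 \<le> u" "u \<le> v" "v \<le> 1" and B: "B \<ge> 0"
    and bd: "\<And>m. 1 \<le> m \<Longrightarrow> m \<le> n \<Longrightarrow> x m \<in> {u..<v} \<Longrightarrow> \<bar>\<phi> (x m)\<bar> \<le> B"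
    and I: "(LINT s:{u..<v}|lborel. \<bar>\<phi> s\<bar>) \<le> J"
    and D: "D = C * real n powr (1 - \<delta>)"
  shows "\<bar>disc_err x \<phi> n u v\<bar> \<le> B * (real n * (v - u) + D) + real n * J"
proof -
  have "\<bar>\<Sum>m=1..n. indicator {u..<v} (x m) * \<phi> (x m)\<bar> \<le> (\<Sum>m=1..n. B * indicator {u..<v} (x m))"
    using bd by (intro order.trans[OF sum_abs] sum_mono) (auto simp: abs_mult indicator_def)
  also have "\<dots> = B * (\<Sum>m=1..n. indicator {u..<v} (x m))" by (simp add: sum_distrib_left)
  also have "\<dots> \<le> B * (real n * (v - u) + D)"
    using disc_count[OF n uv] B unfolding D by (intro mult_left_mono) auto
  finally have 1: "\<bar>\<Sum>m=1..n. indicator {u..<v} (x m) * \<phi> (x m)\<bar> \<le> B * (real n * (v - u) + D)" .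
  have "\<bar>LINT s:{u..<v}|lborel. \<phi> s\<bar> \<le> (LINT s:{u..<v}|lborel. \<bar>\<phi> s\<bar>)"
    using integral_abs_bound[of lborel "\<lambda>s. indicator {u..<v} s *\<^sub>R \<phi> s"]
    by (simp add: set_lebesgue_integral_def abs_mult)
  then have "\<bar>LINT s:{u..<v}|lborel. \<phi> s\<bar> \<le> J" using I by linarith
  then have "real n * \<bar>LINT s:{u..<v}|lborel. \<phi> s\<bar> \<le> real n * J" by (intro mult_left_mono) auto
  then have "\<bar>real n * (LINT s:{u..<v}|lborel. \<phi> s)\<bar> \<le> real n * J" by (simp add: abs_mult)
  then show ?thesis using 1 unfolding disc_err_def by linarith
qed

end

text \<open>The hypothesis \<open>cut\<close> removes a piece of length at most \<eta> at one end,
  the disjunction telling which end; on the rest \<phi> is bounded and Lipschitz with constants that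
  are powers of 1 / \<eta>. Taking \<eta> a small negative power of n makes both contributions save
  a power.\<close>

lemma disc_err_singular:
  fixes x :: "nat \<Rightarrow> real"
  assumes ld: "low_discrepancy x C \<delta>" and \<delta>: "\<delta> > 0" and ab: "0 \<le> a" "a \<le> b" "b \<le> 1" and M: "M \<ge> 0"
    and int: "set_integrable lborel {a..<b} \<phi>"
    and growth: "\<exists>M'. \<forall>m\<ge>1. x m \<in> {a..<b} \<longrightarrow> \<bar>\<phi> (x m)\<bar> \<le> M' * real m powr (\<delta> / 12)"
    and cut: "\<And>\<eta>. 0 < \<eta> \<Longrightarrow> \<eta> \<le> 1 \<Longrightarrow> \<exists>u v u' v'. a \<le> u \<and> u \<le> v \<and> v \<le> b \<and> a \<le> u' \<and> u' \<le> v' \<and> v' \<le> b \<and>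
       ((u = a \<and> v = u' \<and> v' = b) \<or> (u' = a \<and> v' = u \<and> v = b)) \<and> v - u \<le> \<eta> \<and>
       (LINT s:{u..<v}|lborel. \<bar>\<phi> s\<bar>) \<le> M * sqrt \<eta> \<and> (\<forall>s\<in>{u'..<v'}. \<bar>\<phi> s\<bar> \<le> M / \<eta>) \<and>
       (\<forall>s\<in>{u'..<v'}. \<forall>t\<in>{u'..<v'}. \<bar>\<phi> s - \<phi> t\<bar> \<le> M / \<eta>\<^sup>2 * \<bar>s - t\<bar>)"
  shows "\<exists>C' \<delta>'. \<delta>' > 0 \<and> (\<forall>n\<ge>1. \<bar>disc_err x \<phi> n a b\<bar> \<le> C' * real n powr (1 - \<delta>'))"
proof -
  define \<rho> where "\<rho> = \<delta> / 6"
  have \<rho>: "\<rho> > 0" "\<delta> = 6 * \<rho>" using \<delta> by (auto simp: \<rho>_def)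
  obtain M0 where M0: "\<And>m. m \<ge> 1 \<Longrightarrow> x m \<in> {a..<b} \<Longrightarrow> \<bar>\<phi> (x m)\<bar> \<le> M0 * real m powr (\<rho> / 2)"
    using growth \<rho> by auto
  define M' where "M' = max M0 0"
  have M': "M' \<ge> 0" "\<And>m. m \<ge> 1 \<Longrightarrow> x m \<in> {a..<b} \<Longrightarrow> \<bar>\<phi> (x m)\<bar> \<le> M' * real m powr (\<rho> / 2)"
  proof -
    fix m :: nat assume "m \<ge> 1" "x m \<in> {a..<b}"
    then have "\<bar>\<phi> (x m)\<bar> \<le> M0 * real m powr (\<rho> / 2)" by (rule M0)
    also have "\<dots> \<le> M' * real m powr (\<rho> / 2)" by (intro mult_right_mono) (auto simp: M'_def)
    finally show "\<bar>\<phi> (x m)\<bar> \<le> M' * real m powr (\<rho> / 2)" .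
  qed (simp add: M'_def)
  have C: "C \<ge> 0" using disc_bound_nonneg[OF ld, of 1] by simp
  define C' where "C' = (2 * M * C + M * C + 2 * M) + (M' * (1 + C) + M)"
  have main: "\<bar>disc_err x \<phi> n a b\<bar> \<le> C' * real n powr (1 - \<rho> / 2)" if n: "n \<ge> 1" for n
  proof -
    \<comment> \<open>With D about n^(1 - 6 \<rho>), the choices \<eta> = n^(-\<rho>) and N about
      n^(4 \<rho>) give far terms n^(1 - \<rho>), n^(1 - 4 \<rho>) and n^(1 - 2 \<rho>). The near
      terms are at most n^(1 - \<rho> / 2), both from the growth n^(\<rho> / 2) of the sampled
      values and from sqrt \<eta>; this worst case is P.\<close>
    define \<eta> where "\<eta> = real n powr (-\<rho>)"
    define N where "N = nat \<lceil>real n powr (4 * \<rho>)\<rceil>"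
    define D where "D = C * real n powr (1 - \<delta>)"
    define P where "P = real n powr (1 - \<rho> / 2)"
    have n1: "real n \<ge> 1" using n by simp
    have le: "real n powr y \<le> P" if "y \<le> 1 - \<rho> / 2" for y
      unfolding P_def using that n1 by (intro powr_mono) auto
    have \<eta>: "0 < \<eta>" "\<eta> \<le> 1" using n1 \<rho> powr_mono[of "-\<rho>" 0 "real n"] by (auto simp: \<eta>_def)
    have Nx: "real n powr (4 * \<rho>) \<ge> 1" using n1 \<rho> by (simp add: ge_one_powr_ge_zero)
    then have "\<lceil>real n powr (4 * \<rho>)\<rceil> \<ge> 1" by linarith
    then have "real N = of_int \<lceil>real n powr (4 * \<rho>)\<rceil>" by (simp add: N_def)
    then have N: "N \<ge> 1" "real n powr (4 * \<rho>) \<le> real N" "real N \<le> 2 * real n powr (4 * \<rho>)"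
      using Nx by linarith+
    have D0: "D \<ge> 0" using C by (simp add: D_def)
    obtain u v u' v' where h: "a \<le> u" "u \<le> v" "v \<le> b" "a \<le> u'" "u' \<le> v'" "v' \<le> b"
      "(u = a \<and> v = u' \<and> v' = b) \<or> (u' = a \<and> v' = u \<and> v = b)" "v - u \<le> \<eta>"
      "(LINT s:{u..<v}|lborel. \<bar>\<phi> s\<bar>) \<le> M * sqrt \<eta>" "\<And>s. s \<in> {u'..<v'} \<Longrightarrow> \<bar>\<phi> s\<bar> \<le> M / \<eta>"
      "\<And>s t. s \<in> {u'..<v'} \<Longrightarrow> t \<in> {u'..<v'} \<Longrightarrow> \<bar>\<phi> s - \<phi> t\<bar> \<le> M / \<eta>\<^sup>2 * \<bar>s - t\<bar>"
      using cut[OF \<eta>] by blast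
    have "disc_err x \<phi> n a b = disc_err x \<phi> n u v + disc_err x \<phi> n u' v'"
      using h(7) disc_err_add[OF _ _ int, where b=u' and n=n and x=x] disc_err_add[OF _ _ int, where b=u and n=n and x=x] h(1-6) by auto
    moreover have "\<bar>disc_err x \<phi> n u v\<bar> \<le> (M' * real n powr (\<rho> / 2)) * (real n * (v - u) + D) + real n * (M * sqrt \<eta>)"
    proof (rule disc_err_near[OF ld n _ h(2) _ _ _ h(9) D_def])
      show "\<bar>\<phi> (x m)\<bar> \<le> M' * real n powr (\<rho> / 2)" if "1 \<le> m" "m \<le> n" "x m \<in> {u..<v}" for m
      proof -
        have "\<bar>\<phi> (x m)\<bar> \<le> M' * real m powr (\<rho> / 2)" using that h by (intro M'(2)) auto
        also have "\<dots> \<le> M' * real n powr (\<rho> / 2)" using that \<rho> M' by (intro mult_left_mono powr_mono2) auto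
        finally show ?thesis .
      qed
    qed (use h ab M' in auto)
    moreover have "(M' * real n powr (\<rho> / 2)) * (real n * (v - u) + D) + real n * (M * sqrt \<eta>) \<le> (M' * (1 + C) + M) * P"
    proof -
      have "real n powr (\<rho> / 2) * (real n * (v - u) + D) \<le> real n powr (\<rho> / 2) * (real n * \<eta> + D)"
        using h by (intro mult_left_mono add_right_mono) auto
      also have "\<dots> = real n powr (\<rho> / 2) * (real n powr 1 * real n powr (-\<rho>)) + C * (real n powr (\<rho> / 2) * real n powr (1 - \<delta>))"
        using n1 by (simp add: \<eta>_def D_def algebra_simps)
      also have "\<dots> = real n powr (1 - \<rho> / 2) + C * real n powr (1 - 6 * \<rho> + \<rho> / 2)"
        unfolding powr_add [symmetric] \<rho>(2) by (simp add: algebra_simps)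
      also have "\<dots> \<le> P + C * P" using \<rho> C by (intro add_mono mult_left_mono le) auto
      finally have "M' * (real n powr (\<rho> / 2) * (real n * (v - u) + D)) \<le> M' * (P + C * P)"
        using M' by (intro mult_left_mono) auto
      moreover have "real n * (M * sqrt \<eta>) = M * P"
      proof -
        have "sqrt \<eta> = real n powr (- \<rho> / 2)"
          by (simp add: \<eta>_def powr_half_sqrt [symmetric] powr_powr)
        moreover have "real n * real n powr (- \<rho> / 2) = P"
          using n1 powr_add[of "real n" 1 "- \<rho> / 2"] by (simp add: P_def)
        ultimately show ?thesis by simp
      qed
      moreover have "(M' * (1 + C) + M) * P = M' * (P + C * P) + M * P" by (simp add: algebra_simps)
      ultimately show ?thesis by (simp only: mult.assoc)
    qed
    moreover have "\<bar>disc_err x \<phi> n u' v'\<bar> \<le> real N * (M / \<eta>) * D + M / \<eta>\<^sup>2 * D + 2 * real n * (M / \<eta>\<^sup>2) / real N"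
      using h ab M \<eta> by (intro disc_err_far[OF ld n _ _ _ _ _ _ _ set_integrable_subset[OF int] D_def N(1)]) auto
    moreover have "real N * (M / \<eta>) * D + M / \<eta>\<^sup>2 * D + 2 * real n * (M / \<eta>\<^sup>2) / real N \<le> (2 * M * C + M * C + 2 * M) * P"
    proof -
      have e1: "1 / \<eta> = real n powr \<rho>" by (simp add: \<eta>_def powr_minus divide_inverse)
      have e2: "1 / \<eta>\<^sup>2 = real n powr (2 * \<rho>)"
        using n1 by (simp add: \<eta>_def powr_minus divide_inverse power_inverse powr_power)
      have "real N * (M / \<eta>) * D \<le> (2 * real n powr (4 * \<rho>)) * (M / \<eta>) * D"
        using N M \<eta> D0 by (intro mult_right_mono) auto
      also have "\<dots> = 2 * M * C * (real n powr (4 * \<rho>) * (1 / \<eta>) * real n powr (1 - \<delta>))"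
        by (simp add: D_def)
      also have "\<dots> = 2 * M * C * real n powr (1 - \<rho>)"
        unfolding e1 powr_add [symmetric] \<rho>(2) by (simp add: algebra_simps)
      also have "\<dots> \<le> 2 * M * C * P" using M C \<rho> by (intro mult_left_mono le) auto
      finally have 1: "real N * (M / \<eta>) * D \<le> 2 * M * C * P" .
      have "M / \<eta>\<^sup>2 * D = M * C * (1 / \<eta>\<^sup>2 * real n powr (1 - \<delta>))" by (simp add: D_def)
      also have "\<dots> = M * C * real n powr (1 - 4 * \<rho>)"
        unfolding e2 powr_add [symmetric] \<rho>(2) by (simp add: algebra_simps)
      also have "\<dots> \<le> M * C * P" using M C \<rho> by (intro mult_left_mono le) auto
      finally have 2: "M / \<eta>\<^sup>2 * D \<le> M * C * P" .
      have "2 * real n * (M / \<eta>\<^sup>2) / real N \<le> 2 * real n * (M / \<eta>\<^sup>2) / real n powr (4 * \<rho>)"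
      proof (intro divide_left_mono mult_pos_pos)
        show "real n powr (4 * \<rho>) \<le> real N" by (rule N(2))
        show "0 < real N" using N(1) by simp
        show "0 < real n powr (4 * \<rho>)" using n1 by simp
      qed (use M in auto)
      also have "\<dots> = 2 * M * (real n powr 1 * (1 / \<eta>\<^sup>2) * real n powr (- (4 * \<rho>)))"
        using n1 by (simp add: powr_minus divide_inverse)
      also have "\<dots> = 2 * M * real n powr (1 - 2 * \<rho>)"
        unfolding e2 powr_add [symmetric] by (simp add: algebra_simps)
      also have "\<dots> \<le> 2 * M * P" using M \<rho> by (intro mult_left_mono le) auto
      finally have 3: "2 * real n * (M / \<eta>\<^sup>2) / real N \<le> 2 * M * P" .
      have "(2 * M * C + M * C + 2 * M) * P = 2 * M * C * P + M * C * P + 2 * M * P" by (simp only: distrib_right)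
      then show ?thesis using 1 2 3 by linarith
    qed
    moreover have "C' * P = (2 * M * C + M * C + 2 * M) * P + (M' * (1 + C) + M) * P"
      unfolding C'_def by (rule distrib_right)
    ultimately show ?thesis unfolding P_def [symmetric] by linarith
  qed
  show ?thesis using main \<rho> by (intro exI[of _ C'] exI[of _ "\<rho> / 2"]) auto
qed

lemma inverse_sqrt_integral:
  assumes "c \<ge> (0::real)"
  shows "has_bochner_integral lborel (\<lambda>s. indicator {0..c} s * s powr (- 1/2)) (2 * sqrt c)"
proof (rule has_bochner_integral_nn_integral)
  have "((\<lambda>s. s powr (-1/2)) has_integral (c powr (-1/2 + 1) / (-1/2 + 1))) {0..c}"
    by (rule has_integral_powr_from_0) (use assms in auto)
  then have "((\<lambda>s. s powr (-1/2)) has_integral (2 * sqrt c)) {0..c}"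
    using assms by (simp add: powr_half_sqrt mult.commute)
  then show "integral\<^sup>N lborel (\<lambda>s. ennreal (indicator {0..c} s * s powr (- 1/2))) = ennreal (2 * sqrt c)"
    by (intro nn_integral_has_integral_lebesgue) auto
qed (use assms in auto)

lemma inverse_sqrt_dist_integral:
  assumes "c \<ge> (0::real)"
  shows "integrable lborel (\<lambda>s. indicator {e - c..e + c} s * \<bar>s - e\<bar> powr (- 1/2))"
    "(LINT s|lborel. indicator {e - c..e + c} s * \<bar>s - e\<bar> powr (- 1/2)) = 4 * sqrt c"
proof -
  let ?k = "\<lambda>s. indicator {0..c} s * s powr (- 1/2)"
  note k = inverse_sqrt_integral[OF assms]
  have 1: "has_bochner_integral lborel (\<lambda>s. ?k (-e + 1 * s)) (2 * sqrt c /\<^sub>R \<bar>1\<bar>)"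
    using k by (subst (asm) lborel_has_bochner_integral_real_affine_iff[of 1 _ _ "-e"]) auto
  have 2: "has_bochner_integral lborel (\<lambda>s. ?k (e + (-1) * s)) (2 * sqrt c /\<^sub>R \<bar>-1\<bar>)"
    using k by (subst (asm) lborel_has_bochner_integral_real_affine_iff[of "-1" _ _ e]) auto
  have "(\<lambda>s. ?k (-e + 1 * s) + ?k (e + (-1) * s)) = (\<lambda>s. indicator {e - c..e + c} s * \<bar>s - e\<bar> powr (- 1/2))"
    using assms by (auto simp: fun_eq_iff indicator_def)
  then have "has_bochner_integral lborel (\<lambda>s. indicator {e - c..e + c} s * \<bar>s - e\<bar> powr (- 1/2)) (2 * sqrt c /\<^sub>R \<bar>1\<bar> + 2 * sqrt c /\<^sub>R \<bar>-1\<bar>)"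
    using has_bochner_integral_add[OF 1 2] by simp
  then show "integrable lborel (\<lambda>s. indicator {e - c..e + c} s * \<bar>s - e\<bar> powr (- 1/2))"
    "(LINT s|lborel. indicator {e - c..e + c} s * \<bar>s - e\<bar> powr (- 1/2)) = 4 * sqrt c"
    by (auto simp: has_bochner_integral_iff)
qed

section \<open>Test functions of exponential growth\<close>

text \<open>Real and imaginary part, their products and exp (c |z|) all belong to this class. The
  second clause is a Lipschitz condition whose constant may grow exponentially, which composition
  with a logarithmic singularity can absorb when c is small.\<close>

definition exp_growth :: "real \<Rightarrow> real \<Rightarrow> (complex \<Rightarrow> real) \<Rightarrow> bool" where
  "exp_growth A c \<psi> \<longleftrightarrow> (\<forall>z. \<bar>\<psi> z\<bar> \<le> A * exp (c * norm z)) \<and>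
     (\<forall>z w. \<bar>\<psi> z - \<psi> w\<bar> \<le> A * norm (z - w) * (exp (c * norm z) + exp (c * norm w)))"

text \<open>The threshold \<open>c0\<close> does not depend on \<psi>, so several test functions can
  be used with one common c. Integrability is included because errors on adjacent intervals can be
  added only for integrable functions.\<close>

definition equidistributes :: "(nat \<Rightarrow> real) \<Rightarrow> (real \<Rightarrow> complex) \<Rightarrow> real \<Rightarrow> real \<Rightarrow> bool" where
  "equidistributes x G a b \<longleftrightarrow> (\<exists>c0>0. \<forall>c A \<psi>. 0 < c \<longrightarrow> c \<le> c0 \<longrightarrow> exp_growth A c \<psi> \<longrightarrow>
     set_integrable lborel {a..<b} (\<lambda>s. \<psi> (G s)) \<and>
     (\<exists>C \<delta>. \<delta> > 0 \<and> (\<forall>n\<ge>1. \<bar>disc_err x (\<lambda>s. \<psi> (G s)) n a b\<bar> \<le> C * real n powr (1 - \<delta>))))"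

text \<open>Adjacent intervals are glued with the smaller threshold and the smaller exponent. This
  closure property is what a bisection argument needs.\<close>

lemma equidistributes_trans:
  assumes "equidistributes x G a b" "equidistributes x G b c" "a \<le> b" "b \<le> c"
  shows "equidistributes x G a c"
proof -
  obtain c1 where c1: "c1 > 0" "\<And>c A \<psi>. 0 < c \<Longrightarrow> c \<le> c1 \<Longrightarrow> exp_growth A c \<psi> \<Longrightarrow>
     set_integrable lborel {a..<b} (\<lambda>s. \<psi> (G s)) \<and>
     (\<exists>C \<delta>. \<delta> > 0 \<and> (\<forall>n\<ge>1. \<bar>disc_err x (\<lambda>s. \<psi> (G s)) n a b\<bar> \<le> C * real n powr (1 - \<delta>)))"
    using assms(1) unfolding equidistributes_def by auto
  obtain c2 where c2: "c2 > 0" "\<And>c' A \<psi>. 0 < c' \<Longrightarrow> c' \<le> c2 \<Longrightarrow> exp_growth A c' \<psi> \<Longrightarrow>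
     set_integrable lborel {b..<c} (\<lambda>s. \<psi> (G s)) \<and>
     (\<exists>C \<delta>. \<delta> > 0 \<and> (\<forall>n\<ge>1. \<bar>disc_err x (\<lambda>s. \<psi> (G s)) n b c\<bar> \<le> C * real n powr (1 - \<delta>)))"
    using assms(2) unfolding equidistributes_def by auto
  have u: "{a..<c} = {a..<b} \<union> {b..<c}" using assms by auto
  show ?thesis unfolding equidistributes_def
  proof (rule exI[of _ "min c1 c2"], intro conjI allI impI)
    show "min c1 c2 > 0" using c1 c2 by simp
    fix c' A \<psi> assume c': "0 < c'" "c' \<le> min c1 c2" "exp_growth A c' \<psi>"
    have 1: "set_integrable lborel {a..<b} (\<lambda>s. \<psi> (G s))" and 2: "set_integrable lborel {b..<c} (\<lambda>s. \<psi> (G s))"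
      using c1(2) c2(2) c' by auto
    show int: "set_integrable lborel {a..<c} (\<lambda>s. \<psi> (G s))" unfolding u by (rule set_integrable_Un[OF 1 2]) auto
    obtain C1 \<delta>1 where h1: "\<delta>1 > 0" "\<And>n. n \<ge> 1 \<Longrightarrow> \<bar>disc_err x (\<lambda>s. \<psi> (G s)) n a b\<bar> \<le> C1 * real n powr (1 - \<delta>1)"
      using c1(2)[of c' A \<psi>] c' by auto
    obtain C2 \<delta>2 where h2: "\<delta>2 > 0" "\<And>n. n \<ge> 1 \<Longrightarrow> \<bar>disc_err x (\<lambda>s. \<psi> (G s)) n b c\<bar> \<le> C2 * real n powr (1 - \<delta>2)"
      using c2(2)[of c' A \<psi>] c' by auto
    have "\<bar>disc_err x (\<lambda>s. \<psi> (G s)) n a c\<bar> \<le> (\<bar>C1\<bar> + \<bar>C2\<bar>) * real n powr (1 - min \<delta>1 \<delta>2)" if n: "n \<ge> 1" for n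
    proof -
      have "C1 * real n powr (1 - \<delta>1) \<le> \<bar>C1\<bar> * real n powr (1 - min \<delta>1 \<delta>2)"
        using n by (intro mult_mono powr_mono) auto
      moreover have "C2 * real n powr (1 - \<delta>2) \<le> \<bar>C2\<bar> * real n powr (1 - min \<delta>1 \<delta>2)"
        using n by (intro mult_mono powr_mono) auto
      ultimately show ?thesis using h1(2)[OF n] h2(2)[OF n]
        unfolding disc_err_add[OF assms(3,4) int] distrib_right by linarith
    qed
    then show "\<exists>C \<delta>. \<delta> > 0 \<and> (\<forall>n\<ge>1. \<bar>disc_err x (\<lambda>s. \<psi> (G s)) n a c\<bar> \<le> C * real n powr (1 - \<delta>))"
      using h1(1) h2(1) by (intro exI[of _ "\<bar>C1\<bar> + \<bar>C2\<bar>"] exI[of _ "min \<delta>1 \<delta>2"]) auto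
  qed
qed

text \<open>A singularity of order 1/2 at the end e is integrable, with mass at most 4 M sqrt \<eta>
  within distance \<eta>; farther away \<phi> is at most M / \<eta>, as \<eta> is at most 1. The
  bounds leave out the point e itself; a sample point that hits it is covered by
  \<open>growth\<close>.\<close>

lemma disc_err_endpoint_singularity:
  fixes x :: "nat \<Rightarrow> real"
  assumes ld: "low_discrepancy x C \<delta>" and \<delta>: "\<delta> > 0" and ab: "0 \<le> a" "a \<le> b" "b \<le> 1" and M: "M \<ge> 0"
    and e: "e = a \<or> e = b"
    and growth: "\<exists>M'. \<forall>m\<ge>1. x m \<in> {a..<b} \<longrightarrow> \<bar>\<phi> (x m)\<bar> \<le> M' * real m powr (\<delta> / 12)"
    and bd: "\<And>s. s \<in> {a..<b} \<Longrightarrow> s \<noteq> e \<Longrightarrow> \<bar>\<phi> s\<bar> \<le> M * \<bar>s - e\<bar> powr (- 1/2)"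
    and lip: "\<And>s t. s \<in> {a..<b} \<Longrightarrow> t \<in> {a..<b} \<Longrightarrow> s \<noteq> e \<Longrightarrow> t \<noteq> e \<Longrightarrow>
      \<bar>\<phi> s - \<phi> t\<bar> \<le> M * \<bar>s - t\<bar> / (min \<bar>s - e\<bar> \<bar>t - e\<bar>)\<^sup>2"
  shows "set_integrable lborel {a..<b} \<phi>"
    "\<exists>C' \<delta>'. \<delta>' > 0 \<and> (\<forall>n\<ge>1. \<bar>disc_err x \<phi> n a b\<bar> \<le> C' * real n powr (1 - \<delta>'))"
proof -
  have lip': "\<bar>\<phi> s - \<phi> t\<bar> \<le> M / \<eta>\<^sup>2 * \<bar>s - t\<bar>"
    if "s \<in> {a..<b}" "t \<in> {a..<b}" "\<eta> \<le> \<bar>s - e\<bar>" "\<eta> \<le> \<bar>t - e\<bar>" "\<eta> > 0" for s t \<eta>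
  proof -
    have "\<bar>\<phi> s - \<phi> t\<bar> \<le> M * \<bar>s - t\<bar> / (min \<bar>s - e\<bar> \<bar>t - e\<bar>)\<^sup>2" using that by (intro lip) auto
    also have "\<dots> \<le> M * \<bar>s - t\<bar> / \<eta>\<^sup>2"
      using that M by (intro divide_left_mono power_mono mult_nonneg_nonneg mult_pos_pos zero_less_power) auto
    finally show ?thesis by simp
  qed
  \<comment> \<open>The Lipschitz bound gives continuity on the open interval, which supplies the
    measurability needed for integrability.\<close>
  have cont: "continuous_on {a<..<b} \<phi>"
  proof (rule continuous_onI)
    fix s r :: real assume s: "s \<in> {a<..<b}" and r: "r > 0"
    define \<eta> where "\<eta> = \<bar>s - e\<bar> / 2"
    have \<eta>: "\<eta> > 0" using s e by (auto simp: \<eta>_def)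
    have K: "M / \<eta>\<^sup>2 + 1 > 0" using M by (simp add: add_nonneg_pos)
    define d where "d = min \<eta> (r / (M / \<eta>\<^sup>2 + 1))"
    have "dist (\<phi> t) (\<phi> s) \<le> r" if t: "t \<in> {a<..<b}" "dist t s < d" for t
    proof -
      have ts: "\<bar>t - s\<bar> < \<eta>" "\<bar>t - s\<bar> \<le> r / (M / \<eta>\<^sup>2 + 1)" using t by (auto simp: d_def dist_real_def)
      have "2 * \<eta> = \<bar>s - e\<bar>" by (simp add: \<eta>_def)
      then have "\<eta> \<le> \<bar>t - e\<bar>" "\<eta> \<le> \<bar>s - e\<bar>" using ts(1) \<eta> by linarith+
      then have "\<bar>\<phi> t - \<phi> s\<bar> \<le> M / \<eta>\<^sup>2 * \<bar>t - s\<bar>" using t s \<eta> by (intro lip') auto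
      also have "\<dots> \<le> (M / \<eta>\<^sup>2 + 1) * \<bar>t - s\<bar>" by (simp add: distrib_right)
      also have "\<dots> \<le> (M / \<eta>\<^sup>2 + 1) * (r / (M / \<eta>\<^sup>2 + 1))" using ts(2) K by (intro mult_left_mono) auto
      also have "\<dots> = r" using K by simp
      finally show ?thesis by (simp add: dist_real_def)
    qed
    moreover have "d > 0" using \<eta> r K by (simp add: d_def)
    ultimately show "\<exists>d>0. \<forall>t\<in>{a<..<b}. dist t s < d \<longrightarrow> dist (\<phi> t) (\<phi> s) \<le> r"
      by (intro exI[of _ d] conjI ballI impI) simp_all
  qed
  have meas: "set_borel_measurable lborel {a<..<b} \<phi>"
    using borel_measurable_continuous_on_indicator[OF _ cont] by (simp add: set_borel_measurable_def)
  have "set_integrable lborel {a<..<b} \<phi>"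
    unfolding set_integrable_def
  proof (rule Bochner_Integration.integrable_bound)
    show "integrable lborel (\<lambda>s. M * (indicator {e - 1..e + 1} s * \<bar>s - e\<bar> powr (- 1/2)))"
      by (intro integrable_mult_right inverse_sqrt_dist_integral) simp
    show "(\<lambda>s. indicator {a<..<b} s *\<^sub>R \<phi> s) \<in> borel_measurable lborel"
      using meas by (simp add: set_borel_measurable_def)
    show "AE s in lborel. norm (indicator {a<..<b} s *\<^sub>R \<phi> s) \<le> norm (M * (indicator {e - 1..e + 1} s * \<bar>s - e\<bar> powr (- 1/2)))"
    proof (rule AE_I2)
      fix s
      show "norm (indicator {a<..<b} s *\<^sub>R \<phi> s) \<le> norm (M * (indicator {e - 1..e + 1} s * \<bar>s - e\<bar> powr (- 1/2)))"
      proof (cases "s \<in> {a<..<b}")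
        case True
        then have "s \<in> {e - 1..e + 1}" "s \<noteq> e" using e ab by auto
        then show ?thesis using True bd[of s] M by (simp add: abs_mult)
      qed simp
    qed
  qed
  \<comment> \<open>This difference contains at most the point a, so \<phi> may be replaced there by
    a constant.\<close>
  moreover have "set_integrable lborel ({a..<b} - {a<..<b}) \<phi>"
  proof -
    have "set_integrable lborel {a..<b} (\<lambda>_. \<phi> a)"
      unfolding set_integrable_def
      by (intro integrable_scaleR_left integrable_real_indicator) (simp_all add: ab emeasure_lborel_Ico)
    then have "set_integrable lborel ({a..<b} - {a<..<b}) (\<lambda>_. \<phi> a)"
      by (rule set_integrable_subset) auto
    moreover have "set_integrable lborel ({a..<b} - {a<..<b}) \<phi> \<longleftrightarrow> set_integrable lborel ({a..<b} - {a<..<b}) (\<lambda>_. \<phi> a)"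
    proof (rule set_integrable_cong)
      fix s assume "s \<in> {a..<b} - {a<..<b}"
      then have "s = a" by auto
      then show "\<phi> s = \<phi> a" by simp
    qed simp_all
    ultimately show ?thesis by iprover
  qed
  ultimately have "set_integrable lborel ({a<..<b} \<union> ({a..<b} - {a<..<b})) \<phi>"
    by (rule set_integrable_Un) auto
  moreover have "{a<..<b} \<union> ({a..<b} - {a<..<b}) = {a..<b}" by auto
  ultimately show int: "set_integrable lborel {a..<b} \<phi>" by simp
  have near: "(LINT s:{u..<v}|lborel. \<bar>\<phi> s\<bar>) \<le> (4 * M) * sqrt \<eta>"
    if "{u..<v} \<subseteq> {a..<b}" "{u..<v} \<subseteq> {e - \<eta>..e + \<eta>}" "\<eta> > 0" for u v \<eta>
  proof -
    have "set_integrable lborel {u..<v} \<phi>" using that by (intro set_integrable_subset[OF int]) auto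
    then have "integrable lborel (\<lambda>s. indicator {u..<v} s *\<^sub>R \<bar>\<phi> s\<bar>)"
      using set_integrable_abs unfolding set_integrable_def by blast
    then have "(LINT s:{u..<v}|lborel. \<bar>\<phi> s\<bar>) \<le> (LINT s|lborel. M * (indicator {e - \<eta>..e + \<eta>} s * \<bar>s - e\<bar> powr (- 1/2)))"
      unfolding set_lebesgue_integral_def
    proof (rule integral_mono_AE)
      show "integrable lborel (\<lambda>s. M * (indicator {e - \<eta>..e + \<eta>} s * \<bar>s - e\<bar> powr (- 1/2)))"
        by (intro integrable_mult_right inverse_sqrt_dist_integral) (use that in simp)
      show "AE s in lborel. indicator {u..<v} s *\<^sub>R \<bar>\<phi> s\<bar> \<le> M * (indicator {e - \<eta>..e + \<eta>} s * \<bar>s - e\<bar> powr (- 1/2))"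
        using AE_lborel_singleton[of e]
      proof eventually_elim
        case (elim s)
        show ?case
        proof (cases "s \<in> {u..<v}")
          case True
          then have "s \<in> {a..<b}" "s \<in> {e - \<eta>..e + \<eta>}" using that by auto
          then show ?thesis using True bd[of s] elim by simp
        qed (use M in simp)
      qed
    qed
    also have "\<dots> = M * (4 * sqrt \<eta>)"
      using inverse_sqrt_dist_integral(2)[of \<eta> e] that by simp
    finally show ?thesis by simp
  qed
  have far: "\<bar>\<phi> s\<bar> \<le> (4 * M) / \<eta>" if "s \<in> {a..<b}" "\<eta> \<le> \<bar>s - e\<bar>" "0 < \<eta>" "\<eta> \<le> 1" for s \<eta>
  proof -
    have "\<bar>\<phi> s\<bar> \<le> M * \<bar>s - e\<bar> powr (- 1/2)" using that by (intro bd) auto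
    also have "\<dots> \<le> M * \<eta> powr (- 1/2)" using that M by (intro mult_left_mono powr_mono2') auto
    also have "\<dots> \<le> M * \<eta> powr (- 1)" using that M powr_mono'[of "-1" "-1/2" \<eta>] by (intro mult_left_mono) auto
    also have "\<dots> = M / \<eta>" using that by (simp add: powr_minus divide_inverse)
    also have "\<dots> \<le> (4 * M) / \<eta>" using that M by (intro divide_right_mono) auto
    finally show ?thesis .
  qed
  have lip4: "\<bar>\<phi> s - \<phi> t\<bar> \<le> (4 * M) / \<eta>\<^sup>2 * \<bar>s - t\<bar>"
    if "s \<in> {a..<b}" "t \<in> {a..<b}" "\<eta> \<le> \<bar>s - e\<bar>" "\<eta> \<le> \<bar>t - e\<bar>" "\<eta> > 0" for s t \<eta>
  proof -
    have "M / \<eta>\<^sup>2 * \<bar>s - t\<bar> \<le> (4 * M) / \<eta>\<^sup>2 * \<bar>s - t\<bar>" using M by (intro mult_right_mono divide_right_mono) auto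
    then show ?thesis using lip'[OF that] by linarith
  qed
  show "\<exists>C' \<delta>'. \<delta>' > 0 \<and> (\<forall>n\<ge>1. \<bar>disc_err x \<phi> n a b\<bar> \<le> C' * real n powr (1 - \<delta>'))"
  proof (rule disc_err_singular[OF ld \<delta> ab _ int growth])
    show "4 * M \<ge> 0" using M by simp
    fix \<eta> :: real assume \<eta>: "0 < \<eta>" "\<eta> \<le> 1"
    \<comment> \<open>A piece of length \<eta> at e is cut off. When b - a is smaller than \<eta>,
      \<open>min\<close> and \<open>max\<close> make it the whole interval and leave the far piece
      empty.\<close>
    define u where "u = (if e = a then a else max a (b - \<eta>))"
    define v where "v = (if e = a then min b (a + \<eta>) else b)"
    define u' where "u' = (if e = a then v else a)"
    define v' where "v' = (if e = a then b else u)"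
    have ord: "a \<le> u" "u \<le> v" "v \<le> b" "a \<le> u'" "u' \<le> v'" "v' \<le> b" "v - u \<le> \<eta>"
      "(u = a \<and> v = u' \<and> v' = b) \<or> (u' = a \<and> v' = u \<and> v = b)"
      using ab \<eta> by (auto simp: u_def v_def u'_def v'_def)
    have "{u..<v} \<subseteq> {e - \<eta>..e + \<eta>}" using \<eta> e by (auto simp: u_def v_def)
    then have 1: "(LINT s:{u..<v}|lborel. \<bar>\<phi> s\<bar>) \<le> 4 * M * sqrt \<eta>"
      using ord \<eta> by (intro near) auto
    have d: "s \<in> {a..<b}" "\<eta> \<le> \<bar>s - e\<bar>" if "s \<in> {u'..<v'}" for s
    proof -
      show "s \<in> {a..<b}" using that ord by simp
      show "\<eta> \<le> \<bar>s - e\<bar>"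
      proof (cases "e = a")
        case True
        then have "min b (a + \<eta>) \<le> s" "s < b" using that by (simp_all add: u'_def v'_def v_def)
        then show ?thesis using True by linarith
      next
        case False
        then have "a \<le> s" "s < max a (b - \<eta>)" "e = b" using that e by (simp_all add: u'_def v'_def u_def)
        then show ?thesis by linarith
      qed
    qed
    have 2: "\<forall>s\<in>{u'..<v'}. \<bar>\<phi> s\<bar> \<le> 4 * M / \<eta>" using d far \<eta> by blast
    have 3: "\<forall>s\<in>{u'..<v'}. \<forall>t\<in>{u'..<v'}. \<bar>\<phi> s - \<phi> t\<bar> \<le> 4 * M / \<eta>\<^sup>2 * \<bar>s - t\<bar>" using d lip4 \<eta> by blast
    show "\<exists>u v u' v'. a \<le> u \<and> u \<le> v \<and> v \<le> b \<and> a \<le> u' \<and> u' \<le> v' \<and> v' \<le> b \<and>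
       ((u = a \<and> v = u' \<and> v' = b) \<or> (u' = a \<and> v' = u \<and> v = b)) \<and> v - u \<le> \<eta> \<and>
       (LINT s:{u..<v}|lborel. \<bar>\<phi> s\<bar>) \<le> 4 * M * sqrt \<eta> \<and> (\<forall>s\<in>{u'..<v'}. \<bar>\<phi> s\<bar> \<le> 4 * M / \<eta>) \<and>
       (\<forall>s\<in>{u'..<v'}. \<forall>t\<in>{u'..<v'}. \<bar>\<phi> s - \<phi> t\<bar> \<le> 4 * M / \<eta>\<^sup>2 * \<bar>s - t\<bar>)"
      by (rule exI[of _ u], rule exI[of _ v], rule exI[of _ u'], rule exI[of _ v'], intro conjI ord 1 2 3)
  qed
qed

lemma equidistributes_log_piece:
  fixes x :: "nat \<Rightarrow> real" and G :: "real \<Rightarrow> complex"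
  assumes ld: "low_discrepancy x C \<delta>" and \<delta>: "\<delta> > 0" and ab: "0 \<le> a" "a \<le> b" "b \<le> 1"
    and e: "e = a \<or> e = b" and k: "k \<ge> 0" and L: "L \<ge> 0"
    and G1: "\<And>s. s \<in> {a..<b} \<Longrightarrow> s \<noteq> e \<Longrightarrow> norm (G s) \<le> k * \<bar>ln \<bar>s - e\<bar>\<bar> + B"
    and G2: "\<And>s t. s \<in> {a..<b} \<Longrightarrow> t \<in> {a..<b} \<Longrightarrow> s \<noteq> e \<Longrightarrow> t \<noteq> e \<Longrightarrow>
       norm (G s - G t) \<le> L * \<bar>s - t\<bar> / min \<bar>s - e\<bar> \<bar>t - e\<bar>"
    and G3: "\<And>m. m \<ge> 1 \<Longrightarrow> x m \<in> {a..<b} \<Longrightarrow> norm (G (x m)) \<le> \<gamma> * ln (real m) + B'" and \<gamma>: "\<gamma> \<ge> 0"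
  shows "equidistributes x G a b"
proof -
  \<comment> \<open>Adding 1 to k and \<gamma> keeps the quotients meaningful when these are
    0.\<close>
  define c0 where "c0 = min (1 / (2 * (k + 1))) (\<delta> / (12 * (\<gamma> + 1)))"
  have c0: "c0 > 0" using k \<gamma> \<delta> by (simp add: c0_def)
  show ?thesis unfolding equidistributes_def
  proof (rule exI[of _ c0], intro conjI allI impI)
    show "c0 > 0" by (rule c0)
    fix c A \<psi> assume c: "0 < c" "c \<le> c0" and \<psi>: "exp_growth A c \<psi>"
    have "c \<le> 1 / (2 * (k + 1))" "c \<le> \<delta> / (12 * (\<gamma> + 1))" using c by (auto simp: c0_def)
    then have ck: "c * k \<le> 1/2" and c\<gamma>: "c * \<gamma> \<le> \<delta> / 12"
    proof -
      have "c * (k + 1) \<le> 1/2" using \<open>c \<le> 1 / (2 * (k + 1))\<close> k by (simp add: field_simps)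
      then show "c * k \<le> 1/2" using c by (simp add: distrib_left)
      have "c * (\<gamma> + 1) \<le> \<delta> / 12" using \<open>c \<le> \<delta> / (12 * (\<gamma> + 1))\<close> \<gamma> by (simp add: field_simps)
      then show "c * \<gamma> \<le> \<delta> / 12" using c by (simp add: distrib_left)
    qed
    have A: "A \<ge> 0" using \<psi>[unfolded exp_growth_def, THEN conjunct1, rule_format, of 0] by simp
    have \<psi>1: "\<bar>\<psi> z\<bar> \<le> A * exp (c * norm z)" for z using \<psi> by (auto simp: exp_growth_def)
    have \<psi>2: "\<bar>\<psi> z - \<psi> w\<bar> \<le> A * norm (z - w) * (exp (c * norm z) + exp (c * norm w))" for z w
      using \<psi> by (auto simp: exp_growth_def)
    have ex: "exp (c * norm (G s)) \<le> exp (c * B) * \<bar>s - e\<bar> powr (- 1/2)" if s: "s \<in> {a..<b}" "s \<noteq> e" for s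
    proof -
      have d: "0 < \<bar>s - e\<bar>" "\<bar>s - e\<bar> \<le> 1" using s e ab by auto
      have "c * norm (G s) \<le> c * (k * \<bar>ln \<bar>s - e\<bar>\<bar> + B)" using c s by (intro mult_left_mono G1) auto
      also have "\<dots> = c * B + (c * k) * (- ln \<bar>s - e\<bar>)" using d by (simp add: algebra_simps)
      also have "\<dots> \<le> c * B + (1/2) * (- ln \<bar>s - e\<bar>)" using d ck by (intro add_left_mono mult_right_mono) auto
      finally have "exp (c * norm (G s)) \<le> exp (c * B + (1/2) * (- ln \<bar>s - e\<bar>))" by simp
      also have "\<dots> = exp (c * B) * \<bar>s - e\<bar> powr (- 1/2)" using d by (simp add: exp_add [symmetric] powr_def)
      finally show ?thesis .
    qed
    define M where "M = A * exp (c * B) * (1 + 2 * L)"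
    have M: "M \<ge> 0" using A L by (simp add: M_def)
    have bd: "\<bar>\<psi> (G s)\<bar> \<le> M * \<bar>s - e\<bar> powr (- 1/2)" if s: "s \<in> {a..<b}" "s \<noteq> e" for s
    proof -
      have "\<bar>\<psi> (G s)\<bar> \<le> A * exp (c * norm (G s))" by (rule \<psi>1)
      also have "\<dots> \<le> A * (exp (c * B) * \<bar>s - e\<bar> powr (- 1/2))" using A ex[OF s] by (rule mult_left_mono[rotated])
      also have "\<dots> = (A * exp (c * B) * \<bar>s - e\<bar> powr (- 1/2)) * 1" by simp
      also have "\<dots> \<le> (A * exp (c * B) * \<bar>s - e\<bar> powr (- 1/2)) * (1 + 2 * L)" using A L by (intro mult_left_mono) auto
      finally show ?thesis by (simp add: M_def mult_ac)
    qed
    have lip: "\<bar>\<psi> (G s) - \<psi> (G t)\<bar> \<le> M * \<bar>s - t\<bar> / (min \<bar>s - e\<bar> \<bar>t - e\<bar>)\<^sup>2"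
      if st: "s \<in> {a..<b}" "t \<in> {a..<b}" "s \<noteq> e" "t \<noteq> e" for s t
    proof -
      define d where "d = min \<bar>s - e\<bar> \<bar>t - e\<bar>"
      have d: "0 < d" "d \<le> 1" "d \<le> \<bar>s - e\<bar>" "d \<le> \<bar>t - e\<bar>" using st e ab by (auto simp: d_def)
      have p: "r powr (- 1/2) \<le> 1 / d" if "d \<le> r" for r
      proof -
        have "r powr (- 1/2) \<le> d powr (- 1/2)" using that d by (intro powr_mono2') auto
        also have "\<dots> \<le> d powr (- 1)" using d powr_mono'[of "-1" "-1/2" d] by auto
        also have "\<dots> = 1 / d" using d by (simp add: powr_minus divide_inverse)
        finally show ?thesis .
      qed
      have "exp (c * norm (G s)) + exp (c * norm (G t)) \<le> exp (c * B) * (1 / d) + exp (c * B) * (1 / d)"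
        using st d by (intro add_mono order.trans[OF ex] mult_left_mono p) auto
      then have e2: "exp (c * norm (G s)) + exp (c * norm (G t)) \<le> 2 * exp (c * B) / d" by simp
      have "\<bar>\<psi> (G s) - \<psi> (G t)\<bar> \<le> A * norm (G s - G t) * (exp (c * norm (G s)) + exp (c * norm (G t)))" by (rule \<psi>2)
      also have "\<dots> \<le> A * (L * \<bar>s - t\<bar> / d) * (2 * exp (c * B) / d)"
        using A L d st e2 G2[OF st] unfolding d_def [symmetric] by (intro mult_mono mult_left_mono mult_nonneg_nonneg) auto
      also have "\<dots> = (A * exp (c * B) * \<bar>s - t\<bar> / d\<^sup>2) * (2 * L)" by (simp add: power2_eq_square)
      also have "\<dots> \<le> (A * exp (c * B) * \<bar>s - t\<bar> / d\<^sup>2) * (1 + 2 * L)" using A d by (intro mult_left_mono) auto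
      also have "\<dots> = M * \<bar>s - t\<bar> / d\<^sup>2" by (simp add: M_def)
      finally show ?thesis by (simp add: d_def)
    qed
    have growth: "\<exists>M'. \<forall>m\<ge>1. x m \<in> {a..<b} \<longrightarrow> \<bar>\<psi> (G (x m))\<bar> \<le> M' * real m powr (\<delta> / 12)"
    proof (intro exI[of _ "A * exp (c * B')"] allI impI)
      fix m :: nat assume m: "m \<ge> 1" "x m \<in> {a..<b}"
      have "c * norm (G (x m)) \<le> c * (\<gamma> * ln (real m) + B')" using c m by (intro mult_left_mono G3) auto
      also have "\<dots> = c * B' + (c * \<gamma>) * ln (real m)" by (simp add: algebra_simps)
      also have "\<dots> \<le> c * B' + \<delta> / 12 * ln (real m)" using c\<gamma> m by (intro add_left_mono mult_right_mono) auto
      finally have "exp (c * norm (G (x m))) \<le> exp (c * B' + \<delta> / 12 * ln (real m))" by simp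
      also have "\<dots> = exp (c * B') * real m powr (\<delta> / 12)" using m by (simp add: exp_add powr_def)
      finally have "A * exp (c * norm (G (x m))) \<le> A * (exp (c * B') * real m powr (\<delta> / 12))"
        using A by (intro mult_left_mono) auto
      then show "\<bar>\<psi> (G (x m))\<bar> \<le> A * exp (c * B') * real m powr (\<delta> / 12)"
        using \<psi>1[of "G (x m)"] by (simp add: mult.assoc)
    qed
    note res = disc_err_endpoint_singularity[OF ld \<delta> ab M e growth bd lip]
    show "set_integrable lborel {a..<b} (\<lambda>s. \<psi> (G s))" by (rule res(1))
    show "\<exists>C \<delta>. \<delta> > 0 \<and> (\<forall>n\<ge>1. \<bar>disc_err x (\<lambda>s. \<psi> (G s)) n a b\<bar> \<le> C * real n powr (1 - \<delta>))" by (rule res(2))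
  qed
qed

section \<open>Logarithms of real-analytic functions on the circle\<close>

lemma powser_factor_order:
  fixes a :: "nat \<Rightarrow> 'a::real_normed_field"
  assumes "(\<lambda>j. a j * y ^ j) sums S" "y \<noteq> 0" "\<And>j. j < k \<Longrightarrow> a j = 0"
  shows "(\<lambda>j. a (j + k) * y ^ j) sums (S / y ^ k)"
proof -
  have "(\<Sum>j<k. a j * y ^ j) = 0" using assms(3) by (intro sum.neutral) auto
  then have "(\<lambda>j. a (j + k) * y ^ (j + k)) sums S"
    using assms(1) sums_iff_shift[of "\<lambda>j. a j * y ^ j" k S] by simp
  then have "(\<lambda>j. a (j + k) * y ^ (j + k) / y ^ k) sums (S / y ^ k)" by (rule sums_divide)
  then show ?thesis using assms(2) by (simp add: power_add)
qed

lemma holomorphic_lipschitz_half_ball: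
  assumes "g holomorphic_on ball 0 \<rho>" "\<rho> > 0"
  obtains L B where "\<And>z w. z \<in> ball 0 (\<rho> / 2) \<Longrightarrow> w \<in> ball 0 (\<rho> / 2) \<Longrightarrow> norm (g z - g w) \<le> L * norm (z - w)"
    "\<And>z. z \<in> ball 0 (\<rho> / 2) \<Longrightarrow> norm (g z) \<le> B"
proof -
  have sub: "cball 0 (\<rho> / 2) \<subseteq> ball (0::complex) \<rho>" using assms by auto
  have "deriv g holomorphic_on ball 0 \<rho>" by (rule holomorphic_deriv[OF assms(1)]) simp
  then have "continuous_on (cball 0 (\<rho> / 2)) (deriv g)"
    using sub holomorphic_on_imp_continuous_on continuous_on_subset by blast
  then have "bounded (deriv g ` cball 0 (\<rho> / 2))" by (intro compact_imp_bounded compact_continuous_image) auto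
  then obtain L where L: "\<And>z. z \<in> cball 0 (\<rho> / 2) \<Longrightarrow> norm (deriv g z) \<le> L" unfolding bounded_iff by blast
  have "continuous_on (cball 0 (\<rho> / 2)) g"
    using sub assms(1) holomorphic_on_imp_continuous_on continuous_on_subset by blast
  then have "bounded (g ` cball 0 (\<rho> / 2))" by (intro compact_imp_bounded compact_continuous_image) auto
  then obtain B where B: "\<And>z. z \<in> cball 0 (\<rho> / 2) \<Longrightarrow> norm (g z) \<le> B" unfolding bounded_iff by blast
  show thesis
  proof (rule that)
    fix z w :: complex assume zw: "z \<in> ball 0 (\<rho> / 2)" "w \<in> ball 0 (\<rho> / 2)"
    show "norm (g z - g w) \<le> L * norm (z - w)"
    proof (rule field_differentiable_bound[of "cball 0 (\<rho> / 2)"])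
      fix z :: complex assume z: "z \<in> cball 0 (\<rho> / 2)"
      have "(g has_field_derivative deriv g z) (at z)"
        using holomorphic_derivI[OF assms(1), of z] z sub by auto
      then show "(g has_field_derivative deriv g z) (at z within cball 0 (\<rho> / 2))"
        by (rule has_field_derivative_at_within)
    qed (use L zw in auto)
    show "norm (g z) \<le> B" using B zw by auto
  qed
qed

text \<open>The first nonzero coefficient decides the sign near 0. The alternative between
  nonpositive and positive matches the half-open range of the principal argument and accommodates
  the zero series.\<close>

lemma powser_real_sign:
  fixes c :: "nat \<Rightarrow> real"
  assumes r: "r > 0" and S: "\<And>y. 0 < y \<Longrightarrow> y < r \<Longrightarrow> (\<lambda>j. c j * y ^ j) sums S y"
  shows "\<exists>\<rho>>0. (\<forall>y. 0 < y \<longrightarrow> y < \<rho> \<longrightarrow> S y \<le> 0) \<or> (\<forall>y. 0 < y \<longrightarrow> y < \<rho> \<longrightarrow> S y > 0)"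
proof (cases "\<exists>k. c k \<noteq> 0")
  case False
  then have "S y = 0" if "0 < y" "y < r" for y
    using S[OF that] sums_unique2[OF _ sums_zero] by simp
  then show ?thesis using r by (intro exI[of _ r]) auto
next
  case True
  define k where "k = (LEAST k. c k \<noteq> 0)"
  have k: "c k \<noteq> 0" unfolding k_def using True by (rule LeastI_ex)
  have k0: "c j = 0" if "j < k" for j using that not_less_Least unfolding k_def by blast
  define T where "T = (\<lambda>y. \<Sum>j. c (j + k) * y ^ j)"
  have T: "(\<lambda>j. c (j + k) * y ^ j) sums (S y / y ^ k)" if "0 < y" "y < r" for y
    using powser_factor_order[OF S[OF that] _ k0, of k] that by simp
  have "isCont T 0" unfolding T_def
    by (rule isCont_powser[of _ "r / 2"]) (use T[of "r / 2"] r sums_summable in auto)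
  moreover have "T 0 = c k" unfolding T_def by (simp add: powser_zero[of "\<lambda>j. c (j + k)", simplified])
  ultimately have lim: "(T \<longlongrightarrow> c k) (at 0)" by (simp add: isCont_def)
  have Sy: "S y = y ^ k * T y" if "0 < y" "y < r" for y
  proof -
    have "S y = y ^ k * (S y / y ^ k)" using that by simp
    then show ?thesis using sums_unique[OF T[OF that]] by (simp only: T_def)
  qed
  show ?thesis
  proof (cases "c k > 0")
    case True
    then have "eventually (\<lambda>y. T y > 0) (at 0)" using lim by (rule order_tendstoD(1)[rotated])
    then obtain d where d: "d > 0" "\<And>y. y \<noteq> 0 \<Longrightarrow> dist y 0 < d \<Longrightarrow> T y > 0" by (auto simp: eventually_at)
    have "S y > 0" if "0 < y" "y < min d r" for y
      using that d(2)[of y] by (simp add: Sy)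
    then show ?thesis using d(1) r by (intro exI[of _ "min d r"]) auto
  next
    case False
    then have "c k < 0" using k by simp
    then have "eventually (\<lambda>y. T y < 0) (at 0)" using lim by (rule order_tendstoD(2)[rotated])
    then obtain d where d: "d > 0" "\<And>y. y \<noteq> 0 \<Longrightarrow> dist y 0 < d \<Longrightarrow> T y < 0" by (auto simp: eventually_at)
    have "S y \<le> 0" if "0 < y" "y < min d r" for y
      using that d(2)[of y] by (simp add: Sy mult_nonneg_nonpos)
    then show ?thesis using d(1) r by (intro exI[of _ "min d r"]) auto
  qed
qed

text \<open>When the value at \<open>0\<close> lies on the branch cut, the sign of the imaginary part is
  eventually constant, so that the branches of \<open>Ln\<close> on one side differ by a constant.\<close>

lemma Ln_powser_lipschitz:
  fixes b :: "nat \<Rightarrow> complex"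
  assumes r: "r > 0" and U: "\<And>z. z \<in> ball 0 r \<Longrightarrow> (\<lambda>j. b j * z ^ j) sums U z" and U0: "U 0 \<noteq> 0"
  obtains \<rho> L B where "0 < \<rho>" "\<rho> \<le> r"
    "\<And>y. 0 < y \<Longrightarrow> y < \<rho> \<Longrightarrow> U (of_real y) \<noteq> 0"
    "\<And>y. 0 < y \<Longrightarrow> y < \<rho> \<Longrightarrow> norm (Ln (U (of_real y))) \<le> B"
    "\<And>y y'. 0 < y \<Longrightarrow> y < \<rho> \<Longrightarrow> 0 < y' \<Longrightarrow> y' < \<rho> \<Longrightarrow> norm (Ln (U (of_real y)) - Ln (U (of_real y'))) \<le> L * \<bar>y - y'\<bar>"
proof -
  have hol: "U holomorphic_on ball 0 r"
    by (rule power_series_holomorphic[of 0 r b]) (use U in simp)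
  \<comment> \<open>If \<open>U 0\<close> lies on the cut, the sign change moves it to the positive
    axis, where Ln is holomorphic; Ln of U is then recovered from Ln of -U by adding or subtracting
    i \<pi>.\<close>
  define \<epsilon> :: complex where "\<epsilon> = (if U 0 \<in> \<real>\<^sub>\<le>\<^sub>0 then -1 else 1)"
  have \<epsilon>0: "\<epsilon> * U 0 \<notin> \<real>\<^sub>\<le>\<^sub>0" using U0 by (auto simp: \<epsilon>_def complex_nonpos_Reals_iff complex_eq_iff)
  have cont: "continuous_on (ball 0 r) (\<lambda>z. \<epsilon> * U z)"
    by (intro continuous_intros holomorphic_on_imp_continuous_on hol)
  have "open ((\<lambda>z. \<epsilon> * U z) -` (- \<real>\<^sub>\<le>\<^sub>0) \<inter> ball 0 r)"
    using cont by (simp add: continuous_on_open_vimage open_Compl)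
  moreover have "0 \<in> (\<lambda>z. \<epsilon> * U z) -` (- \<real>\<^sub>\<le>\<^sub>0) \<inter> ball 0 r" using \<epsilon>0 r by simp
  ultimately obtain \<rho>1 where \<rho>1: "\<rho>1 > 0" "ball 0 \<rho>1 \<subseteq> (\<lambda>z. \<epsilon> * U z) -` (- \<real>\<^sub>\<le>\<^sub>0) \<inter> ball 0 r"
    by (meson open_contains_ball)
  have "(\<lambda>z. Ln (\<epsilon> * U z)) holomorphic_on ball 0 \<rho>1"
    using \<rho>1(2) by (intro holomorphic_intros holomorphic_on_subset[OF hol]) auto
  then obtain L B where LB:
    "\<And>z w. z \<in> ball 0 (\<rho>1 / 2) \<Longrightarrow> w \<in> ball 0 (\<rho>1 / 2) \<Longrightarrow> norm (Ln (\<epsilon> * U z) - Ln (\<epsilon> * U w)) \<le> L * norm (z - w)"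
    "\<And>z. z \<in> ball 0 (\<rho>1 / 2) \<Longrightarrow> norm (Ln (\<epsilon> * U z)) \<le> B"
    using holomorphic_lipschitz_half_ball[OF _ \<rho>1(1), of "\<lambda>z. Ln (\<epsilon> * U z)"] by metis
  have "\<exists>\<rho>2>0. \<exists>\<omega>. \<forall>y. 0 < y \<longrightarrow> y < \<rho>2 \<longrightarrow> Ln (U (of_real y)) = Ln (\<epsilon> * U (of_real y)) + \<omega>"
  proof (cases "U 0 \<in> \<real>\<^sub>\<le>\<^sub>0")
    case False
    then show ?thesis by (intro exI[of _ 1] conjI exI[of _ 0]) (auto simp: \<epsilon>_def)
  next
    case True
    have "(\<lambda>j. - Im (b j) * y ^ j) sums Im (- U (of_real y))" if "0 < y" "y < r" for y
    proof -
      have "(\<lambda>j. - (b j * of_real y ^ j)) sums (- U (of_real y))"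
        using that by (intro sums_minus U) simp
      then have "(\<lambda>j. Im (- (b j * of_real y ^ j))) sums Im (- U (of_real y))" by (rule sums_Im)
      then show ?thesis by (simp flip: of_real_power)
    qed
    then obtain \<rho>2 where \<rho>2: "\<rho>2 > 0"
      "(\<forall>y. 0 < y \<longrightarrow> y < \<rho>2 \<longrightarrow> Im (- U (of_real y)) \<le> 0) \<or> (\<forall>y. 0 < y \<longrightarrow> y < \<rho>2 \<longrightarrow> Im (- U (of_real y)) > 0)"
      using powser_real_sign[OF r, of "\<lambda>j. - Im (b j)" "\<lambda>y. Im (- U (of_real y))"] by blast
    have cut: "- U (of_real y) \<notin> \<real>\<^sub>\<le>\<^sub>0" if "0 < y" "y < \<rho>1" for y
    proof -
      have "complex_of_real y \<in> ball 0 \<rho>1" using that by simp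
      then have "\<epsilon> * U (of_real y) \<in> - \<real>\<^sub>\<le>\<^sub>0" using \<rho>1(2) by blast
      moreover have "\<epsilon> = -1" using True by (simp add: \<epsilon>_def)
      ultimately show ?thesis by (simp only: Compl_iff mult_minus1 not_False_eq_True)
    qed
    have eq: "Ln (U (of_real y)) = (if Im (- U (of_real y)) \<le> 0 then Ln (- U (of_real y)) + \<i> * pi else Ln (- U (of_real y)) - \<i> * pi)"
      if "0 < y" "y < \<rho>1" for y
    proof -
      have nz: "- U (of_real y) \<noteq> 0" using cut[OF that] by auto
      have "\<not> (Re (- U (of_real y)) < 0 \<and> Im (- U (of_real y)) = 0)"
        using cut[OF that] by (auto simp: complex_nonpos_Reals_iff)
      then show ?thesis using Ln_minus[OF nz] by (simp only: minus_minus simp_thms)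
    qed
    show ?thesis using \<rho>2(2)
    proof
      assume "\<forall>y. 0 < y \<longrightarrow> y < \<rho>2 \<longrightarrow> Im (- U (of_real y)) \<le> 0"
      then show ?thesis using eq True \<rho>1(1) \<rho>2(1)
        by (intro exI[of _ "min \<rho>1 \<rho>2"] conjI exI[of _ "\<i> * pi"]) (auto simp: \<epsilon>_def)
    next
      assume "\<forall>y. 0 < y \<longrightarrow> y < \<rho>2 \<longrightarrow> Im (- U (of_real y)) > 0"
      then show ?thesis using eq True \<rho>1(1) \<rho>2(1)
        by (intro exI[of _ "min \<rho>1 \<rho>2"] conjI exI[of _ "- (\<i> * pi)"]) (auto simp: \<epsilon>_def not_le)
    qed
  qed
  then obtain \<rho>2 \<omega> where \<rho>2: "\<rho>2 > 0" "\<And>y. 0 < y \<Longrightarrow> y < \<rho>2 \<Longrightarrow> Ln (U (of_real y)) = Ln (\<epsilon> * U (of_real y)) + \<omega>"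
    by blast
  define \<rho> where "\<rho> = min r (min (\<rho>1 / 2) \<rho>2)"
  have inb: "complex_of_real y \<in> ball 0 (\<rho>1 / 2)" "complex_of_real y \<in> ball 0 \<rho>1" "y < \<rho>2" if "0 < y" "y < \<rho>" for y
    using that \<rho>1(1) by (auto simp: \<rho>_def)
  show thesis
  proof (rule that[of \<rho> "B + norm \<omega>" L])
    show "0 < \<rho>" "\<rho> \<le> r" using r \<rho>1 \<rho>2 by (auto simp: \<rho>_def)
    fix y assume y: "0 < y" "y < \<rho>"
    have "\<epsilon> * U (of_real y) \<notin> \<real>\<^sub>\<le>\<^sub>0" using \<rho>1(2) inb(2)[OF y] by blast
    then show "U (of_real y) \<noteq> 0" by auto
    have "norm (Ln (U (of_real y))) \<le> norm (Ln (\<epsilon> * U (of_real y))) + norm \<omega>"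
      unfolding \<rho>2(2)[OF y(1) inb(3)[OF y]] by (rule norm_triangle_ineq)
    then show "norm (Ln (U (of_real y))) \<le> B + norm \<omega>" using LB(2)[OF inb(1)[OF y]] by linarith
    fix y' assume y': "0 < y'" "y' < \<rho>"
    have "norm (Ln (U (of_real y)) - Ln (U (of_real y'))) = norm (Ln (\<epsilon> * U (of_real y)) - Ln (\<epsilon> * U (of_real y')))"
      by (simp add: \<rho>2(2)[OF y(1) inb(3)[OF y]] \<rho>2(2)[OF y'(1) inb(3)[OF y']])
    also have "\<dots> \<le> L * norm (complex_of_real y - of_real y')" by (rule LB(1)[OF inb(1)[OF y] inb(1)[OF y']])
    also have "norm (complex_of_real y - of_real y') = \<bar>y - y'\<bar>" by (simp flip: of_real_diff)
    finally show "norm (Ln (U (of_real y)) - Ln (U (of_real y'))) \<le> L * \<bar>y - y'\<bar>" .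
  qed
qed

lemma ln_lipschitz:
  fixes y y' :: real
  assumes "0 < y" "0 < y'"
  shows "\<bar>ln y - ln y'\<bar> \<le> \<bar>y - y'\<bar> / min y y'"
proof -
  have *: "\<bar>ln y - ln y'\<bar> \<le> \<bar>y - y'\<bar> / min y y'" if "0 < y" "y \<le> y'" for y y' :: real
  proof -
    have "ln y' - ln y = ln (y' / y)" using that by (simp add: ln_div)
    also have "\<dots> \<le> y' / y - 1" using that by (intro ln_le_minus_one) auto
    also have "\<dots> = (y' - y) / y" using that by (simp add: field_simps)
    finally show ?thesis using that by (simp add: min_def)
  qed
  show ?thesis
    using *[of y y'] *[of y' y] assms by (cases "y \<le> y'") (auto simp: abs_minus_commute min.commute)
qed

text \<open>With k the order of vanishing, H y = y^k * U y and \<open>U 0\<close> is nonzero. As y^k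
  is a positive real, Ln splits without branch correction into k ln y, which carries the
  singularity, and Ln (U y), which is Lipschitz on one side.\<close>

lemma Ln_powser_one_sided:
  fixes a :: "nat \<Rightarrow> complex" and H :: "real \<Rightarrow> complex"
  assumes r: "r > 0" and H: "\<And>y. 0 < y \<Longrightarrow> y < r \<Longrightarrow> (\<lambda>j. a j * of_real y ^ j) sums H y" and nz: "\<exists>k. a k \<noteq> 0"
  obtains \<rho> L B and k :: nat where "0 < \<rho>" "L \<ge> 0" "a 0 \<noteq> 0 \<Longrightarrow> k = 0"
    "\<And>y. 0 < y \<Longrightarrow> y < \<rho> \<Longrightarrow> norm (Ln (H y)) \<le> real k * \<bar>ln y\<bar> + B"
    "\<And>y y'. 0 < y \<Longrightarrow> y < \<rho> \<Longrightarrow> 0 < y' \<Longrightarrow> y' < \<rho> \<Longrightarrow> norm (Ln (H y) - Ln (H y')) \<le> L * \<bar>y - y'\<bar> / min y y'"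
proof -
  define k where "k = (LEAST k. a k \<noteq> 0)"
  have k: "a k \<noteq> 0" unfolding k_def using nz by (rule LeastI_ex)
  have k0: "a j = 0" if "j < k" for j using that not_less_Least unfolding k_def by blast
  define b where "b j = a (j + k)" for j
  define U where "U z = (\<Sum>j. b j * z ^ j)" for z
  have sH: "(\<lambda>j. b j * of_real y ^ j) sums (H y / of_real y ^ k)" if "0 < y" "y < r" for y
    unfolding b_def using powser_factor_order[OF H[OF that] _ k0, of k] that by simp
  \<comment> \<open>Convergence is given only at positive reals; inside the disc it follows by
    comparison with a real point beyond |z|.\<close>
  have sU: "(\<lambda>j. b j * z ^ j) sums U z" if "z \<in> ball 0 r" for z
  proof -
    have "norm z < r" using that by simp
    then obtain y where y: "norm z < y" "y < r" using dense by blast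
    then have "0 < y" using norm_ge_zero[of z] by linarith
    then have "summable (\<lambda>j. b j * of_real y ^ j)" using sH y sums_summable by blast
    then have "summable (\<lambda>j. b j * z ^ j)" by (rule powser_inside) (use y \<open>0 < y\<close> in simp)
    then show ?thesis unfolding U_def by (rule summable_sums)
  qed
  have "U 0 = b 0" unfolding U_def by (rule powser_zero)
  then have "U 0 \<noteq> 0" using k by (simp add: b_def)
  then obtain \<rho> L B where \<rho>: "0 < \<rho>" "\<rho> \<le> r"
    "\<And>y. 0 < y \<Longrightarrow> y < \<rho> \<Longrightarrow> U (of_real y) \<noteq> 0"
    "\<And>y. 0 < y \<Longrightarrow> y < \<rho> \<Longrightarrow> norm (Ln (U (of_real y))) \<le> B"
    "\<And>y y'. 0 < y \<Longrightarrow> y < \<rho> \<Longrightarrow> 0 < y' \<Longrightarrow> y' < \<rho> \<Longrightarrow> norm (Ln (U (of_real y)) - Ln (U (of_real y'))) \<le> L * \<bar>y - y'\<bar>"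
    using Ln_powser_lipschitz[OF r sU] by metis
  have Ln_eq: "Ln (H y) = of_real (real k * ln y) + Ln (U (of_real y))" if y: "0 < y" "y < \<rho>" for y
  proof -
    have "U (of_real y) = H y / of_real y ^ k"
      using sums_unique2[OF sU sH[OF y(1)]] y \<rho>(2) by simp
    then have Hy: "H y = of_real (y ^ k) * U (of_real y)" using y by simp
    have "Ln (H y) = of_real (ln (y ^ k)) + Ln (U (of_real y))"
      unfolding Hy Ln_of_real[OF zero_less_power[OF y(1)], symmetric]
      by (rule Ln_times_of_real[OF zero_less_power[OF y(1)] \<rho>(3)[OF y]])
    then show ?thesis using y by (simp add: ln_realpow)
  qed
  show thesis
  \<comment> \<open>Below 1, dividing by \<open>min y y'\<close> only enlarges a bound, so the
    Lipschitz estimate for U takes the same form as that for the logarithm.\<close>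
  proof (rule that[of "min \<rho> 1" "real k + \<bar>L\<bar>" k B])
    show "0 < min \<rho> 1" using \<rho> by simp
    show "0 \<le> real k + \<bar>L\<bar>" by simp
    show "k = 0" if "a 0 \<noteq> 0" using k0[of 0] that by auto
    fix y assume y: "0 < y" "y < min \<rho> 1"
    have "norm (Ln (H y)) \<le> norm (complex_of_real (real k * ln y)) + norm (Ln (U (of_real y)))"
      using Ln_eq[of y] y norm_triangle_ineq by simp
    then show "norm (Ln (H y)) \<le> real k * \<bar>ln y\<bar> + B" using \<rho>(4)[of y] y by (simp add: norm_mult)
    fix y' assume y': "0 < y'" "y' < min \<rho> 1"
    have m: "0 < min y y'" "min y y' \<le> 1" using y y' by auto
    have "Ln (H y) - Ln (H y') = of_real (real k * (ln y - ln y')) + (Ln (U (of_real y)) - Ln (U (of_real y')))"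
      using Ln_eq[of y] Ln_eq[of y'] y y' by (simp add: algebra_simps)
    then have "norm (Ln (H y) - Ln (H y')) \<le> norm (complex_of_real (real k * (ln y - ln y'))) + norm (Ln (U (of_real y)) - Ln (U (of_real y')))"
      using norm_triangle_ineq by simp
    also have "\<dots> \<le> real k * (\<bar>y - y'\<bar> / min y y') + \<bar>L\<bar> * \<bar>y - y'\<bar> / min y y'"
    proof (rule add_mono)
      have "norm (complex_of_real (real k * (ln y - ln y'))) = real k * \<bar>ln y - ln y'\<bar>"
        by (simp only: norm_of_real abs_mult abs_of_nat)
      also have "\<dots> \<le> real k * (\<bar>y - y'\<bar> / min y y')" using ln_lipschitz y y' by (intro mult_left_mono) auto
      finally show "norm (complex_of_real (real k * (ln y - ln y'))) \<le> real k * (\<bar>y - y'\<bar> / min y y')" .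
      have "norm (Ln (U (of_real y)) - Ln (U (of_real y'))) \<le> L * \<bar>y - y'\<bar>" using \<rho>(5) y y' by auto
      also have "\<dots> \<le> \<bar>L\<bar> * \<bar>y - y'\<bar>" by (intro mult_right_mono) auto
      also have "\<dots> \<le> \<bar>L\<bar> * \<bar>y - y'\<bar> / min y y'"
        using m divide_left_mono[of "min y y'" 1 "\<bar>L\<bar> * \<bar>y - y'\<bar>"] by simp
      finally show "norm (Ln (U (of_real y)) - Ln (U (of_real y'))) \<le> \<bar>L\<bar> * \<bar>y - y'\<bar> / min y y'" .
    qed
    also have "\<dots> = (real k + \<bar>L\<bar>) * \<bar>y - y'\<bar> / min y y'" by (simp add: distrib_right add_divide_distrib)
    finally show "norm (Ln (H y) - Ln (H y')) \<le> (real k + \<bar>L\<bar>) * \<bar>y - y'\<bar> / min y y'" .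
  qed
qed

section \<open>How closely the powers approach roots of unity\<close>

lemma cis_eq_1_imp_int: "cis (2 * pi * s) = 1 \<Longrightarrow> \<exists>z::int. s = of_int z"
proof -
  assume "cis (2 * pi * s) = 1"
  then have "cos (2 * pi * s) = 1" by (metis cis.sel(1) one_complex.sel(1))
  then obtain z :: int where "2 * pi * s = of_int z * 2 * pi" using cos_one_2pi_int by metis
  then have "s = of_int z" by simp
  then show ?thesis ..
qed

lemma root_of_unity_rational:
  assumes "root_of_unity (cis (2 * pi * s))"
  obtains q :: nat and z :: int where "q \<ge> 1" "real q * s = of_int z"
proof -
  obtain q where q: "q \<ge> 1" "cis (2 * pi * s) ^ q = 1" using assms by (auto simp: root_of_unity_def)
  have "cis (2 * pi * (real q * s)) = 1" using q(2) by (simp add: Complex.DeMoivre mult_ac)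
  then show thesis using that q(1) cis_eq_1_imp_int by blast
qed

text \<open>Multiplied by q, the distance to s = z / q becomes a distance of q m t to an integer, so
  the Diophantine bound applies with index q m and loses only a constant depending on q. The free
  integer z in \<open>badly_approximable\<close> fits this use.\<close>

lemma badly_approximable_away_from_rational:
  assumes ba: "badly_approximable K \<gamma> t" and q: "q \<ge> 1" "real q * s = of_int z" and m: "m \<ge> 1"
  shows "\<bar>frac (real m * t) - s\<bar> \<ge> K / (real q * real q powr \<gamma>) * real m powr (- \<gamma>)"
proof -
  have "int (q * m) \<noteq> 0" using q m by simp
  then have "K / \<bar>of_int (int (q * m))\<bar> powr \<gamma> < \<bar>of_int (int (q * m)) * t - of_int (int q * \<lfloor>real m * t\<rfloor> + z)\<bar>"
    using ba unfolding badly_approximable_def by blast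
  also have "of_int (int (q * m)) * t - of_int (int q * \<lfloor>real m * t\<rfloor> + z) = real q * (frac (real m * t) - s)"
    using q(2) by (simp add: frac_def algebra_simps)
  finally have "K / (real q * real m) powr \<gamma> < real q * \<bar>frac (real m * t) - s\<bar>"
    by (simp add: abs_mult)
  then have "K / (real q * real m) powr \<gamma> / real q < \<bar>frac (real m * t) - s\<bar>"
    using q by (subst pos_divide_less_eq) (simp_all add: mult.commute)
  moreover have "K / (real q * real m) powr \<gamma> / real q = K / (real q * real q powr \<gamma>) * real m powr (- \<gamma>)"
    using q m by (simp add: powr_mult powr_minus divide_inverse)
  ultimately show ?thesis by simp
qed

lemma exists_irrational_between:
  fixes a b :: real
  assumes "a < b"
  obtains s where "a < s" "s < b" "s \<notin> \<rat>"
proof -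
  have "\<not> {a<..<b} \<subseteq> \<rat>"
    using uncountable_open_interval[of a b] assms countable_rat countable_subset by blast
  then obtain s where "s \<in> {a<..<b}" "s \<notin> \<rat>" by blast
  then show thesis using that[of s] by simp
qed

text \<open>Each s0 has a neighbourhood on both sides of which \<open>G\<close> has at most a
  logarithmic singularity at s0, and bisection extends this local information to [0, 1]. That all
  zeros are roots of unity enters twice: sample points approach a zero only polynomially fast, and f
  cannot vanish on an arc, because an arc contains points with irrational angle.\<close>

lemma circle_equidistributes:
  fixes f :: "complex \<Rightarrow> complex" and t :: real
  assumes an: "real_analytic_on_circle f"
    and zeros: "\<And>z. z \<in> sphere 0 1 \<Longrightarrow> f z = 0 \<Longrightarrow> root_of_unity z"
    and K: "K > 0" and \<gamma>: "\<gamma> > 0" and ba: "badly_approximable K \<gamma> t"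
  shows "equidistributes (\<lambda>m. frac (real m * t)) (\<lambda>s. Ln (f (cis (2 * pi * s)))) 0 1"
proof -
  define x where "x = (\<lambda>m. frac (real m * t))"
  define F where "F = (\<lambda>s. f (cis (2 * pi * s)))"
  define G where "G = (\<lambda>s. Ln (F s))"
  obtain C \<delta> where ld: "C > 0" "0 < \<delta>" "low_discrepancy x C \<delta>"
    using low_discrepancy_badly_approximable[OF K \<gamma> ba] unfolding x_def by blast
  have local_piece: "equidistributes x G a b"
    if ab: "0 \<le> a" "a \<le> b" "b \<le> 1" and e: "e = a \<or> e = b" and L: "L \<ge> 0"
      and k0: "F e \<noteq> 0 \<Longrightarrow> k = 0"
      and bd: "\<And>s. s \<in> {a..<b} \<Longrightarrow> s \<noteq> e \<Longrightarrow> norm (G s) \<le> real k * \<bar>ln \<bar>s - e\<bar>\<bar> + B"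
      and lip: "\<And>s r. s \<in> {a..<b} \<Longrightarrow> r \<in> {a..<b} \<Longrightarrow> s \<noteq> e \<Longrightarrow> r \<noteq> e \<Longrightarrow>
        norm (G s - G r) \<le> L * \<bar>s - r\<bar> / min \<bar>s - e\<bar> \<bar>r - e\<bar>"
    for a b e L B and k :: nat
  proof -
    \<comment> \<open>A singular end is a zero of F, hence a rational angle, and the sample points
      keep a polynomial distance from it. At a regular end a sample point may hit e, where
      \<open>bd\<close> is silent; hence the maximum with |G e|.\<close>
    have "\<exists>\<gamma>' B'. \<gamma>' \<ge> 0 \<and> (\<forall>m\<ge>1. x m \<in> {a..<b} \<longrightarrow> norm (G (x m)) \<le> \<gamma>' * ln (real m) + B')"
    proof (cases "k = 0")
      case True
      have "norm (G (x m)) \<le> 0 * ln (real m) + max (norm (G e)) B" if "x m \<in> {a..<b}" for m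
        using bd[OF that] True by (cases "x m = e") auto
      then show ?thesis by (intro exI[of _ 0] exI[of _ "max (norm (G e)) B"]) auto
    next
      case False
      then have "F e = 0" using k0 by blast
      then have "root_of_unity (cis (2 * pi * e))" by (intro zeros) (simp_all add: F_def)
      then obtain q z where q: "q \<ge> 1" "real q * e = of_int z" by (rule root_of_unity_rational)
      define K' where "K' = K / (real q * real q powr \<gamma>)"
      have K': "K' > 0" using K q by (simp add: K'_def)
      have dist: "\<bar>x m - e\<bar> \<ge> K' * real m powr (- \<gamma>)" if "m \<ge> 1" for m
        unfolding x_def K'_def by (rule badly_approximable_away_from_rational[OF ba q that])
      have "norm (G (x m)) \<le> (real k * \<gamma>) * ln (real m) + (real k * \<bar>ln K'\<bar> + B)" if m: "m \<ge> 1" "x m \<in> {a..<b}" for m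
      proof -
        have pos: "K' * real m powr (- \<gamma>) > 0" using K' m by simp
        have d: "0 < \<bar>x m - e\<bar>" using dist[OF m(1)] pos by linarith
        have d1: "\<bar>x m - e\<bar> \<le> 1" using m(2) ab e by auto
        have "ln K' + - \<gamma> * ln (real m) = ln (K' * real m powr (- \<gamma>))"
          using K' m by (simp add: ln_mult ln_powr)
        also have "\<dots> \<le> ln \<bar>x m - e\<bar>" using dist[OF m(1)] pos d by (subst ln_le_cancel_iff) auto
        finally have "\<bar>ln \<bar>x m - e\<bar>\<bar> \<le> \<bar>ln K'\<bar> + \<gamma> * ln (real m)" using d d1 by simp
        then have "real k * \<bar>ln \<bar>x m - e\<bar>\<bar> \<le> real k * (\<bar>ln K'\<bar> + \<gamma> * ln (real m))" by (intro mult_left_mono) auto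
        then show ?thesis using bd[OF m(2)] d by (auto simp: algebra_simps)
      qed
      then show ?thesis using \<gamma> by (intro exI[of _ "real k * \<gamma>"] exI[of _ "real k * \<bar>ln K'\<bar> + B"]) auto
    qed
    then obtain \<gamma>' B' where g: "\<gamma>' \<ge> 0" "\<And>m. m \<ge> 1 \<Longrightarrow> x m \<in> {a..<b} \<Longrightarrow> norm (G (x m)) \<le> \<gamma>' * ln (real m) + B'"
      by blast
    show ?thesis
      by (rule equidistributes_log_piece[OF ld(3,2) ab e _ L bd lip g(2,1)]) auto
  qed
  \<comment> \<open>The side conditions are part of the bisected property, so that it holds
    vacuously for intervals leaving [0, 1].\<close>
  have "0 \<le> (0::real) \<and> (1::real) \<le> 1 \<longrightarrow> equidistributes x G 0 1"
  proof (rule Bolzano[where P="\<lambda>a b. 0 \<le> a \<and> b \<le> 1 \<longrightarrow> equidistributes x G a b"])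
    show "0 \<le> a \<and> c \<le> 1 \<longrightarrow> equidistributes x G a c"
      if "0 \<le> a \<and> b \<le> 1 \<longrightarrow> equidistributes x G a b" "0 \<le> b \<and> c \<le> 1 \<longrightarrow> equidistributes x G b c" "a \<le> b" "b \<le> c" for a b c
      using that equidistributes_trans[of x G a b c] by auto
    fix s0 :: real
    obtain r a where r: "r > 0" and a0: "\<forall>s. \<bar>s - s0\<bar> < r \<longrightarrow> (\<lambda>k. a k * of_real (s - s0) ^ k) sums f (cis (2 * pi * s))"
      using an[unfolded real_analytic_on_circle_def, THEN spec, of s0] by blast
    have a: "(\<lambda>k. a k * of_real (s - s0) ^ k) sums F s" if "\<bar>s - s0\<bar> < r" for s
      unfolding F_def by (rule a0[THEN spec, THEN mp, OF that])
    have "(\<lambda>k. a k * of_real (s0 - s0) ^ k) sums F s0" by (rule a) (use r in simp)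
    then have "(\<lambda>k. a k * 0 ^ k) sums F s0" by (simp only: diff_self of_real_0)
    then have F0: "F s0 = a 0" using powser_sums_zero[of a] by (rule sums_unique2)
    have nz: "\<exists>k. a k \<noteq> 0"
    proof (rule ccontr)
      assume "\<nexists>k. a k \<noteq> 0"
      then have F0: "F s = 0" if "\<bar>s - s0\<bar> < r" for s
      proof -
        have "a = (\<lambda>_. 0)" using \<open>\<nexists>k. a k \<noteq> 0\<close> by auto
        then have "(\<lambda>k. 0) sums F s" using a[OF that] by simp
        then show ?thesis using sums_zero by (rule sums_unique2)
      qed
      obtain s where s: "s0 < s" "s < s0 + r" "s \<notin> \<rat>" using exists_irrational_between[of s0 "s0 + r"] r by auto
      have "root_of_unity (cis (2 * pi * s))" using F0[of s] s by (intro zeros) (simp_all add: F_def)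
      then obtain q z where q: "q \<ge> 1" "real q * s = of_int z" by (rule root_of_unity_rational)
      then have "s = of_int z / of_nat q" by (simp add: field_simps)
      then show False using s(3) by simp
    qed
    have right: "(\<lambda>j. a j * of_real y ^ j) sums F (s0 + y)" if "0 < y" "y < r" for y
      using a[of "s0 + y"] that by simp
    \<comment> \<open>The left side is reflected to positive y, which alternates the signs of the
      coefficients and leaves \<open>a 0\<close> unchanged.\<close>
    have left: "(\<lambda>j. (a j * (-1) ^ j) * of_real y ^ j) sums F (s0 - y)" if "0 < y" "y < r" for y
    proof -
      have "(a j * (-1) ^ j) * of_real y ^ j = a j * of_real (s0 - y - s0) ^ j" for j
        by (simp add: power_minus[of "complex_of_real y"])
      moreover have "(\<lambda>j. a j * of_real (s0 - y - s0) ^ j) sums F (s0 - y)" by (rule a) (use that in simp)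
      ultimately show ?thesis by (simp only:)
    qed
    obtain \<rho>1 L1 B1 and k1 :: nat where R: "0 < \<rho>1" "L1 \<ge> 0" "a 0 \<noteq> 0 \<Longrightarrow> k1 = 0"
      "\<And>y. 0 < y \<Longrightarrow> y < \<rho>1 \<Longrightarrow> norm (Ln (F (s0 + y))) \<le> real k1 * \<bar>ln y\<bar> + B1"
      "\<And>y y'. 0 < y \<Longrightarrow> y < \<rho>1 \<Longrightarrow> 0 < y' \<Longrightarrow> y' < \<rho>1 \<Longrightarrow> norm (Ln (F (s0 + y)) - Ln (F (s0 + y'))) \<le> L1 * \<bar>y - y'\<bar> / min y y'"
      using Ln_powser_one_sided[OF r right nz] by metis
    have nz': "\<exists>j. a j * (-1) ^ j \<noteq> 0" using nz by simp
    obtain \<rho>2 L2 B2 and k2 :: nat where S: "0 < \<rho>2" "L2 \<ge> 0" "a 0 * (-1) ^ 0 \<noteq> 0 \<Longrightarrow> k2 = 0"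
      "\<And>y. 0 < y \<Longrightarrow> y < \<rho>2 \<Longrightarrow> norm (Ln (F (s0 - y))) \<le> real k2 * \<bar>ln y\<bar> + B2"
      "\<And>y y'. 0 < y \<Longrightarrow> y < \<rho>2 \<Longrightarrow> 0 < y' \<Longrightarrow> y' < \<rho>2 \<Longrightarrow> norm (Ln (F (s0 - y)) - Ln (F (s0 - y'))) \<le> L2 * \<bar>y - y'\<bar> / min y y'"
      using Ln_powser_one_sided[OF r left nz'] by metis
    show "\<exists>d>0. \<forall>u v. u \<le> s0 \<and> s0 \<le> v \<and> v - u < d \<longrightarrow> 0 \<le> u \<and> v \<le> 1 \<longrightarrow> equidistributes x G u v"
    proof (intro exI[of _ "min \<rho>1 \<rho>2"] conjI allI impI)
      show "min \<rho>1 \<rho>2 > 0" using R S by simp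
      fix u v assume uv: "u \<le> s0 \<and> s0 \<le> v \<and> v - u < min \<rho>1 \<rho>2" and uv1: "0 \<le> u \<and> v \<le> 1"
      have "equidistributes x G u s0"
      proof (rule local_piece[where e=s0 and L=L2 and k=k2 and B=B2])
        show "norm (G s) \<le> real k2 * \<bar>ln \<bar>s - s0\<bar>\<bar> + B2" if "s \<in> {u..<s0}" "s \<noteq> s0" for s
          using S(4)[of "s0 - s"] that uv by (simp add: G_def)
        show "norm (G s - G r) \<le> L2 * \<bar>s - r\<bar> / min \<bar>s - s0\<bar> \<bar>r - s0\<bar>" if "s \<in> {u..<s0}" "r \<in> {u..<s0}" "s \<noteq> s0" "r \<noteq> s0" for s r
          using S(5)[of "s0 - s" "s0 - r"] that uv by (simp add: G_def abs_minus_commute)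
      qed (use S F0 uv uv1 in auto)
      moreover have "equidistributes x G s0 v"
      proof (rule local_piece[where e=s0 and L=L1 and k=k1 and B=B1])
        show "norm (G s) \<le> real k1 * \<bar>ln \<bar>s - s0\<bar>\<bar> + B1" if "s \<in> {s0..<v}" "s \<noteq> s0" for s
          using R(4)[of "s - s0"] that uv by (simp add: G_def)
        show "norm (G s - G r) \<le> L1 * \<bar>s - r\<bar> / min \<bar>s - s0\<bar> \<bar>r - s0\<bar>" if "s \<in> {s0..<v}" "r \<in> {s0..<v}" "s \<noteq> s0" "r \<noteq> s0" for s r
          using R(5)[of "s - s0" "r - s0"] that uv by (simp add: G_def)
      qed (use R F0 uv uv1 in auto)
      ultimately show "equidistributes x G u v" using uv equidistributes_trans[of x G u s0 v] by auto
    qed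
  qed simp
  then show ?thesis by (simp add: x_def G_def F_def)
qed

section \<open>Mean values with a power saving\<close>

text \<open>The rate is there for summation by parts, which has to turn it into a bounded error for
  the sums weighted by 1 / m.\<close>

definition power_mean :: "(nat \<Rightarrow> real) \<Rightarrow> real \<Rightarrow> bool" where
  "power_mean \<phi> l \<longleftrightarrow> (\<exists>C \<delta>. \<delta> > 0 \<and> (\<forall>n\<ge>1. \<bar>(\<Sum>m=1..n. \<phi> m) - real n * l\<bar> \<le> C * real n powr (1 - \<delta>)))"

text \<open>The constants come from x^2 / 2 \<le> exp x and x \<le> exp x at x = c |z|.\<close>

lemma exp_growth_prod:
  assumes u: "\<And>z. \<bar>u z\<bar> \<le> norm z" "\<And>z w. \<bar>u z - u w\<bar> \<le> norm (z - w)"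
    and v: "\<And>z. \<bar>v z\<bar> \<le> norm z" "\<And>z w. \<bar>v z - v w\<bar> \<le> norm (z - w)" and c: "c > 0"
  shows "exp_growth (2 / c\<^sup>2 + 1 / c) c (\<lambda>z. u z * v z)"
  unfolding exp_growth_def
proof (intro conjI allI)
  fix z :: complex
  have "\<bar>u z * v z\<bar> \<le> norm z * norm z" unfolding abs_mult by (intro mult_mono u v) auto
  also have "\<dots> = 2 / c\<^sup>2 * ((c * norm z)\<^sup>2 / 2)" using c by (simp add: power2_eq_square)
  also have "\<dots> \<le> 2 / c\<^sup>2 * exp (c * norm z)"
  proof (rule mult_left_mono)
    have "0 \<le> c * norm z" using c by simp
    then show "(c * norm z)\<^sup>2 / 2 \<le> exp (c * norm z)" using exp_lower_Taylor_quadratic[of "c * norm z"] by linarith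
  qed simp
  also have "\<dots> \<le> (2 / c\<^sup>2 + 1 / c) * exp (c * norm z)" using c by (intro mult_right_mono) auto
  finally show "\<bar>u z * v z\<bar> \<le> (2 / c\<^sup>2 + 1 / c) * exp (c * norm z)" .
  fix w :: complex
  have e: "norm y \<le> 1 / c * exp (c * norm y)" for y :: complex
  proof -
    have "c * norm y \<le> exp (c * norm y)" using exp_ge_add_one_self[of "c * norm y"] by linarith
    then show ?thesis using c by (simp add: field_simps)
  qed
  have "u z * v z - u w * v w = u z * (v z - v w) + v w * (u z - u w)" by (simp add: algebra_simps)
  then have "\<bar>u z * v z - u w * v w\<bar> \<le> \<bar>u z\<bar> * \<bar>v z - v w\<bar> + \<bar>v w\<bar> * \<bar>u z - u w\<bar>"
    by (metis abs_mult abs_triangle_ineq)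
  also have "\<dots> \<le> norm z * norm (z - w) + norm w * norm (z - w)" by (intro add_mono mult_mono u v) auto
  also have "\<dots> = norm (z - w) * (norm z + norm w)" by (simp add: algebra_simps)
  also have "\<dots> \<le> norm (z - w) * (1 / c * exp (c * norm z) + 1 / c * exp (c * norm w))"
    by (intro mult_left_mono add_mono e) auto
  also have "\<dots> = 1 / c * (norm (z - w) * (exp (c * norm z) + exp (c * norm w)))" by (simp add: algebra_simps)
  also have "\<dots> \<le> (2 / c\<^sup>2 + 1 / c) * (norm (z - w) * (exp (c * norm z) + exp (c * norm w)))"
    using c by (intro mult_right_mono) (auto simp: add_nonneg_nonneg)
  finally show "\<bar>u z * v z - u w * v w\<bar> \<le> (2 / c\<^sup>2 + 1 / c) * norm (z - w) * (exp (c * norm z) + exp (c * norm w))"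
    by (simp only: mult.assoc)
qed

lemma exp_growth_lipschitz:
  assumes u: "\<And>z. \<bar>u z\<bar> \<le> norm z" "\<And>z w. \<bar>u z - u w\<bar> \<le> norm (z - w)" and c: "c > 0"
  shows "exp_growth (1 / c + 1) c u"
  unfolding exp_growth_def
proof (intro conjI allI)
  fix z w :: complex
  have "c * norm z \<le> exp (c * norm z)" using exp_ge_add_one_self[of "c * norm z"] by linarith
  then have "norm z \<le> 1 / c * exp (c * norm z)" using c by (simp add: field_simps)
  also have "\<dots> \<le> (1 / c + 1) * exp (c * norm z)" by (intro mult_right_mono) auto
  finally show "\<bar>u z\<bar> \<le> (1 / c + 1) * exp (c * norm z)" using u(1)[of z] by linarith
  have "norm (z - w) * 1 \<le> ((1 / c + 1) * norm (z - w)) * (exp (c * norm z) + exp (c * norm w))"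
  proof (rule mult_mono)
    have "1 * norm (z - w) \<le> (1 / c + 1) * norm (z - w)" using c by (intro mult_right_mono) auto
    then show "norm (z - w) \<le> (1 / c + 1) * norm (z - w)" by simp
    have "1 \<le> exp (c * norm z)" using c by simp
    then show "1 \<le> exp (c * norm z) + exp (c * norm w)" using exp_ge_zero[of "c * norm w"] by linarith
  qed (use c in auto)
  then show "\<bar>u z - u w\<bar> \<le> (1 / c + 1) * norm (z - w) * (exp (c * norm z) + exp (c * norm w))"
    using u(2)[of z w] by simp
qed

lemma exp_diff_le: "\<bar>exp a - exp b\<bar> \<le> \<bar>a - b\<bar> * (exp a + exp b)" for a b :: real
proof -
  have *: "exp b - exp a \<le> (b - a) * exp b" if "a \<le> b" for a b :: real
  proof -
    have "1 + (a - b) \<le> exp (a - b)" by (rule exp_ge_add_one_self)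
    then have "exp b * (1 + (a - b)) \<le> exp b * exp (a - b)" by (intro mult_left_mono) auto
    also have "\<dots> = exp a" by (simp flip: exp_add)
    finally show ?thesis by (simp add: algebra_simps)
  qed
  have "\<bar>exp a - exp b\<bar> \<le> \<bar>a - b\<bar> * exp a \<or> \<bar>exp a - exp b\<bar> \<le> \<bar>a - b\<bar> * exp b"
    using *[of a b] *[of b a] by (cases "a \<le> b") (auto simp: abs_if)
  moreover have "0 \<le> \<bar>a - b\<bar> * exp a" "0 \<le> \<bar>a - b\<bar> * exp b" by simp_all
  moreover have "\<bar>a - b\<bar> * (exp a + exp b) = \<bar>a - b\<bar> * exp a + \<bar>a - b\<bar> * exp b" by (rule distrib_left)
  ultimately show ?thesis by linarith
qed

text \<open>This test function yields the finite exponential mean on which all estimates for large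
  values rest.\<close>

lemma exp_growth_exp:
  assumes c: "c > 0"
  shows "exp_growth (1 + c) c (\<lambda>z. exp (c * norm z))"
  unfolding exp_growth_def
proof (intro conjI allI)
  fix z w :: complex
  have "1 * exp (c * norm z) \<le> (1 + c) * exp (c * norm z)" using c by (intro mult_right_mono) auto
  then show "\<bar>exp (c * norm z)\<bar> \<le> (1 + c) * exp (c * norm z)" by simp
  have "\<bar>c * norm z - c * norm w\<bar> = c * \<bar>norm z - norm w\<bar>" using c by (simp flip: right_diff_distrib add: abs_mult)
  also have "\<dots> \<le> c * norm (z - w)" using c by (intro mult_left_mono norm_triangle_ineq3) auto
  also have "\<dots> \<le> (1 + c) * norm (z - w)" by (intro mult_right_mono) auto
  finally have "\<bar>c * norm z - c * norm w\<bar> * (exp (c * norm z) + exp (c * norm w)) \<le> (1 + c) * norm (z - w) * (exp (c * norm z) + exp (c * norm w))"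
    by (intro mult_right_mono) (auto simp: add_nonneg_nonneg)
  then show "\<bar>exp (c * norm z) - exp (c * norm w)\<bar> \<le> (1 + c) * norm (z - w) * (exp (c * norm z) + exp (c * norm w))"
    using exp_diff_le[of "c * norm z" "c * norm w"] by linarith
qed

section \<open>Coefficients of exponential generating functions\<close>

text \<open>The coefficient of z^n in the exponential of the series with terms a k z^k / k, k \<ge>
  1. The recursion is the coefficient form of F' = A F, where A has the coefficients
  \<open>a (k + 1)\<close>; the value \<open>a 0\<close> does not enter. Defined this way, norm
  bounds, positivity and monotonicity follow by induction.\<close>

fun exp_coeff :: "(nat \<Rightarrow> 'a::real_normed_field) \<Rightarrow> nat \<Rightarrow> 'a" where
  "exp_coeff a 0 = 1"
| "exp_coeff a (Suc n) = (\<Sum>k\<le>n. a (Suc k) * exp_coeff a (n - k)) / of_nat (Suc n)"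

declare exp_coeff.simps(2) [simp del]

lemma exp_coeff_Suc:
  "of_nat (Suc n) * exp_coeff a (Suc n) = (\<Sum>k\<le>n. a (Suc k) * exp_coeff a (n - k))"
  by (subst exp_coeff.simps) (simp del: of_nat_Suc)

lemma exp_coeff_rec:
  "of_nat n * exp_coeff a n = (\<Sum>k=1..n. a k * exp_coeff a (n - k))"
proof (cases n)
  case (Suc m)
  have "(\<Sum>k=1..Suc m. a k * exp_coeff a (Suc m - k)) = (\<Sum>k=0..m. a (Suc k) * exp_coeff a (m - k))"
    using sum.shift_bounds_cl_Suc_ivl[of "\<lambda>k. a k * exp_coeff a (Suc m - k)" 0 m] by simp
  then show ?thesis unfolding Suc exp_coeff_Suc by (simp add: atLeast0AtMost)
qed simp

lemma exp_coeff_cong: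
  "(\<And>m. 1 \<le> m \<Longrightarrow> m \<le> n \<Longrightarrow> a m = b m) \<Longrightarrow> exp_coeff a n = exp_coeff b n"
proof (induction n rule: less_induct)
  case (less n)
  show ?case
  proof (cases n)
    case (Suc m)
    have "(\<Sum>k\<le>m. a (Suc k) * exp_coeff a (m - k)) = (\<Sum>k\<le>m. b (Suc k) * exp_coeff b (m - k))"
      using less.IH less.prems Suc by (intro sum.cong refl arg_cong2[where f="(*)"]) auto
    then show ?thesis by (simp add: Suc exp_coeff.simps(2))
  qed simp
qed

lemma exp_coeff_of_real: "exp_coeff (\<lambda>m. of_real (a m)) n = (of_real (exp_coeff a n) :: complex)"
proof (induction n rule: less_induct)
  case (less n)
  show ?case
  proof (cases n)
    case (Suc i)
    show ?thesis unfolding Suc exp_coeff.simps(2) of_real_divide of_real_sum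
      using less Suc by (intro arg_cong2[where f="(/)"] sum.cong refl) auto
  qed simp
qed

text \<open>The differential equation determines all coefficients once the constant term is 1, so a
  series can be recognised by its logarithmic derivative.\<close>

lemma exp_coeff_unique:
  fixes F :: "'a::real_normed_field fps"
  assumes "fps_deriv F = Abs_fps (\<lambda>n. a (Suc n)) * F" "fps_nth F 0 = 1"
  shows "fps_nth F n = exp_coeff a n"
proof (induction n rule: less_induct)
  case (less n)
  show ?case
  proof (cases n)
    case (Suc m)
    have "of_nat (Suc m) * fps_nth F (Suc m) = fps_nth (fps_deriv F) m" by simp
    also have "\<dots> = (\<Sum>k\<le>m. a (Suc k) * exp_coeff a (m - k))"
      unfolding assms(1) fps_mult_nth using less Suc by (simp add: atLeast0AtMost)
    also have "\<dots> = of_nat (Suc m) * exp_coeff a (Suc m)" by (rule exp_coeff_Suc [symmetric])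
    finally show ?thesis using Suc by (simp del: of_nat_Suc)
  qed (simp add: assms)
qed

lemma exp_coeff_deriv:
  "fps_deriv (Abs_fps (exp_coeff a)) = Abs_fps (\<lambda>n. a (Suc n)) * Abs_fps (exp_coeff a)"
  by (rule fps_ext) (simp del: of_nat_Suc add: exp_coeff_Suc fps_mult_nth atLeast0AtMost)

text \<open>By the product rule logarithmic derivatives add, so the product of the two series solves
  the equation for the sum of the weights.\<close>

lemma exp_coeff_add:
  "exp_coeff (\<lambda>m. a m + b m) n = (\<Sum>k\<le>n. exp_coeff a k * exp_coeff b (n - k))"
proof -
  let ?F = "Abs_fps (exp_coeff a) * Abs_fps (exp_coeff b)"
  have "Abs_fps (\<lambda>n. a (Suc n) + b (Suc n)) = Abs_fps (\<lambda>n. a (Suc n)) + Abs_fps (\<lambda>n. b (Suc n))"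
    by (rule fps_ext) simp
  then have "fps_deriv ?F = Abs_fps (\<lambda>n. a (Suc n) + b (Suc n)) * ?F"
    by (simp add: exp_coeff_deriv algebra_simps)
  then have "fps_nth ?F n = exp_coeff (\<lambda>m. a m + b m) n"
    by (rule exp_coeff_unique) simp
  then show ?thesis by (simp add: fps_mult_nth atLeast0AtMost)
qed

text \<open>The recursion uses only sums, products and division by positive integers, so taking
  norms of the weights gives a majorant.\<close>

lemma norm_exp_coeff_le:
  "norm (exp_coeff a n) \<le> exp_coeff (\<lambda>m. norm (a m)) n"
proof (induction n rule: less_induct)
  case (less n)
  show ?case
  proof (cases n)
    case (Suc m)
    have "norm (\<Sum>k\<le>m. a (Suc k) * exp_coeff a (m - k)) \<le>
        (\<Sum>k\<le>m. norm (a (Suc k)) * exp_coeff (\<lambda>m. norm (a m)) (m - k))"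
      using less Suc by (intro order.trans[OF norm_sum] sum_mono) (auto simp: norm_mult intro!: mult_left_mono)
    then show ?thesis by (simp del: of_nat_Suc add: Suc exp_coeff.simps(2) norm_divide divide_right_mono)
  qed simp
qed

lemma exp_coeff_nonneg:
  fixes a :: "nat \<Rightarrow> real"
  assumes "\<And>m. a m \<ge> 0"
  shows "exp_coeff a n \<ge> 0"
proof -
  have "(\<lambda>m. norm (a m)) = a" using assms by auto
  then show ?thesis using norm_exp_coeff_le[of a n] norm_ge_zero order.trans by metis
qed

lemma exp_coeff_mono:
  fixes a b :: "nat \<Rightarrow> real"
  assumes "\<And>m. a m \<ge> 0" "\<And>m. a m \<le> b m"
  shows "exp_coeff a n \<le> exp_coeff b n"
proof (induction n rule: less_induct)
  case (less n)
  have b: "b m \<ge> 0" for m using assms order.trans by blast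
  show ?case
  proof (cases n)
    case (Suc m)
    have "(\<Sum>k\<le>m. a (Suc k) * exp_coeff a (m - k)) \<le> (\<Sum>k\<le>m. b (Suc k) * exp_coeff b (m - k))"
      using less Suc by (intro sum_mono mult_mono) (auto simp: assms b exp_coeff_nonneg)
    then show ?thesis by (simp del: of_nat_Suc add: Suc exp_coeff.simps(2) divide_right_mono)
  qed simp
qed

text \<open>These are the coefficients of exp (c z^m / m), a power series in z^m.\<close>

lemma exp_coeff_single:
  assumes "m \<ge> 1"
  shows "exp_coeff (\<lambda>k. if k = m then c else 0) n =
    (if m dvd n then (c / of_nat m) ^ (n div m) / fact (n div m) else 0)"
proof (induction n rule: less_induct)
  case (less n)
  let ?a = "\<lambda>k. if k = m then c else 0"
  show ?case
  proof (cases "n = 0")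
    case False
    have "of_nat n * exp_coeff ?a n = (\<Sum>k=1..n. if k = m then c * exp_coeff ?a (n - m) else 0)"
      unfolding exp_coeff_rec by (intro sum.cong) auto
    also have "\<dots> = (if m \<le> n then c * exp_coeff ?a (n - m) else 0)"
      using assms by (simp add: sum.delta)
    finally have *: "of_nat n * exp_coeff ?a n = (if m \<le> n then c * exp_coeff ?a (n - m) else 0)" .
    show ?thesis
    proof (cases "m dvd n")
      case True
      then obtain j where j: "n = m * j" by blast
      with False obtain i where i: "j = Suc i" by (cases j) auto
      have n: "n = m * Suc i" using i j by simp
      have "exp_coeff ?a (n - m) = (c / of_nat m) ^ i / fact i"
        by (subst less.IH) (use assms n in auto)
      then have "of_nat n * exp_coeff ?a n = c * ((c / of_nat m) ^ i / fact i)"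
        using * n by (simp only: le_add1 mult_Suc_right if_True)
      then have "exp_coeff ?a n = c * ((c / of_nat m) ^ i / fact i) / of_nat n"
        using False by (metis nonzero_mult_div_cancel_left of_nat_eq_0_iff)
      also have "\<dots> = (c / of_nat m) ^ Suc i / fact (Suc i)"
        by (simp only: n of_nat_mult fact_Suc power_Suc times_divide_times_eq times_divide_eq_left times_divide_eq_right divide_divide_eq_left divide_divide_eq_right mult.assoc mult.commute mult.left_commute)
      finally have e: "exp_coeff ?a n = (c / of_nat m) ^ Suc i / fact (Suc i)" .
      have "n div m = Suc i" using assms n by simp
      then show ?thesis unfolding if_P[OF True] using e by simp
    next
      case nd: False
      then have "m \<le> n \<Longrightarrow> \<not> m dvd n - m" using dvd_minus_self[of m n] by simp
      then have "of_nat n * exp_coeff ?a n = 0"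
        using * less.IH[of "n - m"] assms False by simp
      then show ?thesis using nd False by simp
    qed
  qed simp
qed

lemma exp_coeff_single_sums:
  fixes c :: "'a::{real_normed_field,banach}"
  assumes "m \<ge> 1"
  shows "exp_coeff (\<lambda>k. if k = m then c else 0) sums exp (c / of_nat m)"
proof -
  have sm: "strict_mono (\<lambda>j. m * j)" using assms by (auto simp: strict_mono_def)
  have z: "exp_coeff (\<lambda>k. if k = m then c else 0) n = 0" if "n \<notin> range (\<lambda>j. m * j)" for n
    using that by (subst exp_coeff_single[OF assms]) auto
  have "(\<lambda>j. (c / of_nat m) ^ j /\<^sub>R fact j) sums exp (c / of_nat m)"
    by (rule exp_converges)
  then have "(\<lambda>j. exp_coeff (\<lambda>k. if k = m then c else 0) (m * j)) sums exp (c / of_nat m)"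
    using assms by (simp add: exp_coeff_single scaleR_conv_of_real divide_inverse mult.commute)
  moreover have "(\<lambda>j. exp_coeff (\<lambda>k. if k = m then c else 0) (m * j)) sums exp (c / of_nat m) \<longleftrightarrow>
      exp_coeff (\<lambda>k. if k = m then c else 0) sums exp (c / of_nat m)"
    by (rule sums_mono_reindex[OF sm]) (rule z)
  ultimately show ?thesis by iprover
qed

lemma exp_coeff_trivial:
  assumes "\<And>k. k \<ge> 1 \<Longrightarrow> a k = 0" shows "exp_coeff a n = (if n = 0 then 1 else 0)"
proof (cases n)
  case (Suc m)
  then show ?thesis using assms by (simp add: exp_coeff.simps(2))
qed simp

lemma exp_coeff_truncate_Suc:
  "exp_coeff (\<lambda>m. if m \<le> Suc b then a m else 0) n =
   (\<Sum>k\<le>n. exp_coeff (\<lambda>m. if m \<le> b then a m else 0) k * exp_coeff (\<lambda>m. if m = Suc b then a (Suc b) else 0) (n - k))"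
  by (subst exp_coeff_add [symmetric]) (intro exp_coeff_cong, auto simp: le_Suc_eq)

lemma exp_coeff_summable_real:
  fixes a :: "nat \<Rightarrow> real"
  assumes "\<And>m. a m \<ge> 0"
  shows "summable (exp_coeff (\<lambda>m. if m \<le> b then a m else 0))"
proof (induction b)
  case 0
  have "exp_coeff (\<lambda>m. if m \<le> 0 then a m else 0) = (\<lambda>n. if n = 0 then 1 else 0)"
    by (rule ext, rule exp_coeff_trivial) auto
  then show ?case by simp
next
  case (Suc b)
  have "summable (\<lambda>n. norm (exp_coeff (\<lambda>m. if m \<le> b then a m else 0) n))"
    using Suc assms by (simp add: exp_coeff_nonneg)
  moreover have "summable (\<lambda>n. norm (exp_coeff (\<lambda>m. if m = Suc b then a (Suc b) else 0) n))"
    using sums_summable[OF exp_coeff_single_sums[of "Suc b" "a (Suc b)"]] assms by (simp add: exp_coeff_nonneg)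
  ultimately show ?case
    unfolding exp_coeff_truncate_Suc by (rule summable_Cauchy_product)
qed

lemma exp_coeff_abs_summable:
  fixes a :: "nat \<Rightarrow> 'a::{real_normed_field,banach}"
  shows "summable (\<lambda>n. norm (exp_coeff (\<lambda>m. if m \<le> b then a m else 0) n))"
proof (rule summable_comparison_test')
  show "summable (exp_coeff (\<lambda>m. if m \<le> b then norm (a m) else 0))"
    by (rule exp_coeff_summable_real) simp
  show "norm (norm (exp_coeff (\<lambda>m. if m \<le> b then a m else 0) n)) \<le> exp_coeff (\<lambda>m. if m \<le> b then norm (a m) else 0) n" for n
    using norm_exp_coeff_le[of "\<lambda>m. if m \<le> b then a m else 0" n] by (simp add: if_distrib cong: if_cong)
qed

text \<open>The exponential of a polynomial is evaluated at z = 1. One exponent is added at a time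
  by a Cauchy product, for which absolute summability is needed.\<close>

lemma exp_coeff_sums:
  fixes a :: "nat \<Rightarrow> 'a::{real_normed_field,banach}"
  shows "exp_coeff (\<lambda>m. if m \<le> b then a m else 0) sums exp (\<Sum>m=1..b. a m / of_nat m)"
proof (induction b)
  case 0
  have "exp_coeff (\<lambda>m. if m \<le> 0 then a m else 0) = (\<lambda>n. if n = 0 then 1 else 0)"
    by (rule ext, rule exp_coeff_trivial) auto
  then show ?case using sums_single[of 0 "\<lambda>_. 1"] by simp
next
  case (Suc b)
  have "summable (\<lambda>n. norm (exp_coeff (\<lambda>m. if m = Suc b then a (Suc b) else 0) n))"
    using exp_coeff_abs_summable[of "Suc b" "\<lambda>m. if m = Suc b then a (Suc b) else 0"]
    by (rule back_subst[where P=summable]) (intro ext arg_cong[where f=norm] exp_coeff_cong, auto)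
  note c = Cauchy_product_sums[OF exp_coeff_abs_summable[of b a] this]
  have "(\<Sum>k. exp_coeff (\<lambda>m. if m = Suc b then a (Suc b) else 0) k) = exp (a (Suc b) / of_nat (Suc b))"
    by (rule sums_unique[symmetric], rule exp_coeff_single_sums) simp
  moreover have "(\<Sum>k. exp_coeff (\<lambda>m. if m \<le> b then a m else 0) k) = exp (\<Sum>m=1..b. a m / of_nat m)"
    by (rule sums_unique[OF Suc, symmetric])
  moreover have "exp (\<Sum>m=1..Suc b. a m / of_nat m) = exp (\<Sum>m=1..b. a m / of_nat m) * exp (a (Suc b) / of_nat (Suc b))"
    by (simp add: exp_add del: of_nat_Suc)
  ultimately show ?case
    using c by (simp only: exp_coeff_truncate_Suc)
qed

section \<open>Short and long cycle lengths for a constant weight\<close>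

lemma harmonic_tail_le:
  assumes "1 \<le> b" "b \<le> n"
  shows "(\<Sum>m=Suc b..n. 1 / real m) \<le> ln (real n / real b)"
  using assms(2)
proof (induction n rule: dec_induct)
  case (step n)
  have pos: "real n > 0" "real b > 0" using step assms by auto
  have "ln (real n / real (Suc n)) \<le> real n / real (Suc n) - 1"
    using pos by (intro ln_le_minus_one) auto
  also have "\<dots> = - (1 / real (Suc n))" by (simp add: field_simps)
  finally have "1 / real (Suc n) \<le> ln (real (Suc n)) - ln (real n)"
    using pos by (simp add: ln_div)
  moreover have "(\<Sum>m=Suc b..Suc n. 1 / real m) = (\<Sum>m=Suc b..n. 1 / real m) + 1 / real (Suc n)"
    using step by simp
  ultimately show ?case using step pos by (simp add: ln_div)
qed (use assms in simp)

lemma harmonic_le: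
  assumes "1 \<le> b"
  shows "(\<Sum>m=1..b. 1 / real m) \<le> 1 + ln (real b)"
  using harmonic_tail_le[of 1 b] assms by (simp add: sum.atLeast_Suc_atMost)

text \<open>Together with \<open>short_coeff\<close> this factors (1 - z)^(-\<theta>), the
  exponential of \<theta> times the sum of z^m / m, according to m > b and m \<le> b.\<close>

definition long_coeff :: "real \<Rightarrow> nat \<Rightarrow> nat \<Rightarrow> real" where
  "long_coeff \<theta> b = exp_coeff (\<lambda>m. if b < m then \<theta> else 0)"

definition short_coeff :: "real \<Rightarrow> nat \<Rightarrow> nat \<Rightarrow> real" where
  "short_coeff \<theta> b = exp_coeff (\<lambda>m. if m \<le> b then \<theta> else 0)"

context
  fixes \<theta> :: real and b :: nat
  assumes \<theta>: "\<theta> > 0" and b: "b \<ge> 1"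
begin

lemma long_coeff_nonneg: "long_coeff \<theta> b n \<ge> 0"
  unfolding long_coeff_def using \<theta> by (intro exp_coeff_nonneg) auto

lemma short_coeff_nonneg: "short_coeff \<theta> b n \<ge> 0"
  unfolding short_coeff_def using \<theta> by (intro exp_coeff_nonneg) auto

lemma short_coeff_sums: "short_coeff \<theta> b sums exp (\<Sum>m=1..b. \<theta> / real m)"
  using exp_coeff_sums[of b "\<lambda>_. \<theta>"] by (simp add: short_coeff_def)

lemma short_coeff_sum_le: "(\<Sum>k\<in>A. short_coeff \<theta> b k) \<le> exp (\<Sum>m=1..b. \<theta> / real m)" if "finite A"
  unfolding sums_unique[OF short_coeff_sums]
  by (intro sum_le_suminf sums_summable[OF short_coeff_sums] that) (auto simp: short_coeff_nonneg)

lemma short_mass_le: "exp (\<Sum>m=1..b. \<theta> / real m) \<le> exp \<theta> * real b powr \<theta>"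
proof -
  have "(\<Sum>m=1..b. \<theta> / real m) = \<theta> * (\<Sum>m=1..b. 1 / real m)" by (simp add: sum_distrib_left)
  also have "\<dots> \<le> \<theta> * (1 + ln (real b))" using harmonic_le[OF b] \<theta> by (intro mult_left_mono) auto
  finally have "exp (\<Sum>m=1..b. \<theta> / real m) \<le> exp (\<theta> * (1 + ln (real b)))" by simp
  also have "\<dots> = exp \<theta> * real b powr \<theta>" using b by (simp add: powr_def distrib_left exp_add)
  finally show ?thesis .
qed

text \<open>Coefficients up to n do not see exponents above n, so those may be dropped. The sum of
  all remaining coefficients is the value at z = 1, the exponential of \<theta> (1 / (b + 1) + ... +
  1 / n).\<close>

lemma long_coeff_sum_le:
  assumes "b \<le> n"
  shows "(\<Sum>j\<le>n. long_coeff \<theta> b j) \<le> (real n / real b) powr \<theta>"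
proof -
  let ?a = "\<lambda>m. if b < m then \<theta> else 0"
  have "(\<Sum>j\<le>n. long_coeff \<theta> b j) = (\<Sum>j\<le>n. exp_coeff (\<lambda>m. if m \<le> n then ?a m else 0) j)"
    unfolding long_coeff_def by (intro sum.cong refl exp_coeff_cong) auto
  also have "\<dots> \<le> (\<Sum>j. exp_coeff (\<lambda>m. if m \<le> n then ?a m else 0) j)"
    using \<theta> by (intro sum_le_suminf exp_coeff_summable_real exp_coeff_nonneg) auto
  also have "\<dots> = exp (\<Sum>m=1..n. ?a m / real m)"
    by (rule sums_unique[symmetric], rule exp_coeff_sums)
  also have "(\<Sum>m=1..n. ?a m / real m) = \<theta> * (\<Sum>m=Suc b..n. 1 / real m)"
    unfolding sum_distrib_left by (rule sum.mono_neutral_cong_right) auto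
  also have "exp \<dots> \<le> exp (\<theta> * ln (real n / real b))"
    using harmonic_tail_le[OF b assms] \<theta> by simp
  also have "\<dots> = (real n / real b) powr \<theta>"
    using b assms by (simp add: powr_def)
  finally show ?thesis .
qed

text \<open>Only k > b contribute to the recursion, which turns it into a partial sum over j < n -
  b; passing to the next n then adds at most one term. For n at most b the truncated subtraction
  correctly yields the empty sum.\<close>

lemma long_coeff_rec: "real n * long_coeff \<theta> b n = \<theta> * (\<Sum>j<n - b. long_coeff \<theta> b j)"
proof -
  have "real n * long_coeff \<theta> b n = (\<Sum>k=1..n. (if b < k then \<theta> else 0) * long_coeff \<theta> b (n - k))"
    unfolding long_coeff_def by (rule exp_coeff_rec)
  also have "\<dots> = (\<Sum>k\<in>{b<..n}. \<theta> * long_coeff \<theta> b (n - k))"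
    using b by (intro sum.mono_neutral_cong_right) auto
  also have "\<dots> = (\<Sum>j<n - b. \<theta> * long_coeff \<theta> b j)"
    by (rule sum.reindex_bij_witness[of _ "\<lambda>j. n - j" "\<lambda>k. n - k"]) auto
  finally show ?thesis by (simp add: sum_distrib_left)
qed

lemma long_coeff_le:
  assumes "b \<le> n" "1 \<le> i" "i \<le> n"
  shows "long_coeff \<theta> b i \<le> \<theta> / real i * (real n / real b) powr \<theta>"
proof -
  have "real i * long_coeff \<theta> b i \<le> \<theta> * (real n / real b) powr \<theta>"
    unfolding long_coeff_rec using \<theta> assms long_coeff_nonneg
    by (intro mult_left_mono order.trans[OF _ long_coeff_sum_le[OF assms(1)]] sum_mono2) auto
  then show ?thesis using assms by (simp add: field_simps)
qed

text \<open>Subtracting the recursions at j + 1 and j leaves j times the increment equal to \<theta>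
  \<open>B (j - b)\<close> - \<open>B (Suc j)\<close>. Both indices are at least n / 4, where
  \<open>B\<close> is O(M / n), and division by j \<ge> n / 2 gives the second factor 1 / n.\<close>

lemma long_coeff_step:
  assumes "4 * b \<le> n" "n \<le> 2 * j" "j < n"
  shows "\<bar>long_coeff \<theta> b (Suc j) - long_coeff \<theta> b j\<bar> \<le>
     8 * \<theta> * (\<theta> + 1) / (real n)\<^sup>2 * (real n / real b) powr \<theta>"
proof -
  define M where "M = (real n / real b) powr \<theta>"
  define B where "B = long_coeff \<theta> b"
  have n: "n > 0" using assms by auto
  have M: "M \<ge> 0" by (simp add: M_def)
  have bd: "B i \<le> 4 * \<theta> / real n * M" if "n \<le> 4 * i" "i \<le> n" for i
  proof -
    have i: "1 \<le> i" using that n by auto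
    have "B i \<le> \<theta> / real i * M" unfolding B_def M_def
      using that assms i by (intro long_coeff_le) auto
    also have "\<dots> \<le> 4 * \<theta> / real n * M"
    proof (rule mult_right_mono[OF _ M])
      have "real n \<le> 4 * real i" using that by linarith
      then show "\<theta> / real i \<le> 4 * \<theta> / real n" using \<theta> n i by (simp add: field_simps)
    qed
    finally show ?thesis .
  qed
  have "real (Suc j) * B (Suc j) - real j * B j = \<theta> * B (j - b)"
  proof -
    have "Suc j - b = Suc (j - b)" using assms by simp
    then have "(\<Sum>i<Suc j - b. B i) = (\<Sum>i<j - b. B i) + B (j - b)" by simp
    then show ?thesis unfolding B_def long_coeff_rec by (simp add: algebra_simps)
  qed
  then have "real j * (B (Suc j) - B j) = \<theta> * B (j - b) - B (Suc j)"
    by (simp add: algebra_simps)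
  then have "real j * \<bar>B (Suc j) - B j\<bar> = \<bar>\<theta> * B (j - b) - B (Suc j)\<bar>"
    by (metis abs_mult abs_of_nat)
  also have "\<dots> \<le> \<theta> * B (j - b) + B (Suc j)"
    using \<theta> long_coeff_nonneg by (simp add: B_def abs_le_iff add_increasing add_increasing2)
  also have "\<dots> \<le> \<theta> * (4 * \<theta> / real n * M) + 4 * \<theta> / real n * M"
    using assms \<theta> by (intro add_mono mult_left_mono bd) auto
  also have "\<dots> = 4 * \<theta> * (\<theta> + 1) / real n * M" by (simp add: add_divide_distrib algebra_simps)
  finally have *: "real j * \<bar>B (Suc j) - B j\<bar> \<le> 4 * \<theta> * (\<theta> + 1) / real n * M" .
  have "real n / 2 * \<bar>B (Suc j) - B j\<bar> \<le> real j * \<bar>B (Suc j) - B j\<bar>"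
    using assms by (intro mult_right_mono) auto
  then have "real n / 2 * \<bar>B (Suc j) - B j\<bar> \<le> 4 * \<theta> * (\<theta> + 1) / real n * M" using * by linarith
  then have "\<bar>B (Suc j) - B j\<bar> \<le> 8 * \<theta> * (\<theta> + 1) / (real n)\<^sup>2 * M"
    using n by (simp add: field_simps power2_eq_square)
  then show ?thesis by (simp add: B_def M_def)
qed

lemma long_coeff_diff:
  assumes "4 * b \<le> n" "2 * k \<le> n"
  shows "\<bar>long_coeff \<theta> b (n - k) - long_coeff \<theta> b n\<bar> \<le>
     real k * (8 * \<theta> * (\<theta> + 1) / (real n)\<^sup>2 * (real n / real b) powr \<theta>)"
  using assms(2)
proof (induction k)
  case (Suc k)
  let ?D = "8 * \<theta> * (\<theta> + 1) / (real n)\<^sup>2 * (real n / real b) powr \<theta>"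
  have s: "Suc (n - Suc k) = n - k" using Suc by simp
  have "\<bar>long_coeff \<theta> b (n - k) - long_coeff \<theta> b (n - Suc k)\<bar> \<le> ?D"
    using long_coeff_step[of n "n - Suc k"] assms Suc unfolding s by simp
  moreover have "\<bar>long_coeff \<theta> b (n - k) - long_coeff \<theta> b n\<bar> \<le> real k * ?D"
    using Suc by simp
  moreover have "real (Suc k) * ?D = real k * ?D + ?D"
    by (simp only: of_nat_Suc distrib_right mult_1_left add.commute)
  ultimately show ?case by linarith
qed simp

lemma short_coeff_rec:
  "real k * short_coeff \<theta> b k = \<theta> * (\<Sum>m\<in>{1..min b k}. short_coeff \<theta> b (k - m))"
proof -
  have "real k * short_coeff \<theta> b k = (\<Sum>m=1..k. (if m \<le> b then \<theta> else 0) * short_coeff \<theta> b (k - m))"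
    unfolding short_coeff_def by (rule exp_coeff_rec)
  also have "\<dots> = (\<Sum>m\<in>{1..min b k}. \<theta> * short_coeff \<theta> b (k - m))"
    by (intro sum.mono_neutral_cong_right) auto
  finally show ?thesis by (simp add: sum_distrib_left)
qed

text \<open>This is the derivative of the generating function at 1: its logarithmic derivative there
  is a sum of b terms \<theta>. Exchanging the sums makes the bound valid for all partial
  sums.\<close>

lemma short_coeff_moment:
  "(\<Sum>k\<le>n. real k * short_coeff \<theta> b k) \<le> \<theta> * real b * exp (\<Sum>m=1..b. \<theta> / real m)"
proof -
  let ?E = "exp (\<Sum>m=1..b. \<theta> / real m)"
  have "(\<Sum>k\<le>n. real k * short_coeff \<theta> b k) = \<theta> * (\<Sum>k\<le>n. \<Sum>m\<in>{1..min b k}. short_coeff \<theta> b (k - m))"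
    unfolding short_coeff_rec sum_distrib_left ..
  also have "(\<Sum>k\<le>n. \<Sum>m\<in>{1..min b k}. short_coeff \<theta> b (k - m)) =
      (\<Sum>k\<le>n. \<Sum>m\<in>{1..b}. if m \<le> k then short_coeff \<theta> b (k - m) else 0)"
    by (intro sum.cong refl sum.mono_neutral_cong_left) auto
  also have "\<dots> = (\<Sum>m\<in>{1..b}. \<Sum>k\<le>n. if m \<le> k then short_coeff \<theta> b (k - m) else 0)"
    by (rule sum.swap)
  also have "\<dots> \<le> (\<Sum>m\<in>{1..b}. ?E)"
  proof (rule sum_mono)
    fix m assume "m \<in> {1..b}"
    have "(\<Sum>k\<le>n. if m \<le> k then short_coeff \<theta> b (k - m) else 0) = (\<Sum>k\<in>{m..n}. short_coeff \<theta> b (k - m))"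
      by (intro sum.mono_neutral_cong_right) auto
    also have "\<dots> = (\<Sum>j\<in>(\<lambda>k. k - m) ` {m..n}. short_coeff \<theta> b j)"
      by (subst sum.reindex) (auto simp: inj_on_def)
    also have "\<dots> \<le> ?E" by (rule short_coeff_sum_le) simp
    finally show "(\<Sum>k\<le>n. if m \<le> k then short_coeff \<theta> b (k - m) else 0) \<le> ?E" .
  qed
  finally show ?thesis using \<theta> by (simp add: mult.assoc)
qed

text \<open>For k > n / 2 every index k - m in the recursion is at least n / 4, so the first moment
  bounds their sum by 4 / n times \<theta> b times the total mass. Dividing by k gives the second
  power of 1 / n.\<close>

lemma short_coeff_le:
  assumes "4 * b \<le> n" "n < 2 * k"
  shows "short_coeff \<theta> b k \<le> 8 * \<theta>\<^sup>2 * real b / (real n)\<^sup>2 * exp (\<Sum>m=1..b. \<theta> / real m)"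
proof -
  define E where "E = exp (\<Sum>m=1..b. \<theta> / real m)"
  have n: "n > 0" using assms b by auto
  have kb: "real n / 4 \<le> real (k - b)" and k2: "real n / 2 \<le> real k"
    using assms by linarith+
  have "(real n / 4) * (\<Sum>m\<in>{1..min b k}. short_coeff \<theta> b (k - m)) \<le> (\<Sum>m\<in>{1..min b k}. real (k - m) * short_coeff \<theta> b (k - m))"
    unfolding sum_distrib_left
    by (intro sum_mono mult_right_mono short_coeff_nonneg order.trans[OF kb]) auto
  also have "\<dots> = (\<Sum>j\<in>(\<lambda>m. k - m) ` {1..min b k}. real j * short_coeff \<theta> b j)"
    by (subst sum.reindex) (auto simp: inj_on_def)
  also have "\<dots> \<le> (\<Sum>j\<le>k. real j * short_coeff \<theta> b j)"
    by (intro sum_mono2) (auto simp: short_coeff_nonneg)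
  also have "\<dots> \<le> \<theta> * real b * E" unfolding E_def by (rule short_coeff_moment)
  finally have 1: "(\<Sum>m\<in>{1..min b k}. short_coeff \<theta> b (k - m)) \<le> 4 / real n * (\<theta> * real b * E)"
    using n by (simp add: field_simps)
  have "real n / 2 * short_coeff \<theta> b k \<le> real k * short_coeff \<theta> b k"
    by (intro mult_right_mono k2 short_coeff_nonneg)
  also have "\<dots> \<le> \<theta> * (4 / real n * (\<theta> * real b * E))"
    unfolding short_coeff_rec using 1 \<theta> by (intro mult_left_mono) auto
  finally show ?thesis using n unfolding E_def [symmetric] by (simp add: field_simps power2_eq_square)
qed

text \<open>With the short part split off, the remaining coefficients vary slowly near \<open>n\<close>,
  so the convolution factors up to a relative error \<open>b / n\<close>, uniformly in \<open>a\<close>.\<close>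

lemma exp_coeff_split_bound:
  fixes a :: "nat \<Rightarrow> complex"
  assumes n: "4 * b \<le> n" and a: "\<And>m. norm (a m) \<le> 1"
  shows "norm (exp_coeff (\<lambda>m. if m \<le> b then of_real \<theta> * a m else of_real \<theta>) n
       - exp (\<Sum>m=1..b. of_real \<theta> * a m / of_nat m) * of_real (long_coeff \<theta> b n))
     \<le> 10 * \<theta>\<^sup>2 * (\<theta> + 2) * exp \<theta> * (real b / real n) * real n powr (\<theta> - 1)"
proof -
  define A where "A = exp_coeff (\<lambda>m. if m \<le> b then of_real \<theta> * a m else 0)"
  define S where "S = short_coeff \<theta> b"
  define B where "B = long_coeff \<theta> b"
  define E where "E = exp (\<Sum>m=1..b. \<theta> / real m)"
  define M where "M = (real n / real b) powr \<theta>"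
  define K where "K = n div 2"
  define D where "D = 8 * \<theta> * (\<theta> + 1) / (real n)\<^sup>2 * M"
  define X where "X = exp (\<Sum>m=1..b. of_real \<theta> * a m / of_nat m)"
  have n0: "n > 0" using n b by auto
  have A: "A sums X" unfolding A_def X_def by (rule exp_coeff_sums)
  have M0: "M \<ge> 0" by (simp add: M_def)
  have E0: "E \<ge> 0" by (simp add: E_def)
  have AS: "norm (A k) \<le> S k" for k
  proof -
    have "norm (A k) \<le> exp_coeff (\<lambda>m. norm (if m \<le> b then of_real \<theta> * a m else 0)) k"
      unfolding A_def by (rule norm_exp_coeff_le)
    also have "\<dots> \<le> S k" unfolding S_def short_coeff_def
      using a \<theta> by (intro exp_coeff_mono) (auto simp: norm_mult intro: mult_left_le)
    finally show ?thesis .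
  qed
  have S0: "S k \<ge> 0" and B0: "B k \<ge> 0" for k
    by (simp_all add: S_def B_def short_coeff_nonneg long_coeff_nonneg)
  have hB: "exp_coeff (\<lambda>m. if b < m then of_real \<theta> else 0) j = (of_real (B j) :: complex)" for j
    using exp_coeff_of_real[of "\<lambda>m. if b < m then \<theta> else 0" j] by (simp add: B_def long_coeff_def if_distrib cong: if_cong)
  have split: "exp_coeff (\<lambda>m. if m \<le> b then of_real \<theta> * a m else of_real \<theta>) n = (\<Sum>k\<le>n. A k * of_real (B (n - k)))"
  proof -
    have "(\<lambda>m. if m \<le> b then of_real \<theta> * a m else of_real \<theta>) =
       (\<lambda>m. (if m \<le> b then of_real \<theta> * a m else 0) + (if b < m then complex_of_real \<theta> else 0))"
      by auto
    then show ?thesis unfolding A_def using hB by (simp only: exp_coeff_add)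
  qed
  have "summable A" using A sums_summable by blast
  have Xs: "X = (\<Sum>k\<le>K. A k) + (\<Sum>k. A (k + Suc K))"
    using suminf_split_initial_segment[OF \<open>summable A\<close>, of "Suc K"] sums_unique[OF A] lessThan_Suc_atMost by simp
  have sS: "summable S" using short_coeff_sums sums_summable unfolding S_def by blast
  have tail: "norm (\<Sum>k. A (k + Suc K)) \<le> 2 * \<theta> * real b * E / real n"
  proof -
    have s1: "summable (\<lambda>k. S (k + Suc K))" using sS by (subst summable_iff_shift)
    have "norm (\<Sum>k. A (k + Suc K)) \<le> (\<Sum>k. S (k + Suc K))"
      by (intro order.trans[OF summable_norm] suminf_le summable_comparison_test'[OF s1] s1)
         (auto simp: AS)
    also have "\<dots> \<le> 2 * \<theta> * real b * E / real n"
    proof (rule suminf_le_const[OF s1])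
      fix N
      have "real n / 2 * (\<Sum>k<N. S (k + Suc K)) \<le> (\<Sum>k<N. real (k + Suc K) * S (k + Suc K))"
        unfolding sum_distrib_left
        by (intro sum_mono mult_right_mono S0) (simp add: K_def)
      also have "\<dots> = (\<Sum>j\<in>(\<lambda>k. k + Suc K) ` {..<N}. real j * S j)"
        by (subst sum.reindex) (auto simp: inj_on_def)
      also have "\<dots> \<le> (\<Sum>j\<le>N + K. real j * S j)"
        by (intro sum_mono2) (auto simp: S0)
      also have "\<dots> \<le> \<theta> * real b * E" unfolding S_def E_def by (rule short_coeff_moment)
      finally show "(\<Sum>k<N. S (k + Suc K)) \<le> 2 * \<theta> * real b * E / real n"
        using n0 by (simp add: field_simps)
    qed
    finally show ?thesis .
  qed
  have b1: "(\<Sum>k\<le>K. S k * (real k * D)) \<le> (\<theta> * real b * E) * D"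
  proof -
    have "(\<Sum>k\<le>K. S k * (real k * D)) = (\<Sum>k\<le>K. real k * S k) * D"
      unfolding sum_distrib_right by (intro sum.cong refl) (simp only: mult_ac)
    also have "\<dots> \<le> (\<theta> * real b * E) * D"
      using short_coeff_moment[of K] \<theta> M0 by (intro mult_right_mono) (auto simp: S_def E_def D_def)
    finally show ?thesis .
  qed
  have b2: "(\<Sum>k\<in>{K<..n}. (8 * \<theta>\<^sup>2 * real b / (real n)\<^sup>2 * E) * B (n - k)) \<le> (8 * \<theta>\<^sup>2 * real b / (real n)\<^sup>2 * E) * M"
  proof -
    have "(\<Sum>k\<in>{K<..n}. B (n - k)) = (\<Sum>j\<in>(\<lambda>k. n - k) ` {K<..n}. B j)"
      by (subst sum.reindex) (auto simp: inj_on_def)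
    also have "\<dots> \<le> (\<Sum>j\<le>n. B j)" by (intro sum_mono2) (auto simp: B0)
    also have "\<dots> \<le> M" unfolding B_def M_def using n by (intro long_coeff_sum_le) auto
    finally show ?thesis unfolding sum_distrib_left [symmetric] using E0 by (intro mult_left_mono) auto
  qed
  have "(\<Sum>k\<le>n. A k * of_real (B (n - k))) = (\<Sum>k\<le>K. A k * of_real (B (n - k))) + (\<Sum>k\<in>{K<..n}. A k * of_real (B (n - k)))"
    by (subst sum.union_disjoint [symmetric]) (auto simp: K_def intro!: sum.cong)
  \<comment> \<open>Three errors arise: \<open>B (n - k)\<close> is replaced by \<open>B n\<close>
    for k up to K, the terms with k > K are set apart, and the tail beyond K is missing from the
    series of X.\<close>
  then have "(\<Sum>k\<le>n. A k * of_real (B (n - k))) - X * of_real (B n) =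
     (\<Sum>k\<le>K. A k * of_real (B (n - k) - B n)) + (\<Sum>k\<in>{K<..n}. A k * of_real (B (n - k)))
      - (\<Sum>k. A (k + Suc K)) * of_real (B n)"
    unfolding Xs by (simp add: algebra_simps sum_subtractf sum_distrib_left)
  also have "norm \<dots> \<le> (\<Sum>k\<le>K. S k * (real k * D)) + (\<Sum>k\<in>{K<..n}. (8 * \<theta>\<^sup>2 * real b / (real n)\<^sup>2 * E) * B (n - k))
      + 2 * \<theta> * real b * E / real n * (\<theta> / real n * M)"
  proof (intro order.trans[OF norm_triangle_ineq4] order.trans[OF norm_triangle_ineq] add_mono)
    show "norm (\<Sum>k\<le>K. A k * of_real (B (n - k) - B n)) \<le> (\<Sum>k\<le>K. S k * (real k * D))"
    proof (rule sum_norm_le)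
      fix k assume k: "k \<in> {..K}"
      have "\<bar>B (n - k) - B n\<bar> \<le> real k * D" unfolding B_def D_def M_def
        using k by (intro long_coeff_diff n) (auto simp: K_def)
      then show "norm (A k * of_real (B (n - k) - B n)) \<le> S k * (real k * D)"
        unfolding norm_mult norm_of_real by (intro mult_mono AS S0) auto
    qed
    show "norm (\<Sum>k\<in>{K<..n}. A k * of_real (B (n - k))) \<le> (\<Sum>k\<in>{K<..n}. (8 * \<theta>\<^sup>2 * real b / (real n)\<^sup>2 * E) * B (n - k))"
    proof (rule sum_norm_le)
      fix k assume k: "k \<in> {K<..n}"
      have "S k \<le> 8 * \<theta>\<^sup>2 * real b / (real n)\<^sup>2 * E" unfolding S_def E_def
        using k by (intro short_coeff_le n) (auto simp: K_def)
      then show "norm (A k * of_real (B (n - k))) \<le> (8 * \<theta>\<^sup>2 * real b / (real n)\<^sup>2 * E) * B (n - k)"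
        unfolding norm_mult norm_of_real abs_of_nonneg[OF B0] by (intro mult_right_mono B0 order.trans[OF AS])
    qed
    have "norm (complex_of_real (B n)) \<le> \<theta> / real n * M"
      using long_coeff_le[of n n] n n0 B0[of n] by (simp add: B_def M_def)
    then show "norm ((\<Sum>k. A (k + Suc K)) * of_real (B n)) \<le> 2 * \<theta> * real b * E / real n * (\<theta> / real n * M)"
      unfolding norm_mult by (intro mult_mono tail) (use \<theta> E0 in auto)
  qed
  also have "\<dots> \<le> (\<theta> * real b * E) * D + (8 * \<theta>\<^sup>2 * real b / (real n)\<^sup>2 * E) * M
      + 2 * \<theta> * real b * E / real n * (\<theta> / real n * M)"
    by (intro add_mono b1 b2 order_refl)
  also have "(\<theta> * real b * E) * D + (8 * \<theta>\<^sup>2 * real b / (real n)\<^sup>2 * E) * M + 2 * \<theta> * real b * E / real n * (\<theta> / real n * M)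
     = (8 * \<theta>\<^sup>2 * (\<theta> + 1) + 10 * \<theta>\<^sup>2) * (real b / (real n)\<^sup>2) * (E * M)"
    using n0 by (simp add: D_def field_simps power2_eq_square)
  \<comment> \<open>The mass E of the short part is at most exp \<theta> * b^\<theta>, and M = (n /
    b)^\<theta>, so b cancels in E * M.\<close>
  also have "\<dots> \<le> 10 * \<theta>\<^sup>2 * (\<theta> + 2) * (real b / (real n)\<^sup>2) * (exp \<theta> * real n powr \<theta>)"
  proof (rule mult_mono)
    have "8 * \<theta>\<^sup>2 * (\<theta> + 1) + 10 * \<theta>\<^sup>2 \<le> 10 * \<theta>\<^sup>2 * (\<theta> + 2)" using \<theta> by (simp add: algebra_simps)
    then show "(8 * \<theta>\<^sup>2 * (\<theta> + 1) + 10 * \<theta>\<^sup>2) * (real b / (real n)\<^sup>2) \<le> 10 * \<theta>\<^sup>2 * (\<theta> + 2) * (real b / (real n)\<^sup>2)"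
      by (rule mult_right_mono) simp
    have "E * M \<le> (exp \<theta> * real b powr \<theta>) * M"
      using short_mass_le M0 by (intro mult_right_mono) (auto simp: E_def)
    also have "\<dots> = exp \<theta> * real n powr \<theta>"
      using b n0 by (simp add: M_def powr_divide)
    finally show "E * M \<le> exp \<theta> * real n powr \<theta>" .
  qed (use \<theta> E0 M0 in auto)
  also have "\<dots> = 10 * \<theta>\<^sup>2 * (\<theta> + 2) * exp \<theta> * (real b / real n) * real n powr (\<theta> - 1)"
    using n0 by (simp add: powr_diff power2_eq_square field_simps)
  finally have "norm ((\<Sum>k\<le>n. A k * of_real (B (n - k))) - X * of_real (B n)) \<le>
    10 * \<theta>\<^sup>2 * (\<theta> + 2) * exp \<theta> * (real b / real n) * real n powr (\<theta> - 1)" .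
  then show ?thesis unfolding split unfolding X_def B_def by simp
qed

end

section \<open>Constant weight and the ratio of coefficients\<close>

lemma exp_coeff_const_sum:
  "(\<Sum>k<n. \<theta> * exp_coeff (\<lambda>_. \<theta>) k) = of_nat n * exp_coeff (\<lambda>_. \<theta>) n"
proof (cases n)
  case (Suc m)
  show ?thesis unfolding Suc exp_coeff_Suc lessThan_Suc_atMost
    by (rule sum.reindex_bij_witness[of _ "\<lambda>k. m - k" "\<lambda>k. m - k"]) auto
qed simp

text \<open>The difference of two consecutive partial sums gives (n + 1) p (n + 1) = (c + n) p n for
  the coefficients p, which is the recursion of the binomial series (1 - z)^(-c).\<close>

lemma exp_coeff_const: "exp_coeff (\<lambda>_. c) n = pochhammer c n / fact n"
proof (induction n)
  case (Suc n)
  have "of_nat (Suc n) * exp_coeff (\<lambda>_. c) (Suc n) = (c + of_nat n) * exp_coeff (\<lambda>_. c) n"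
    using exp_coeff_const_sum[of c "Suc n"] exp_coeff_const_sum[of c n] by (simp add: distrib_right add.commute)
  then have "exp_coeff (\<lambda>_. c) (Suc n) = (c + of_nat n) * exp_coeff (\<lambda>_. c) n / of_nat (Suc n)"
    by (metis nonzero_mult_div_cancel_left of_nat_neq_0)
  then show ?case by (simp add: Suc pochhammer_Suc mult_ac del: of_nat_Suc)
qed simp

lemma exp_coeff_const_pos: "\<theta> > 0 \<Longrightarrow> exp_coeff (\<lambda>_. \<theta>::real) n > 0"
  by (simp add: exp_coeff_const pochhammer_pos)

text \<open>Up to the factor n^(\<theta> - 1) the coefficient is the reciprocal of a sequence
  converging to Gamma \<theta>, which is positive; both that sequence and its reciprocal are
  therefore bounded.\<close>

lemma exp_coeff_const_asymp:
  fixes \<theta> :: real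
  assumes "\<theta> > 0"
  obtains c C where "c > 0" "C > 0"
    "\<And>n. n \<ge> 1 \<Longrightarrow> c * real n powr (\<theta> - 1) \<le> exp_coeff (\<lambda>_. \<theta>) n"
    "\<And>n. n \<ge> 1 \<Longrightarrow> exp_coeff (\<lambda>_. \<theta>) n \<le> C * real n powr (\<theta> - 1)"
proof -
  define G where "G = (\<lambda>n. Gamma_series' \<theta> n)"
  have lim: "G \<longlonglongrightarrow> Gamma \<theta>" unfolding G_def by (rule Gamma_series'_LIMSEQ)
  have G0: "G n > 0" for n unfolding G_def Gamma_series'_def
    using assms by (simp add: pochhammer_pos)
  \<comment> \<open>\<open>Gamma_series'\<close> has (n - 1)! in its numerator while the coefficient
    has n! in its denominator; the quotient n turns the exponent \<theta> into \<theta> - 1.\<close>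
  have eq: "exp_coeff (\<lambda>_. \<theta>) n = real n powr (\<theta> - 1) / G n" if "n \<ge> 1" for n
  proof -
    obtain m where m: "n = Suc m" using \<open>n \<ge> 1\<close> by (cases n) auto
    have p: "pochhammer \<theta> n > 0" using assms by (simp add: pochhammer_pos)
    have "G n = fact m * real n powr \<theta> / pochhammer \<theta> n"
      using m by (simp add: G_def Gamma_series'_def powr_def)
    then have "real n powr (\<theta> - 1) / G n = pochhammer \<theta> n / (real n * fact m)"
      using p m by (simp add: powr_diff)
    also have "\<dots> = exp_coeff (\<lambda>_. \<theta>) n" using m by (simp add: exp_coeff_const)
    finally show ?thesis ..
  qed
  have "Bseq G" using lim by (intro convergent_imp_Bseq) (auto simp: convergent_def)
  then obtain K where K: "K > 0" "\<And>n. norm (G n) \<le> K" by (auto simp: Bseq_def)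
  have "(\<lambda>n. inverse (G n)) \<longlonglongrightarrow> inverse (Gamma \<theta>)"
    using Gamma_real_pos[OF assms] by (intro tendsto_inverse lim) auto
  then have "Bseq (\<lambda>n. inverse (G n))" by (intro convergent_imp_Bseq) (auto simp: convergent_def)
  then obtain L where L: "L > 0" "\<And>n. norm (inverse (G n)) \<le> L" by (auto simp: Bseq_def)
  show thesis
  proof (rule that[of "inverse K" L])
    fix n :: nat assume n: "n \<ge> 1"
    have "inverse K \<le> inverse (G n)" using K(2)[of n] G0[of n] by (intro le_imp_inverse_le) auto
    from mult_right_mono[OF this, of "real n powr (\<theta> - 1)"]
    show "inverse K * real n powr (\<theta> - 1) \<le> exp_coeff (\<lambda>_. \<theta>) n" using eq[OF n] by (simp add: field_simps)
    have "inverse (G n) \<le> L" using L(2)[of n] G0[of n] by simp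
    from mult_right_mono[OF this, of "real n powr (\<theta> - 1)"]
    show "exp_coeff (\<lambda>_. \<theta>) n \<le> L * real n powr (\<theta> - 1)" using eq[OF n] by (simp add: field_simps)
  qed (use K L in auto)
qed

text \<open>The split bound is applied both to a and to the constant 1, and the quotient eliminates
  the unknown long coefficient. The quotient of the exponentials has norm at most 1 because Re (a m)
  \<le> 1, so the two errors simply add.\<close>

lemma exp_coeff_ratio:
  fixes \<theta> :: real
  assumes \<theta>: "\<theta> > 0"
  obtains C where "\<And>(a :: nat \<Rightarrow> complex) b n. 1 \<le> b \<Longrightarrow> 4 * b \<le> n \<Longrightarrow> (\<And>m. norm (a m) \<le> 1) \<Longrightarrow>
    norm (exp_coeff (\<lambda>m. of_real \<theta> * (if m \<le> b then a m else 1)) n / of_real (exp_coeff (\<lambda>_. \<theta>) n)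
      - exp (\<Sum>m=1..b. of_real \<theta> * (a m - 1) / of_nat m)) \<le> C * (real b / real n)"
proof -
  obtain c where c: "c > 0" "\<And>n. n \<ge> 1 \<Longrightarrow> c * real n powr (\<theta> - 1) \<le> exp_coeff (\<lambda>_. \<theta>) n"
    using exp_coeff_const_asymp[OF \<theta>] by metis
  define C0 where "C0 = 10 * \<theta>\<^sup>2 * (\<theta> + 2) * exp \<theta>"
  show thesis
  proof (rule that[of "2 * C0 / c"])
    fix a :: "nat \<Rightarrow> complex" and b n :: nat
    assume b: "1 \<le> b" and n: "4 * b \<le> n" and a: "\<And>m. norm (a m) \<le> 1"
    define p where "p = exp_coeff (\<lambda>_. \<theta>) n"
    define X where "X = (\<lambda>a :: nat \<Rightarrow> complex. exp (\<Sum>m=1..b. of_real \<theta> * a m / of_nat m))"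
    define B where "B = long_coeff \<theta> b n"
    define h where "h = (\<lambda>a :: nat \<Rightarrow> complex. exp_coeff (\<lambda>m. if m \<le> b then of_real \<theta> * a m else of_real \<theta>) n)"
    define R where "R = C0 * (real b / real n) * real n powr (\<theta> - 1)"
    have p: "p > 0" unfolding p_def by (rule exp_coeff_const_pos[OF \<theta>])
    have h: "norm (h a - X a * of_real B) \<le> R" if "\<And>m. norm (a m) \<le> 1" for a
      unfolding h_def X_def B_def R_def C0_def by (rule exp_coeff_split_bound[OF \<theta> b n that])
    have h1: "h (\<lambda>_. 1) = of_real p" unfolding h_def p_def
      by (simp only: mult_1_right if_cancel exp_coeff_of_real)
    have X1: "X (\<lambda>_. 1) \<noteq> 0" by (simp add: X_def)
    have ratio: "X a / X (\<lambda>_. 1) = exp (\<Sum>m=1..b. of_real \<theta> * (a m - 1) / of_nat m)"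
      unfolding X_def by (simp add: exp_diff [symmetric] sum_subtractf [symmetric] diff_divide_distrib [symmetric] algebra_simps)
    have nr: "norm (X a / X (\<lambda>_. 1)) \<le> 1"
    proof -
      have "Re (of_real \<theta> * (a m - 1) / of_nat m) \<le> 0" for m
      proof -
        have "Re (a m) \<le> 1" using a[of m] complex_Re_le_cmod[of "a m"] by linarith
        then have "\<theta> * (Re (a m) - 1) / real m \<le> 0"
          using \<theta> by (intro divide_nonpos_nonneg mult_nonneg_nonpos) auto
        moreover have "Re (of_real \<theta> * (a m - 1) / of_nat m) = \<theta> * (Re (a m) - 1) / real m"
          by simp
        ultimately show ?thesis by simp
      qed
      then have "Re (\<Sum>m=1..b. of_real \<theta> * (a m - 1) / of_nat m) \<le> 0"
        unfolding Re_sum by (intro sum_nonpos) blast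
      then show ?thesis unfolding ratio by (simp only: norm_exp_eq_Re) simp
    qed
    have "h a / of_real p - X a / X (\<lambda>_. 1) =
        ((h a - X a * of_real B) - (X a / X (\<lambda>_. 1)) * (h (\<lambda>_. 1) - X (\<lambda>_. 1) * of_real B)) / of_real p"
      using p X1 by (simp add: h1 field_simps)
    also have "norm \<dots> \<le> (R + 1 * R) / p"
      unfolding norm_divide norm_of_real abs_of_pos[OF p]
    proof (rule divide_right_mono[OF order.trans[OF norm_triangle_ineq4 add_mono]])
      show "norm (h a - X a * of_real B) \<le> R" by (rule h[OF a])
      show "norm (X a / X (\<lambda>_. 1) * (h (\<lambda>_. 1) - X (\<lambda>_. 1) * of_real B)) \<le> 1 * R"
        unfolding norm_mult by (intro mult_mono nr h) auto
    qed (use p in auto)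
    also have "\<dots> \<le> 2 * C0 / c * (real b / real n)"
    proof -
      have n1: "n \<ge> 1" using b n by auto
      have R0: "R \<ge> 0" using order.trans[OF norm_ge_zero h[OF a]] .
      have "(R + 1 * R) / p \<le> (2 * R) / (c * real n powr (\<theta> - 1))"
        using c n1 R0 by (intro frac_le) (auto simp: p_def)
      also have "\<dots> = 2 * C0 / c * (real b / real n)"
        using c n1 by (simp add: R_def mult_ac)
      finally show ?thesis .
    qed
    finally show "norm (exp_coeff (\<lambda>m. of_real \<theta> * (if m \<le> b then a m else 1)) n / of_real (exp_coeff (\<lambda>_. \<theta>) n)
      - exp (\<Sum>m=1..b. of_real \<theta> * (a m - 1) / of_nat m)) \<le> 2 * C0 / c * (real b / real n)"
      unfolding ratio h_def p_def by (simp only: if_distrib[where f="\<lambda>z. of_real \<theta> * z"] mult_1_right)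
  qed
qed

section \<open>Permutations by the cycle through a point\<close>

definition cycle_weight :: "(nat \<Rightarrow> 'b) \<Rightarrow> 'a set \<Rightarrow> ('a \<Rightarrow> 'a) \<Rightarrow> 'b::comm_monoid_mult" where
  "cycle_weight w S \<sigma> = (\<Prod>c\<in>orbit \<sigma> ` S. w (card c))"

lemma permutes_self_in_orbit: "finite S \<Longrightarrow> \<sigma> permutes S \<Longrightarrow> x \<in> orbit \<sigma> x"
  by (intro permutation_self_in_orbit) (auto simp: permutation_permutes)

text \<open>c and \<tau> act on complementary invariant sets, so the orbits of the composition are A
  and the orbits of \<tau>, and the weight gains exactly one factor.\<close>

lemma compose_full_cycle:
  assumes S: "finite S" "A \<subseteq> S" and c: "c permutes A" "orbit c s = A" and \<tau>: "\<tau> permutes (S - A)"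
  shows "c \<circ> \<tau> permutes S" "x \<in> A \<Longrightarrow> orbit (c \<circ> \<tau>) x = A" "x \<in> S - A \<Longrightarrow> orbit (c \<circ> \<tau>) x = orbit \<tau> x"
    "cycle_weight w S (c \<circ> \<tau>) = w (card A) * cycle_weight w (S - A) \<tau>"
proof -
  have fA: "finite A" using S finite_subset by blast
  show "c \<circ> \<tau> permutes S"
    using S by (intro permutes_compose permutes_subset[OF c(1)] permutes_subset[OF \<tau>]) auto
  show 1: "orbit (c \<circ> \<tau>) x = A" if "x \<in> A" for x
  proof -
    have "cyclic_on c A" using cyclic_on_orbit[OF c(1) fA, of s] c(2) by simp
    then have *: "orbit c x = A" using that by (rule orbit_cyclic_eq3)
    have "orbit (c \<circ> \<tau>) x = orbit c x"
    proof (rule orbit_cong0[of x A])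
      show "(c \<circ> \<tau>) y = c y" if "y \<in> A" for y
        using that permutes_not_in[OF \<tau>, of y] by simp
      then show "c \<circ> \<tau> \<in> A \<rightarrow> A" using c(1) by (auto simp: permutes_in_image)
    qed (use that in auto)
    then show ?thesis using * by simp
  qed
  show 2: "orbit (c \<circ> \<tau>) x = orbit \<tau> x" if "x \<in> S - A" for x
  proof (rule orbit_cong0[of x "S - A"])
    show eq: "(c \<circ> \<tau>) y = \<tau> y" if "y \<in> S - A" for y
      using that permutes_in_image[OF \<tau>, of y] permutes_not_in[OF c(1), of "\<tau> y"] by auto
    then show "c \<circ> \<tau> \<in> S - A \<rightarrow> S - A" using permutes_in_image[OF \<tau>] by auto
  qed (use that in auto)
  have "A \<noteq> {}" using c(2) orbit_nonempty by metis
  have "orbit (c \<circ> \<tau>) ` S = orbit (c \<circ> \<tau>) ` A \<union> orbit (c \<circ> \<tau>) ` (S - A)"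
    using S by blast
  also have "orbit (c \<circ> \<tau>) ` A = {A}" using 1 \<open>A \<noteq> {}\<close> by auto
  also have "orbit (c \<circ> \<tau>) ` (S - A) = orbit \<tau> ` (S - A)" using 2 by (rule image_cong[OF refl])
  finally have "orbit (c \<circ> \<tau>) ` S = insert A (orbit \<tau> ` (S - A))" unfolding insert_is_Un[of A "orbit \<tau> ` (S - A)"] .
  moreover have "A \<notin> orbit \<tau> ` (S - A)"
    using permutes_orbit_subset[OF \<tau>] \<open>A \<noteq> {}\<close> by auto
  ultimately show "cycle_weight w S (c \<circ> \<tau>) = w (card A) * cycle_weight w (S - A) \<tau>"
    using S unfolding cycle_weight_def by (simp only: prod.insert finite_imageI finite_Diff not_False_eq_True)
qed

text \<open>The cycle A through s and its complement are both invariant under \<sigma>; restricting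
  \<sigma> to the two sets inverts the composition.\<close>

lemma sum_permutes_orbit_eq:
  fixes f :: "('a \<Rightarrow> 'a) \<Rightarrow> 'b::comm_monoid_add"
  assumes S: "finite S" "A \<subseteq> S" "s \<in> A"
  shows "(\<Sum>\<sigma> | \<sigma> permutes S \<and> orbit \<sigma> s = A. f \<sigma>) =
    (\<Sum>c | c permutes A \<and> orbit c s = A. \<Sum>\<tau> | \<tau> permutes (S - A). f (c \<circ> \<tau>))"
proof -
  have fA: "finite A" using S finite_subset by blast
  let ?C = "{c. c permutes A \<and> orbit c s = A}" and ?T = "{\<tau>. \<tau> permutes (S - A)}"
  have "(\<Sum>\<sigma> | \<sigma> permutes S \<and> orbit \<sigma> s = A. f \<sigma>) = (\<Sum>(c, \<tau>)\<in>?C \<times> ?T. f (c \<circ> \<tau>))"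
  proof (rule sum.reindex_bij_witness[of _ "\<lambda>(c, \<tau>). c \<circ> \<tau>" "\<lambda>\<sigma>. (perm_restrict \<sigma> A, perm_restrict \<sigma> (S - A))"], goal_cases)
    case (1 \<sigma>)
    then have "cyclic_on \<sigma> A" using cyclic_on_orbit[of \<sigma> S s] S by auto
    then have A: "\<sigma> y \<in> A" if "y \<in> A" for y using that by (rule cyclic_on_inI)
    have B: "\<sigma> y \<notin> A" if "y \<notin> A" for y
      using that 1 cyclic_on_f_in[OF _ \<open>cyclic_on \<sigma> A\<close>] by auto
    show ?case using 1 A B permutes_not_in[of \<sigma> S] by (auto simp: fun_eq_iff perm_restrict_def)
  next
    case (2 \<sigma>)
    then have cyc: "cyclic_on \<sigma> A" using cyclic_on_orbit[of \<sigma> S s] S by auto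
    then have A: "\<sigma> y \<in> A" if "y \<in> A" for y using that by (rule cyclic_on_inI)
    have perm: "perm_restrict \<sigma> A permutes A"
    proof (rule bij_imp_permutes)
      have "inj_on (perm_restrict \<sigma> A) A"
        using 2 permutes_inj[of \<sigma> S] by (auto simp: inj_on_def perm_restrict_def)
      moreover have "perm_restrict \<sigma> A ` A \<subseteq> A" using A by (auto simp: perm_restrict_def)
      ultimately show "bij_betw (perm_restrict \<sigma> A) A A"
        using endo_inj_surj[OF fA] by (simp add: bij_betw_def)
    qed (auto simp: perm_restrict_def)
    have "orbit (perm_restrict \<sigma> A) s = orbit \<sigma> s"
      by (rule sym, rule orbit_cong0[of s A]) (use S A in \<open>auto simp: perm_restrict_def\<close>)
    then show ?case using 2 perm perm_restrict_diff_cyclic[OF _ cyc] by auto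
  next
    case (3 p)
    then obtain c \<tau> where p: "p = (c, \<tau>)" "c permutes A" "\<tau> permutes (S - A)" by auto
    have "perm_restrict (c \<circ> \<tau>) A = c"
      using permutes_not_in[OF p(2)] permutes_not_in[OF p(3)] by (auto simp: fun_eq_iff perm_restrict_def)
    moreover have "perm_restrict (c \<circ> \<tau>) (S - A) = \<tau>"
      using permutes_not_in[OF p(2)] permutes_not_in[OF p(3)] permutes_in_image[OF p(3)]
      by (auto simp: fun_eq_iff perm_restrict_def)
    ultimately show ?case using p by simp
  next
    case (4 p)
    then obtain c \<tau> where p: "p = (c, \<tau>)" "c permutes A" "orbit c s = A" "\<tau> permutes (S - A)" by auto
    show ?case using compose_full_cycle(1,2)[OF S(1,2) p(2-4)] p S by auto
  next
    case (5 \<sigma>)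
    then have "cyclic_on \<sigma> A" using cyclic_on_orbit[of \<sigma> S s] S by auto
    then have A: "\<sigma> y \<in> A" if "y \<in> A" for y using that by (rule cyclic_on_inI)
    have B: "\<sigma> y \<notin> A" if "y \<notin> A" for y
      using that 5 cyclic_on_f_in[OF _ \<open>cyclic_on \<sigma> A\<close>] by auto
    have "perm_restrict \<sigma> A \<circ> perm_restrict \<sigma> (S - A) = \<sigma>"
      using 5 A B permutes_not_in[of \<sigma> S] by (auto simp: fun_eq_iff perm_restrict_def)
    then show ?case by simp
  qed
  then show ?thesis by (simp add: sum.cartesian_product)
qed

lemma sum_pointed_subsets_card:
  fixes F :: "nat \<Rightarrow> 'b::semiring_1"
  assumes "finite S" "s \<in> S"
  shows "(\<Sum>A | A \<subseteq> S \<and> s \<in> A. F (card A)) = (\<Sum>m=1..card S. of_nat ((card S - 1) choose (m - 1)) * F m)"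
proof -
  let ?T = "S - {s}"
  have T: "finite ?T" "card ?T = card S - 1" using assms by auto
  have cS: "card S \<ge> 1" using card_gt_0_iff[of S] assms by auto
  have "(\<Sum>A | A \<subseteq> S \<and> s \<in> A. F (card A)) = (\<Sum>B\<in>Pow ?T. F (Suc (card B)))"
  proof (rule sum.reindex_bij_witness[of _ "insert s" "\<lambda>A. A - {s}"], goal_cases)
    case (5 A)
    then have "finite A" "s \<in> A" using assms finite_subset by auto
    then show ?case by (simp only: card_Suc_Diff1)
  qed (use assms in auto)
  also have "\<dots> = (\<Sum>k\<le>card ?T. \<Sum>B | B \<in> Pow ?T \<and> card B = k. F (Suc (card B)))"
    using card_mono[OF T(1)] T(1) by (intro sum.group [symmetric]) auto
  also have "\<dots> = (\<Sum>k\<le>card ?T. of_nat (card ?T choose k) * F (Suc k))"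
    using n_subsets[OF T(1)] by (intro sum.cong) auto
  also have "\<dots> = (\<Sum>m=1..card S. of_nat ((card S - 1) choose (m - 1)) * F m)"
    by (rule sum.reindex_bij_witness[of _ "\<lambda>m. m - 1" "\<lambda>k. Suc k"]) (use T cS in auto)
  finally show ?thesis .
qed

lemma sum_permutes_by_orbit:
  fixes f :: "('a \<Rightarrow> 'a) \<Rightarrow> 'b::comm_monoid_add"
  assumes S: "finite S" "s \<in> S"
  shows "(\<Sum>\<sigma> | \<sigma> permutes S. f \<sigma>) = (\<Sum>A | A \<subseteq> S \<and> s \<in> A.
    \<Sum>c | c permutes A \<and> orbit c s = A. \<Sum>\<tau> | \<tau> permutes (S - A). f (c \<circ> \<tau>))"
proof -
  have "(\<Sum>\<sigma> | \<sigma> permutes S. f \<sigma>) =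
      (\<Sum>A | A \<subseteq> S \<and> s \<in> A. \<Sum>\<sigma> | \<sigma> \<in> {\<sigma>. \<sigma> permutes S} \<and> orbit \<sigma> s = A. f \<sigma>)"
    using permutes_orbit_subset[OF _ S(2)] permutes_self_in_orbit[OF S(1)]
    by (intro sum.group [symmetric] finite_permutations S) (auto simp: S)
  also have "\<dots> = (\<Sum>A | A \<subseteq> S \<and> s \<in> A.
    \<Sum>c | c permutes A \<and> orbit c s = A. \<Sum>\<tau> | \<tau> permutes (S - A). f (c \<circ> \<tau>))"
    by (rule sum.cong[OF refl], simp only: mem_Collect_eq, rule sum_permutes_orbit_eq[OF S(1)]) auto
  finally show ?thesis .
qed

text \<open>Counting all permutations by the cycle through \<open>s\<close> determines the number of full
  cycles inductively, without exhibiting a bijection.\<close>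

lemma card_full_cycles:
  assumes "finite S" "s \<in> S"
  shows "card {c. c permutes S \<and> orbit c s = S} = fact (card S - 1)"
  using assms
proof (induction "card S" arbitrary: S rule: less_induct)
  case less
  let ?n = "card S" and ?N = "\<lambda>A. card {c. c permutes A \<and> orbit c s = A}"
  let ?F = "\<lambda>m. fact (m - 1) * fact (?n - m) :: nat"
  have n: "?n \<ge> 1" using card_gt_0_iff[of S] less.prems by auto
  have fin: "finite {A. A \<subseteq> S \<and> s \<in> A}" using less by auto
  have "fact ?n = (\<Sum>\<sigma> | \<sigma> permutes S. 1 :: nat)"
    using card_permutations[of S ?n] less by simp
  also have "\<dots> = (\<Sum>A | A \<subseteq> S \<and> s \<in> A. ?N A * fact (card (S - A)))"
    unfolding sum_permutes_by_orbit[OF less.prems] using less.prems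
    by (intro sum.cong refl) (simp add: card_permutations[OF refl])
  also have "\<dots> = ?N S * 1 + (\<Sum>A\<in>{A. A \<subseteq> S \<and> s \<in> A} - {S}. ?N A * fact (card (S - A)))"
    using less.prems by (subst sum.remove[OF fin, of S]) auto
  also have "(\<Sum>A\<in>{A. A \<subseteq> S \<and> s \<in> A} - {S}. ?N A * fact (card (S - A))) =
      (\<Sum>A\<in>{A. A \<subseteq> S \<and> s \<in> A} - {S}. ?F (card A))"
  proof (intro sum.cong refl)
    fix A assume A: "A \<in> {A. A \<subseteq> S \<and> s \<in> A} - {S}"
    then have "A \<subset> S" by blast
    then have "card A < ?n" using less.prems by (intro psubset_card_mono) auto
    moreover have "finite A" using A less.prems finite_subset by blast
    ultimately have "?N A = fact (card A - 1)" using less.hyps A by blast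
    moreover have "card (S - A) = ?n - card A" using A \<open>finite A\<close> by (intro card_Diff_subset) auto
    ultimately show "?N A * fact (card (S - A)) = ?F (card A)" by simp
  qed
  finally have 1: "fact ?n = ?N S + (\<Sum>A\<in>{A. A \<subseteq> S \<and> s \<in> A} - {S}. ?F (card A))" by simp
  \<comment> \<open>If the claimed count held for every A, S included, the total would again be n!.
    Comparison with the true total, where the proper subsets are known by induction, isolates the
    count for S.\<close>
  have "(\<Sum>A | A \<subseteq> S \<and> s \<in> A. ?F (card A)) = ?F ?n + (\<Sum>A\<in>{A. A \<subseteq> S \<and> s \<in> A} - {S}. ?F (card A))"
    using less.prems by (subst sum.remove[OF fin, of S]) auto
  moreover have "(\<Sum>A | A \<subseteq> S \<and> s \<in> A. ?F (card A)) = fact ?n"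
  proof -
    have "(\<Sum>A | A \<subseteq> S \<and> s \<in> A. ?F (card A)) = (\<Sum>m=1..?n. ((?n - 1) choose (m - 1)) * ?F m)"
      using sum_pointed_subsets_card[OF less.prems, of ?F] by simp
    also have "\<dots> = (\<Sum>m=1..?n. fact (?n - 1))"
    proof (intro sum.cong refl)
      fix m assume "m \<in> {1..?n}"
      then have "m - 1 \<le> ?n - 1" "?n - 1 - (m - 1) = ?n - m" by auto
      then show "((?n - 1) choose (m - 1)) * ?F m = fact (?n - 1)"
        using binomial_fact_lemma[of "m - 1" "?n - 1"] by (simp only: mult_ac)
    qed
    also have "\<dots> = fact ?n" using n by (simp add: fact_reduce)
    finally show ?thesis .
  qed
  ultimately show "card {c. c permutes S \<and> orbit c s = S} = fact (?n - 1)" using 1 by simp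
qed

text \<open>The value for smaller sets is a hypothesis, so the same computation serves as the
  induction step of \<open>sum_cycle_weight\<close> (with g = 1) and, once that is known, for
  arbitrary g. The factorials from the full cycles and from S - A combine with the binomial
  coefficient to \<open>fact (card S - 1)\<close>.\<close>

lemma sum_cycle_weight_orbit_aux:
  fixes w :: "nat \<Rightarrow> 'b::real_normed_field"
  assumes S: "finite S" "s \<in> S"
    and smaller: "\<And>T. T \<subset> S \<Longrightarrow> (\<Sum>\<tau> | \<tau> permutes T. cycle_weight w T \<tau>) = fact (card T) * exp_coeff w (card T)"
  shows "(\<Sum>\<sigma> | \<sigma> permutes S. g (card (orbit \<sigma> s)) * cycle_weight w S \<sigma>) =
    fact (card S - 1) * (\<Sum>m=1..card S. g m * w m * exp_coeff w (card S - m))"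
proof -
  let ?n = "card S"
  let ?F = "\<lambda>m. fact (m - 1) * (g m * w m * (fact (?n - m) * exp_coeff w (?n - m)))"
  have "(\<Sum>\<sigma> | \<sigma> permutes S. g (card (orbit \<sigma> s)) * cycle_weight w S \<sigma>) = (\<Sum>A | A \<subseteq> S \<and> s \<in> A. ?F (card A))"
    unfolding sum_permutes_by_orbit[OF S]
  proof (intro sum.cong refl)
    fix A assume A: "A \<in> {A. A \<subseteq> S \<and> s \<in> A}"
    then have fA: "finite A" using S finite_subset by blast
    have "(\<Sum>c | c permutes A \<and> orbit c s = A. \<Sum>\<tau> | \<tau> permutes (S - A). g (card (orbit (c \<circ> \<tau>) s)) * cycle_weight w S (c \<circ> \<tau>))
      = (\<Sum>c | c permutes A \<and> orbit c s = A. g (card A) * w (card A) * (\<Sum>\<tau> | \<tau> permutes (S - A). cycle_weight w (S - A) \<tau>))"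
    proof (intro sum.cong refl)
      fix c assume c: "c \<in> {c. c permutes A \<and> orbit c s = A}"
      have *: "g (card (orbit (c \<circ> \<tau>) s)) * cycle_weight w S (c \<circ> \<tau>) = g (card A) * w (card A) * cycle_weight w (S - A) \<tau>"
        if "\<tau> permutes (S - A)" for \<tau>
        using compose_full_cycle(2)[OF S(1) _ _ _ that, of c s] compose_full_cycle(4)[OF S(1) _ _ _ that, of c s w] A c
        by (simp add: mult.assoc)
      show "(\<Sum>\<tau> | \<tau> permutes (S - A). g (card (orbit (c \<circ> \<tau>) s)) * cycle_weight w S (c \<circ> \<tau>)) =
         g (card A) * w (card A) * (\<Sum>\<tau> | \<tau> permutes (S - A). cycle_weight w (S - A) \<tau>)"
        unfolding sum_distrib_left using * by (intro sum.cong) auto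
    qed
    also have "(\<Sum>\<tau> | \<tau> permutes (S - A). cycle_weight w (S - A) \<tau>) = fact (?n - card A) * exp_coeff w (?n - card A)"
    proof -
      have "S - A \<subset> S" using A S by blast
      moreover have "card (S - A) = ?n - card A" using A fA by (intro card_Diff_subset) auto
      ultimately show ?thesis using smaller[of "S - A"] by simp
    qed
    finally show "(\<Sum>c | c permutes A \<and> orbit c s = A. \<Sum>\<tau> | \<tau> permutes (S - A). g (card (orbit (c \<circ> \<tau>) s)) * cycle_weight w S (c \<circ> \<tau>))
        = ?F (card A)"
      using A by (simp only: sum_constant card_full_cycles[OF fA] of_nat_fact mem_Collect_eq)
  qed
  also have "\<dots> = (\<Sum>m=1..?n. of_nat ((?n - 1) choose (m - 1)) * ?F m)"
    by (rule sum_pointed_subsets_card[OF S])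
  also have "\<dots> = (\<Sum>m=1..?n. fact (?n - 1) * (g m * w m * exp_coeff w (?n - m)))"
  proof (intro sum.cong refl)
    fix m assume "m \<in> {1..?n}"
    then have "m - 1 \<le> ?n - 1" "?n - 1 - (m - 1) = ?n - m" by auto
    then have "fact (m - 1) * fact (?n - m) * ((?n - 1) choose (m - 1)) = (fact (?n - 1) :: nat)"
      using binomial_fact_lemma[of "m - 1" "?n - 1"] by (simp only:)
    then have "of_nat (fact (m - 1) * fact (?n - m) * ((?n - 1) choose (m - 1))) = (of_nat (fact (?n - 1)) :: 'b)"
      by (rule arg_cong)
    then have "fact (m - 1) * fact (?n - m) * of_nat ((?n - 1) choose (m - 1)) = (fact (?n - 1) :: 'b)"
      by (simp only: of_nat_mult of_nat_fact)
    moreover have "of_nat ((?n - 1) choose (m - 1)) * ?F m =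
        fact (m - 1) * fact (?n - m) * of_nat ((?n - 1) choose (m - 1)) * (g m * w m * exp_coeff w (?n - m))"
      by (simp only: mult_ac)
    ultimately show "of_nat ((?n - 1) choose (m - 1)) * ?F m = fact (?n - 1) * (g m * w m * exp_coeff w (?n - m))"
      by (simp only:)
  qed
  finally show ?thesis by (simp add: sum_distrib_left)
qed

text \<open>This is the exponential formula for cycles: classifying permutations by the cycle
  through one point reproduces the recursion of \<open>exp_coeff\<close>.\<close>

theorem sum_cycle_weight:
  fixes w :: "nat \<Rightarrow> 'b::real_normed_field"
  assumes "finite S"
  shows "(\<Sum>\<sigma> | \<sigma> permutes S. cycle_weight w S \<sigma>) = fact (card S) * exp_coeff w (card S)"
  using assms
proof (induction rule: finite_psubset_induct)
  case (psubset S)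
  show ?case
  proof (cases "S = {}")
    case False
    then obtain s where s: "s \<in> S" by blast
    have "card S \<ge> 1" using card_gt_0_iff[of S] psubset.hyps False by auto
    then obtain k where k: "card S = Suc k" by (cases "card S") auto
    have "(\<Sum>\<sigma> | \<sigma> permutes S. cycle_weight w S \<sigma>) = fact (card S - 1) * (\<Sum>m=1..card S. w m * exp_coeff w (card S - m))"
      using sum_cycle_weight_orbit_aux[OF psubset.hyps s, of w "\<lambda>_. 1"] psubset.IH by simp
    also have "\<dots> = fact (card S) * exp_coeff w (card S)"
      unfolding exp_coeff_rec [symmetric] by (simp add: k)
    finally show ?thesis .
  qed (simp add: cycle_weight_def)
qed

theorem sum_cycle_weight_orbit:
  fixes w :: "nat \<Rightarrow> 'b::real_normed_field"
  assumes "finite S" "s \<in> S"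
  shows "(\<Sum>\<sigma> | \<sigma> permutes S. g (card (orbit \<sigma> s)) * cycle_weight w S \<sigma>) =
    fact (card S - 1) * (\<Sum>m=1..card S. g m * w m * exp_coeff w (card S - m))"
  using assms by (intro sum_cycle_weight_orbit_aux sum_cycle_weight) (auto dest: finite_subset)

text \<open>A cycle of length k is seen from each of its k points, so a weight 1 / k per point
  counts it once. Sums over points are accessible through the cycle containing a given
  point.\<close>

lemma sum_cycles_eq_sum_points:
  fixes g :: "nat \<Rightarrow> real"
  assumes S: "finite S" and \<sigma>: "\<sigma> permutes S"
  shows "(\<Sum>c\<in>orbit \<sigma> ` S. g (card c)) = (\<Sum>s\<in>S. g (card (orbit \<sigma> s)) / real (card (orbit \<sigma> s)))"
proof -
  have cyc: "cyclic_on \<sigma> (orbit \<sigma> s)" for s by (rule cyclic_on_orbit[OF \<sigma> S])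
  have "(\<Sum>s\<in>S. g (card (orbit \<sigma> s)) / real (card (orbit \<sigma> s))) =
     (\<Sum>c\<in>orbit \<sigma> ` S. \<Sum>s | s \<in> S \<and> orbit \<sigma> s = c. g (card (orbit \<sigma> s)) / real (card (orbit \<sigma> s)))"
    by (rule sum.image_gen[OF S])
  also have "\<dots> = (\<Sum>c\<in>orbit \<sigma> ` S. g (card c))"
  proof (rule sum.cong[OF refl])
    fix c assume "c \<in> orbit \<sigma> ` S"
    then obtain t where t: "t \<in> S" "c = orbit \<sigma> t" by auto
    have eq: "{s \<in> S. orbit \<sigma> s = c} = c"
    proof (intro equalityI subsetI)
      fix s assume "s \<in> {s \<in> S. orbit \<sigma> s = c}"
      then show "s \<in> c" using permutes_self_in_orbit[OF S \<sigma>, of s] by simp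
    next
      fix s assume s: "s \<in> c"
      then have "orbit \<sigma> s = c" using orbit_cyclic_eq3[OF cyc[of t]] t(2) by simp
      moreover have "s \<in> S" using permutes_orbit_subset[OF \<sigma> t(1)] s t(2) by blast
      ultimately show "s \<in> {s \<in> S. orbit \<sigma> s = c}" by simp
    qed
    have "finite c" using t(2) finite_cyclic_on[OF cyc] by simp
    moreover have "c \<noteq> {}" unfolding t(2) by (rule orbit_nonempty)
    ultimately have "card c \<noteq> 0" by simp
    have "(\<Sum>s | s \<in> S \<and> orbit \<sigma> s = c. g (card (orbit \<sigma> s)) / real (card (orbit \<sigma> s)))
       = (\<Sum>s | s \<in> S \<and> orbit \<sigma> s = c. g (card c) / real (card c))"
      by (intro sum.cong) auto
    also have "\<dots> = g (card c)" unfolding eq using \<open>card c \<noteq> 0\<close> by simp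
    finally show "(\<Sum>s | s \<in> S \<and> orbit \<sigma> s = c. g (card (orbit \<sigma> s)) / real (card (orbit \<sigma> s))) = g (card c)" .
  qed
  finally show ?thesis ..
qed

lemma cycle_card_bounds:
  assumes "\<sigma> permutes {1..n}" "c \<in> perm_cycles n \<sigma>"
  shows "1 \<le> card c" "card c \<le> n" "finite c"
proof -
  obtain s where s: "s \<in> {1..n}" "c = orbit \<sigma> s" using assms by (auto simp: perm_cycles_def)
  have "c \<subseteq> {1..n}" using permutes_orbit_subset[OF assms(1) s(1)] s(2) by simp
  then show "finite c" "card c \<le> n" using finite_subset card_mono[of "{1..n}" c] by auto
  then show "1 \<le> card c" using s(2) orbit_nonempty[of \<sigma> s] card_gt_0_iff[of c] by auto
qed

lemma finite_perm_cycles [simp]: "finite (perm_cycles n \<sigma>)"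
  by (simp add: perm_cycles_def)

text \<open>Grouping cycles by length rewrites the statistic of the theorem as a sum over cycles,
  whose exponential is a product over cycles.\<close>

lemma sum_num_cycles_len:
  fixes g :: "nat \<Rightarrow> complex"
  assumes "\<sigma> permutes {1..n}"
  shows "(\<Sum>m=1..n. of_nat (num_cycles_len n m \<sigma>) * g m) = (\<Sum>c\<in>perm_cycles n \<sigma>. g (card c))"
proof -
  have "(\<Sum>c\<in>perm_cycles n \<sigma>. g (card c)) = (\<Sum>m=1..n. \<Sum>c | c \<in> perm_cycles n \<sigma> \<and> card c = m. g (card c))"
    using cycle_card_bounds[OF assms] by (intro sum.group [symmetric]) auto
  also have "\<dots> = (\<Sum>m=1..n. of_nat (num_cycles_len n m \<sigma>) * g m)"
    by (intro sum.cong refl) (simp add: num_cycles_len_def)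
  finally show ?thesis ..
qed

lemma num_cycles_power_mult:
  fixes \<theta> :: "'b::comm_ring_1"
  shows "\<theta> ^ num_cycles n \<sigma> * (\<Prod>c\<in>perm_cycles n \<sigma>. a (card c)) = cycle_weight (\<lambda>m. \<theta> * a m) {1..n} \<sigma>"
  by (simp add: cycle_weight_def prod.distrib num_cycles_def perm_cycles_def)

lemma sum_card_perm_cycles:
  assumes "\<sigma> permutes {1..n}"
  shows "(\<Sum>c\<in>perm_cycles n \<sigma>. real (card c)) = real n"
proof -
  have "card (orbit \<sigma> s) \<noteq> 0" if "s \<in> {1..n}" for s
    using cycle_card_bounds(1)[OF assms, of "orbit \<sigma> s"] that by (simp add: perm_cycles_def)
  then have "(\<Sum>s\<in>{1..n}. real (card (orbit \<sigma> s)) / real (card (orbit \<sigma> s))) = (\<Sum>s\<in>{1..n}. 1)"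
    by (intro sum.cong refl) simp
  then show ?thesis
    unfolding perm_cycles_def using sum_cycles_eq_sum_points[of "{1..n}" \<sigma> real] assms by simp
qed

lemma card_long_cycles_le:
  assumes "\<sigma> permutes {1..n}" "b > 0"
  shows "real (card {c \<in> perm_cycles n \<sigma>. b < card c}) \<le> real n / real b"
proof -
  have "real b * real (card {c \<in> perm_cycles n \<sigma>. b < card c}) = (\<Sum>c | c \<in> perm_cycles n \<sigma> \<and> b < card c. real b)"
    by simp
  also have "\<dots> \<le> (\<Sum>c | c \<in> perm_cycles n \<sigma> \<and> b < card c. real (card c))"
    by (intro sum_mono) auto
  also have "\<dots> \<le> (\<Sum>c\<in>perm_cycles n \<sigma>. real (card c))"
    by (intro sum_mono2) auto
  also have "\<dots> = real n" by (rule sum_card_perm_cycles[OF assms(1)])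
  finally show ?thesis using assms by (simp add: field_simps)
qed

section \<open>Expectations under the Ewens measure\<close>

context
  fixes \<theta> :: real
  assumes \<theta>: "\<theta> > 0"
begin

lemma ewens_integral:
  fixes F :: "(nat \<Rightarrow> nat) \<Rightarrow> 'b::{banach, second_countable_topology}"
  shows "integral\<^sup>L (ewens \<theta> n) F = (\<Sum>\<sigma> | \<sigma> permutes {1..n}. (\<theta> ^ num_cycles n \<sigma> / pochhammer \<theta> n) *\<^sub>R F \<sigma>)"
  unfolding ewens_def using \<theta> pochhammer_pos[OF \<theta>, of n]
  by (intro lebesgue_integral_point_measure_finite finite_permutations) (auto intro!: divide_nonneg_pos)

lemma space_ewens: "space (ewens \<theta> n) = {\<sigma>. \<sigma> permutes {1..n}}"
  by (simp add: ewens_def space_point_measure)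

text \<open>The normalising constant of the measure is n! times the coefficient for the constant
  weight, so the factorials cancel.\<close>

lemma ewens_expectation_prod:
  fixes a :: "nat \<Rightarrow> complex"
  shows "integral\<^sup>L (ewens \<theta> n) (\<lambda>\<sigma>. \<Prod>c\<in>perm_cycles n \<sigma>. a (card c)) =
    exp_coeff (\<lambda>m. of_real \<theta> * a m) n / of_real (exp_coeff (\<lambda>_. \<theta>) n)"
proof -
  have "integral\<^sup>L (ewens \<theta> n) (\<lambda>\<sigma>. \<Prod>c\<in>perm_cycles n \<sigma>. a (card c)) =
     (\<Sum>\<sigma> | \<sigma> permutes {1..n}. cycle_weight (\<lambda>m. of_real \<theta> * a m) {1..n} \<sigma>) / of_real (pochhammer \<theta> n)"
    unfolding ewens_integral sum_divide_distrib num_cycles_power_mult [symmetric]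
    by (intro sum.cong refl) (simp add: scaleR_conv_of_real)
  also have "\<dots> = exp_coeff (\<lambda>m. of_real \<theta> * a m) n / of_real (exp_coeff (\<lambda>_. \<theta>) n)"
    unfolding sum_cycle_weight[OF finite_atLeastAtMost] exp_coeff_const by (simp add: of_real_divide)
  finally show ?thesis .
qed

lemma prob_space_ewens: "prob_space (ewens \<theta> n)"
proof
  have "(\<Sum>\<sigma> | \<sigma> permutes {1..n}. \<theta> ^ num_cycles n \<sigma>) = (\<Sum>\<sigma> | \<sigma> permutes {1..n}. cycle_weight (\<lambda>_. \<theta>) {1..n} \<sigma>)"
    using num_cycles_power_mult[of \<theta> n _ "\<lambda>_. 1"] by simp
  also have "\<dots> = pochhammer \<theta> n"
    unfolding sum_cycle_weight[OF finite_atLeastAtMost] exp_coeff_const by simp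
  finally have "(\<Sum>\<sigma> | \<sigma> permutes {1..n}. \<theta> ^ num_cycles n \<sigma> / pochhammer \<theta> n) = 1"
    using pochhammer_pos[OF \<theta>, of n] by (simp add: sum_divide_distrib [symmetric])
  moreover have "emeasure (ewens \<theta> n) (space (ewens \<theta> n)) =
      ennreal (\<Sum>\<sigma> | \<sigma> permutes {1..n}. \<theta> ^ num_cycles n \<sigma> / pochhammer \<theta> n)"
    unfolding space_ewens unfolding ewens_def
    using \<theta> pochhammer_pos[OF \<theta>, of n]
    by (subst emeasure_point_measure_finite) (auto simp: finite_permutations intro!: sum_ennreal divide_nonneg_pos)
  ultimately show "emeasure (ewens \<theta> n) (space (ewens \<theta> n)) = 1" by simp
qed

text \<open>The sum over cycles is rewritten over points, and all n points contribute equally. The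
  cycle through a fixed point has length m with probability \<theta> p (n - m) / (n p n), where p is
  the coefficient for the constant weight.\<close>

lemma ewens_expectation_sum:
  fixes g :: "nat \<Rightarrow> real"
  shows "integral\<^sup>L (ewens \<theta> n) (\<lambda>\<sigma>. \<Sum>c\<in>perm_cycles n \<sigma>. g (card c)) =
    (\<Sum>m=1..n. g m * \<theta> / real m * exp_coeff (\<lambda>_. \<theta>) (n - m)) / exp_coeff (\<lambda>_. \<theta>) n"
proof (cases "n = 0")
  case True
  then show ?thesis by (simp add: ewens_integral perm_cycles_def)
next
  case False
  let ?X = "\<Sum>m=1..n. g m * \<theta> / real m * exp_coeff (\<lambda>_. \<theta>) (n - m)"
  have w: "\<theta> ^ num_cycles n \<sigma> = cycle_weight (\<lambda>_. \<theta>) {1..n} \<sigma>" for \<sigma>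
    using num_cycles_power_mult[of \<theta> n \<sigma> "\<lambda>_. 1"] by simp
  have "integral\<^sup>L (ewens \<theta> n) (\<lambda>\<sigma>. \<Sum>c\<in>perm_cycles n \<sigma>. g (card c)) =
     (\<Sum>\<sigma> | \<sigma> permutes {1..n}. (\<Sum>s\<in>{1..n}. g (card (orbit \<sigma> s)) / real (card (orbit \<sigma> s))) * cycle_weight (\<lambda>_. \<theta>) {1..n} \<sigma>)
       / pochhammer \<theta> n"
    unfolding ewens_integral sum_divide_distrib w
    by (intro sum.cong refl) (simp add: perm_cycles_def sum_cycles_eq_sum_points)
  also have "(\<Sum>\<sigma> | \<sigma> permutes {1..n}. (\<Sum>s\<in>{1..n}. g (card (orbit \<sigma> s)) / real (card (orbit \<sigma> s))) * cycle_weight (\<lambda>_. \<theta>) {1..n} \<sigma>)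
     = (\<Sum>s\<in>{1..n}. \<Sum>\<sigma> | \<sigma> permutes {1..n}. (g (card (orbit \<sigma> s)) / real (card (orbit \<sigma> s))) * cycle_weight (\<lambda>_. \<theta>) {1..n} \<sigma>)"
    unfolding sum_distrib_right by (rule sum.swap)
  also have "\<dots> = (\<Sum>s\<in>{1..n}. fact (n - 1) * ?X)"
    by (intro sum.cong refl) (subst sum_cycle_weight_orbit[where g="\<lambda>m. g m / real m"], auto)
  also have "\<dots> = fact n * ?X" using False by (simp add: fact_reduce)
  also have "\<dots> / pochhammer \<theta> n = ?X / exp_coeff (\<lambda>_. \<theta>) n"
    by (simp add: exp_coeff_const)
  finally show ?thesis .
qed

end

section \<open>Convergence in distribution in the complex plane\<close>

text \<open>Real trigonometric polynomials with arbitrary frequencies; the phase d covers sine and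
  cosine. They form an algebra that separates points, and their expectations are determined by the
  characteristic function.\<close>

inductive trig_sum :: "('a::real_inner \<Rightarrow> real) \<Rightarrow> bool" where
  wave: "trig_sum (\<lambda>z. c * cos (inner u z + d))"
| add: "trig_sum f \<Longrightarrow> trig_sum g \<Longrightarrow> trig_sum (\<lambda>z. f z + g z)"

lemma trig_sum_const: "trig_sum (\<lambda>_. c)"
  using trig_sum.wave[of c 0 0] by simp

lemma trig_sum_mult:
  assumes "trig_sum f" "trig_sum g"
  shows "trig_sum (\<lambda>z. f z * g z)"
  using assms(1)
proof induction
  case (wave c u d)
  show ?case using assms(2)
  proof induction
    case (wave c' u' d')
    have "(\<lambda>z. c * cos (inner u z + d) * (c' * cos (inner u' z + d'))) =
      (\<lambda>z. (c * c' / 2) * cos (inner (u - u') z + (d - d')) + (c * c' / 2) * cos (inner (u + u') z + (d + d')))"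
    proof
      fix z
      have "cos (inner u z + d) * cos (inner u' z + d') =
         (cos (inner (u - u') z + (d - d')) + cos (inner (u + u') z + (d + d'))) / 2"
        unfolding cos_times_cos by (simp add: inner_diff_left inner_add_left algebra_simps)
      then show "c * cos (inner u z + d) * (c' * cos (inner u' z + d')) =
        (c * c' / 2) * cos (inner (u - u') z + (d - d')) + (c * c' / 2) * cos (inner (u + u') z + (d + d'))"
        by (simp add: algebra_simps add_divide_distrib)
    qed
    then show ?case by (simp only: trig_sum.intros)
  next
    case (add f g)
    then show ?case using trig_sum.add by (simp only: distrib_left)
  qed
next
  case (add f g)
  then show ?case using trig_sum.add by (simp only: distrib_right)
qed

lemma trig_sum_continuous: "trig_sum f \<Longrightarrow> continuous_on S f"
  by (induction rule: trig_sum.induct) (auto intro!: continuous_intros)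

lemma trig_sum_bounded: "trig_sum f \<Longrightarrow> \<exists>B. \<forall>z. \<bar>f z\<bar> \<le> B"
proof (induction rule: trig_sum.induct)
  case (wave c u d)
  have "\<bar>c * cos (inner u z + d)\<bar> \<le> \<bar>c\<bar>" for z
    using mult_left_mono[OF abs_cos_le_one[of "inner u z + d"], of "\<bar>c\<bar>"] by (simp add: abs_mult)
  then show ?case by blast
next
  case (add f g)
  then obtain B C where "\<And>z. \<bar>f z\<bar> \<le> B" "\<And>z. \<bar>g z\<bar> \<le> C" by blast
  then have "\<bar>f z + g z\<bar> \<le> B + C" for z by (meson abs_triangle_ineq add_mono order.trans)
  then show ?case by blast
qed

lemma trig_sum_polynomial:
  assumes "real_polynomial_function p" "trig_sum f"
  shows "trig_sum (\<lambda>z. p (f z))"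
  using assms(1)
proof induction
  case (linear q)
  have "q y = y * q 1" for y using linear_simps(5)[OF linear, of y 1] by (simp only: real_scaleR_def mult_1_right)
  then have "(\<lambda>z. q (f z)) = (\<lambda>z. f z * q 1)" by (rule ext)
  then show ?case using trig_sum_mult[OF assms(2) trig_sum_const[of "q 1"]] by (simp only:)
next
  case (const c)
  show ?case by (rule trig_sum_const)
next
  case (add p q)
  show ?case by (rule trig_sum.add[OF add.IH])
next
  case (mult p q)
  show ?case by (rule trig_sum_mult[OF mult.IH])
qed

text \<open>The direction x - y is scaled so that the phases at x and y differ by exactly
  \<pi>.\<close>

lemma trig_sum_separates:
  assumes "x \<noteq> y"
  shows "\<exists>f. trig_sum f \<and> f x \<noteq> f y"
proof (intro exI conjI)
  define u where "u = (pi / inner (x - y) (x - y)) *\<^sub>R (x - y)"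
  show "trig_sum (\<lambda>z. 1 * cos (inner u z + (- inner u y)))" by (rule trig_sum.wave)
  have "inner u x - inner u y = inner u (x - y)" by (rule inner_diff_right [symmetric])
  also have "\<dots> = pi" using assms by (simp add: u_def)
  finally have "inner u x - inner u y = pi" .
  then show "1 * cos (inner u x + (- inner u y)) \<noteq> 1 * cos (inner u y + (- inner u y))" by simp
qed

lemma (in prob_space) abs_expectation_diff_le:
  assumes F: "integrable M F" and G: "integrable M G" and H: "integrable M H"
    and le: "\<And>\<omega>. \<bar>F \<omega> - G \<omega>\<bar> \<le> e + c * H \<omega>"
  shows "\<bar>expectation F - expectation G\<bar> \<le> e + c * expectation (H :: 'a \<Rightarrow> real)"
proof -
  have "\<bar>expectation F - expectation G\<bar> = \<bar>expectation (\<lambda>\<omega>. F \<omega> - G \<omega>)\<bar>"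
    by (simp add: Bochner_Integration.integral_diff[OF F G])
  also have "\<dots> \<le> expectation (\<lambda>\<omega>. \<bar>F \<omega> - G \<omega>\<bar>)" by (rule integral_abs_bound)
  also have "\<dots> \<le> expectation (\<lambda>\<omega>. e + c * H \<omega>)"
  proof (rule integral_mono)
    show "integrable M (\<lambda>\<omega>. \<bar>F \<omega> - G \<omega>\<bar>)" using F G by simp
    show "integrable M (\<lambda>\<omega>. e + c * H \<omega>)" using H by simp
  qed (rule le)
  also have "\<dots> = e + c * expectation H"
    using H by (simp add: prob_space)
  finally show ?thesis .
qed

text \<open>The setting of the continuity theorem in the plane with a known limit law. Tightness is
  not assumed; it comes from one-dimensional projections.\<close>

locale distribution_limit =
  fixes M :: "nat \<Rightarrow> 'a measure" and X :: "nat \<Rightarrow> 'a \<Rightarrow> complex" and M' :: "'b measure" and Y :: "'b \<Rightarrow> complex"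
  assumes prob_M: "\<And>n. prob_space (M n)" and X: "\<And>n. X n \<in> borel_measurable (M n)"
    and prob_M': "prob_space M'" and Y: "Y \<in> borel_measurable M'"
    and char_tendsto: "\<And>u. (\<lambda>n. integral\<^sup>L (M n) (\<lambda>\<omega>. iexp (inner u (X n \<omega>)))) \<longlonglongrightarrow> integral\<^sup>L M' (\<lambda>\<omega>. iexp (inner u (Y \<omega>)))"
begin

definition test_limit :: "(complex \<Rightarrow> real) \<Rightarrow> bool" where
  "test_limit h \<longleftrightarrow> (\<lambda>n. integral\<^sup>L (M n) (\<lambda>\<omega>. h (X n \<omega>))) \<longlonglongrightarrow> integral\<^sup>L M' (\<lambda>\<omega>. h (Y \<omega>))"

lemma integrable_test:
  fixes h :: "complex \<Rightarrow> real"
  assumes "continuous_on UNIV h" "\<And>z. \<bar>h z\<bar> \<le> B"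
  shows "integrable (M n) (\<lambda>\<omega>. h (X n \<omega>))" "integrable M' (\<lambda>\<omega>. h (Y \<omega>))"
proof -
  have h [measurable]: "h \<in> borel_measurable borel" using assms(1) by (rule borel_measurable_continuous_onI)
  interpret N: prob_space "M n" by (rule prob_M)
  interpret N': prob_space M' by (rule prob_M')
  show "integrable (M n) (\<lambda>\<omega>. h (X n \<omega>))"
    using measurable_compose[OF X h] assms(2) by (intro N.integrable_const_bound[of _ B]) auto
  show "integrable M' (\<lambda>\<omega>. h (Y \<omega>))"
    using measurable_compose[OF Y h] assms(2) by (intro N'.integrable_const_bound[of _ B]) auto
qed

lemma integral_mono_test:
  fixes f g h :: "complex \<Rightarrow> real"
  assumes "continuous_on UNIV f" "\<And>z. \<bar>f z\<bar> \<le> A" "continuous_on UNIV g" "\<And>z. \<bar>g z\<bar> \<le> B"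
    "continuous_on UNIV h" "\<And>z. \<bar>h z\<bar> \<le> C" and le: "\<And>z. \<bar>f z - g z\<bar> \<le> e + c * h z"
  shows "\<bar>integral\<^sup>L (M n) (\<lambda>\<omega>. f (X n \<omega>)) - integral\<^sup>L (M n) (\<lambda>\<omega>. g (X n \<omega>))\<bar> \<le> e + c * integral\<^sup>L (M n) (\<lambda>\<omega>. h (X n \<omega>))"
    "\<bar>integral\<^sup>L M' (\<lambda>\<omega>. f (Y \<omega>)) - integral\<^sup>L M' (\<lambda>\<omega>. g (Y \<omega>))\<bar> \<le> e + c * integral\<^sup>L M' (\<lambda>\<omega>. h (Y \<omega>))"
  using prob_space.abs_expectation_diff_le[OF prob_M integrable_test(1)[OF assms(1,2)] integrable_test(1)[OF assms(3,4)] integrable_test(1)[OF assms(5,6)] le]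
    prob_space.abs_expectation_diff_le[OF prob_M' integrable_test(2)[OF assms(1,2)] integrable_test(2)[OF assms(3,4)] integrable_test(2)[OF assms(5,6)] le] .

text \<open>Uniform approximation over the whole plane is too much to ask, so the error may contain
  a term c * \<kappa> that is small only in mean under the limit law. As the expectations of
  \<kappa> converge too, this smallness carries over to large n.\<close>

lemma test_limit_approx:
  assumes g: "continuous_on UNIV g" "\<And>z. \<bar>g z\<bar> \<le> B"
    and approx: "\<And>e. e > 0 \<Longrightarrow> \<exists>h \<kappa> c. test_limit h \<and> continuous_on UNIV h \<and> (\<exists>C. \<forall>z. \<bar>h z\<bar> \<le> C)
      \<and> test_limit \<kappa> \<and> continuous_on UNIV \<kappa> \<and> (\<exists>C. \<forall>z. \<bar>\<kappa> z\<bar> \<le> C)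
      \<and> (\<forall>z. \<bar>g z - h z\<bar> \<le> e + c * \<kappa> z) \<and> c * integral\<^sup>L M' (\<lambda>\<omega>. \<kappa> (Y \<omega>)) < e"
  shows "test_limit g"
  unfolding test_limit_def
proof (rule tendstoI)
  fix r :: real assume "r > 0"
  \<comment> \<open>Passing from g to h loses less than 2 e on each side, and the convergence for h
    costs another e.\<close>
  define e where "e = r / 5"
  have e: "e > 0" using \<open>r > 0\<close> by (simp add: e_def)
  obtain h \<kappa> c C D where h: "test_limit h" "continuous_on UNIV h" "\<And>z. \<bar>h z\<bar> \<le> C"
    and \<kappa>: "test_limit \<kappa>" "continuous_on UNIV \<kappa>" "\<And>z. \<bar>\<kappa> z\<bar> \<le> D"
    and le: "\<And>z. \<bar>g z - h z\<bar> \<le> e + c * \<kappa> z" and small: "c * integral\<^sup>L M' (\<lambda>\<omega>. \<kappa> (Y \<omega>)) < e"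
    using approx[OF e] by metis
  note bd = integral_mono_test[OF g h(2,3) \<kappa>(2,3) le]
  have "eventually (\<lambda>n. dist (integral\<^sup>L (M n) (\<lambda>\<omega>. h (X n \<omega>))) (integral\<^sup>L M' (\<lambda>\<omega>. h (Y \<omega>))) < e) sequentially"
    using h(1) e unfolding test_limit_def by (rule tendstoD)
  moreover have "(\<lambda>n. c * integral\<^sup>L (M n) (\<lambda>\<omega>. \<kappa> (X n \<omega>))) \<longlonglongrightarrow> c * integral\<^sup>L M' (\<lambda>\<omega>. \<kappa> (Y \<omega>))"
    using \<kappa>(1) unfolding test_limit_def by (intro tendsto_intros)
  then have "eventually (\<lambda>n. c * integral\<^sup>L (M n) (\<lambda>\<omega>. \<kappa> (X n \<omega>)) < e) sequentially"
    using small by (rule order_tendstoD)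
  ultimately show "eventually (\<lambda>n. dist (integral\<^sup>L (M n) (\<lambda>\<omega>. g (X n \<omega>))) (integral\<^sup>L M' (\<lambda>\<omega>. g (Y \<omega>))) < r) sequentially"
  proof eventually_elim
    case (elim n)
    show ?case using elim bd(1)[of n] bd(2) small unfolding dist_real_def e_def by linarith
  qed
qed

lemma test_limit_trig_sum: "trig_sum h \<Longrightarrow> test_limit h"
proof (induction rule: trig_sum.induct)
  case (wave c u d)
  interpret N: prob_space "M n" for n by (rule prob_M)
  interpret N': prob_space M' by (rule prob_M')
  note [measurable] = X Y
  let ?K = "of_real c * cis d"
  have eq: "c * cos (t + d) = Re (?K * iexp t)" for t :: real
    by (simp add: cis.ctr cos_add Euler algebra_simps)
  have "(\<lambda>n. Re (?K * integral\<^sup>L (M n) (\<lambda>\<omega>. iexp (inner u (X n \<omega>))))) \<longlonglongrightarrow> Re (?K * integral\<^sup>L M' (\<lambda>\<omega>. iexp (inner u (Y \<omega>))))"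
    by (intro tendsto_intros char_tendsto)
  moreover have "Re (?K * integral\<^sup>L (M n) (\<lambda>\<omega>. iexp (inner u (X n \<omega>)))) = integral\<^sup>L (M n) (\<lambda>\<omega>. c * cos (inner u (X n \<omega>) + d))" for n
  proof -
    have i: "integrable (M n) (\<lambda>\<omega>. iexp (inner u (X n \<omega>)))"
      by (rule N.integrable_const_bound[of _ 1]) auto
    show ?thesis unfolding eq integral_mult_right_zero [symmetric]
      by (subst integral_Re) (use i in auto)
  qed
  moreover have "Re (?K * integral\<^sup>L M' (\<lambda>\<omega>. iexp (inner u (Y \<omega>)))) = integral\<^sup>L M' (\<lambda>\<omega>. c * cos (inner u (Y \<omega>) + d))"
  proof -
    have i: "integrable M' (\<lambda>\<omega>. iexp (inner u (Y \<omega>)))"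
      by (rule N'.integrable_const_bound[of _ 1]) auto
    show ?thesis unfolding eq integral_mult_right_zero [symmetric]
      by (subst integral_Re) (use i in auto)
  qed
  ultimately show ?case unfolding test_limit_def by simp
next
  case (add f g)
  obtain A B where bd: "\<And>z. \<bar>f z\<bar> \<le> A" "\<And>z. \<bar>g z\<bar> \<le> B"
    using trig_sum_bounded add(1,2) by metis
  note i = integrable_test[OF trig_sum_continuous[OF add(1)] bd(1)] integrable_test[OF trig_sum_continuous[OF add(2)] bd(2)]
  show ?case using add(3,4) i unfolding test_limit_def by (simp add: tendsto_add)
qed

text \<open>An approximation on a disc may be large elsewhere, and clipping restores a bound
  independent of the approximation. As f is bounded, the clip is a uniform limit of polynomials on
  its range, and a polynomial of f is again a trigonometric sum.\<close>

lemma test_limit_clip: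
  assumes f: "trig_sum f" and B: "B \<ge> 0"
  shows "test_limit (\<lambda>z. max (-B) (min B (f z)))"
proof (rule test_limit_approx)
  show "continuous_on UNIV (\<lambda>z. max (-B) (min B (f z)))"
    by (intro continuous_intros trig_sum_continuous f)
  show "\<bar>max (-B) (min B (f z))\<bar> \<le> B" for z using B by linarith
  fix e :: real assume e: "e > 0"
  obtain S where S: "\<And>z. \<bar>f z\<bar> \<le> S" using trig_sum_bounded[OF f] by blast
  obtain p where p: "real_polynomial_function p" "\<And>y. y \<in> {-S..S} \<Longrightarrow> \<bar>max (-B) (min B y) - p y\<bar> < e"
  proof (rule Stone_Weierstrass_real_polynomial_function[of "{-S..S}" "\<lambda>y. max (-B) (min B y)" e])
    show "continuous_on {-S..S} (\<lambda>y. max (-B) (min B y))" by (intro continuous_intros)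
  qed (use e in auto)
  have t: "trig_sum (\<lambda>z. p (f z))" by (rule trig_sum_polynomial[OF p(1) f])
  have "\<bar>max (-B) (min B (f z)) - p (f z)\<bar> \<le> e + 0 * 0" for z
    using p(2)[of "f z"] S[of z] by (auto simp: abs_le_iff)
  note bnd = this
  show "\<exists>h \<kappa> c. test_limit h \<and> continuous_on UNIV h \<and> (\<exists>C. \<forall>z. \<bar>h z\<bar> \<le> C)
      \<and> test_limit \<kappa> \<and> continuous_on UNIV \<kappa> \<and> (\<exists>C. \<forall>z. \<bar>\<kappa> z\<bar> \<le> C)
      \<and> (\<forall>z. \<bar>max (-B) (min B (f z)) - h z\<bar> \<le> e + c * \<kappa> z) \<and> c * integral\<^sup>L M' (\<lambda>\<omega>. \<kappa> (Y \<omega>)) < e"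
  proof (rule exI[of _ "\<lambda>z. p (f z)"], rule exI[of _ "\<lambda>_. 0"], rule exI[of _ 0], intro conjI)
    show "\<exists>C. \<forall>z. \<bar>p (f z)\<bar> \<le> C" by (rule trig_sum_bounded[OF t])
    show "test_limit (\<lambda>_. 0)" by (rule test_limit_trig_sum[OF trig_sum_const])
    show "continuous_on UNIV (\<lambda>z. p (f z))" by (rule trig_sum_continuous[OF t])
  qed (use e test_limit_trig_sum[OF t] bnd in auto)
qed

text \<open>The characteristic function of the projection to v at t is the planar one at t v, so
  Levy's theorem on the line applies.\<close>

lemma test_limit_linear:
  fixes k :: "real \<Rightarrow> real"
  assumes k: "continuous_on UNIV k" "\<And>y. \<bar>k y\<bar> \<le> B"
  shows "test_limit (\<lambda>z. k (inner v z))"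
proof -
  note [measurable] = X Y
  have k' [measurable]: "k \<in> borel_measurable borel" using k(1) by (rule borel_measurable_continuous_onI)
  define D where "D n = distr (M n) borel (\<lambda>\<omega>. inner v (X n \<omega>))" for n
  define D' where "D' = distr M' borel (\<lambda>\<omega>. inner v (Y \<omega>))"
  interpret N: prob_space "M n" for n by (rule prob_M)
  interpret N': prob_space M' by (rule prob_M')
  have rd: "real_distribution (D n)" for n unfolding D_def by (rule N.real_distribution_distr) simp
  have rd': "real_distribution D'" unfolding D'_def by (rule N'.real_distribution_distr) simp
  have "(\<lambda>n. char (D n) t) \<longlonglongrightarrow> char D' t" for t
    using char_tendsto[of "t *\<^sub>R v"] by (simp add: char_def D_def D'_def integral_distr)
  then have "weak_conv_m D D'" by (rule levy_continuity[OF rd rd'])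
  then have "(\<lambda>n. integral\<^sup>L (D n) k) \<longlonglongrightarrow> integral\<^sup>L D' k"
    by (rule weak_conv_imp_integral_bdd_continuous_conv[OF rd rd', where B=B])
       (use k in \<open>auto simp: continuous_on_eq_continuous_at\<close>)
  then show ?thesis by (simp add: test_limit_def D_def D'_def integral_distr)
qed

text \<open>The integrand is a continuous substitute for the indicator of |s| > T and depends on one
  projection only, so that its expectations are known to converge.\<close>

lemma tail_vanishes:
  assumes "e > 0"
  shows "\<exists>T\<ge>0. integral\<^sup>L M' (\<lambda>\<omega>. min 1 (max 0 (\<bar>inner v (Y \<omega>)\<bar> - T))) < e"
proof -
  interpret N': prob_space M' by (rule prob_M')
  note [measurable] = Y
  have "(\<lambda>i. integral\<^sup>L M' (\<lambda>\<omega>. min 1 (max 0 (\<bar>inner v (Y \<omega>)\<bar> - real i)))) \<longlonglongrightarrow> integral\<^sup>L M' (\<lambda>\<omega>. 0)"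
  proof (rule integral_dominated_convergence[where w="\<lambda>_. 1"])
    show "AE \<omega> in M'. (\<lambda>i. min 1 (max 0 (\<bar>inner v (Y \<omega>)\<bar> - real i))) \<longlonglongrightarrow> 0"
    proof (rule AE_I2)
      fix \<omega>
      obtain N :: nat where "\<bar>inner v (Y \<omega>)\<bar> \<le> real N" using real_arch_simple by blast
      then have "eventually (\<lambda>i. min 1 (max 0 (\<bar>inner v (Y \<omega>)\<bar> - real i)) = 0) sequentially"
        by (intro eventually_sequentiallyI[of N]) auto
      then show "(\<lambda>i. min 1 (max 0 (\<bar>inner v (Y \<omega>)\<bar> - real i))) \<longlonglongrightarrow> 0" by (rule tendsto_eventually)
    qed
  qed auto
  then have "eventually (\<lambda>i. integral\<^sup>L M' (\<lambda>\<omega>. min 1 (max 0 (\<bar>inner v (Y \<omega>)\<bar> - real i))) < e) sequentially"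
    by (rule order_tendstoD(2)) (use assms in simp)
  then obtain i where "integral\<^sup>L M' (\<lambda>\<omega>. min 1 (max 0 (\<bar>inner v (Y \<omega>)\<bar> - real i))) < e"
    by (auto simp: eventually_sequentially)
  then show ?thesis by (intro exI[of _ "real i"]) auto
qed

text \<open>On a large disc g is uniformly close to a trigonometric sum by Stone-Weierstrass.
  Outside, g and the clipped sum are both bounded by B, and the tail functions of the two
  coordinates pay for the difference.\<close>

theorem converges_in_distribution: "converges_in_distribution M X M' Y"
  unfolding converges_in_distribution_def
proof (intro allI impI)
  fix g :: "complex \<Rightarrow> real"
  assume g: "continuous_on UNIV g \<and> bounded (range g)"
  then obtain B where B: "B > 0" "\<And>z. \<bar>g z\<bar> \<le> B" by (auto simp: bounded_pos)
  have "test_limit g"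
  proof (rule test_limit_approx)
    fix e :: real assume e: "e > 0"
    \<comment> \<open>Outside the disc the difference is at most 2 B, and the two tail expectations
      add up to less than 2 e'; hence the factor 4 B.\<close>
    define e' where "e' = e / (4 * B)"
    have e': "e' > 0" using e B by (simp add: e'_def)
    obtain T1 where T1: "T1 \<ge> 0" "integral\<^sup>L M' (\<lambda>\<omega>. min 1 (max 0 (\<bar>inner 1 (Y \<omega>)\<bar> - T1))) < e'"
      using tail_vanishes[OF e'] by blast
    obtain T2 where T2: "T2 \<ge> 0" "integral\<^sup>L M' (\<lambda>\<omega>. min 1 (max 0 (\<bar>inner \<i> (Y \<omega>)\<bar> - T2))) < e'"
      using tail_vanishes[OF e'] by blast
    define k where "k = (\<lambda>(T::real) y. min 1 (max 0 (\<bar>y\<bar> - T)))"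
    have k: "continuous_on UNIV (k T)" "\<bar>k T y\<bar> \<le> 1" "k T y \<ge> 0" for T y
      unfolding k_def by (auto intro!: continuous_intros)
    define \<kappa> where "\<kappa> = (\<lambda>z. k T1 (inner 1 z) + k T2 (inner \<i> z))"
    have c1: "continuous_on UNIV (\<lambda>z. k T (inner v z))" for T and v :: complex
      by (rule continuous_on_compose2[OF k(1)]) (auto intro!: continuous_intros)
    note i1 = integrable_test[OF c1[of T1 1] k(2)] and i2 = integrable_test[OF c1[of T2 \<i>] k(2)]
    have \<kappa>: "test_limit \<kappa>"
      using test_limit_linear[OF k(1,2), of T1 1] test_limit_linear[OF k(1,2), of T2 \<i>]
      unfolding test_limit_def \<kappa>_def using i1 i2 by (simp add: tendsto_add)
    have \<kappa>c: "continuous_on UNIV \<kappa>" unfolding \<kappa>_def by (intro continuous_on_add c1)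
    have \<kappa>b: "\<bar>\<kappa> z\<bar> \<le> 2" for z using k(2)[of T1 "inner 1 z"] k(2)[of T2 "inner \<i> z"] by (auto simp: \<kappa>_def)
    have "integral\<^sup>L M' (\<lambda>\<omega>. \<kappa> (Y \<omega>)) < 2 * e'"
      using T1(2) T2(2) i1(2) i2(2) by (simp add: \<kappa>_def k_def)
    then have small: "2 * B * integral\<^sup>L M' (\<lambda>\<omega>. \<kappa> (Y \<omega>)) < e"
      using B by (simp add: e'_def field_simps)
    \<comment> \<open>Outside this disc |Re z| \<ge> T1 + 1 or |Im z| \<ge> T2 + 1, so one of the
      two tail functions has reached the value 1.\<close>
    define R where "R = T1 + T2 + 2"
    obtain f where f: "trig_sum f" "\<And>z. z \<in> cball 0 R \<Longrightarrow> \<bar>g z - f z\<bar> < e"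
    proof -
      have "\<exists>f. trig_sum f \<and> (\<forall>z\<in>cball 0 R. \<bar>g z - f z\<bar> < e)"
      proof (rule Stone_Weierstrass_HOL[of "cball 0 R" trig_sum])
        show "trig_sum (\<lambda>z. f z + h z)" if "trig_sum f \<and> trig_sum h" for f h :: "complex \<Rightarrow> real"
          using that trig_sum.add by blast
        show "trig_sum (\<lambda>z. f z * h z)" if "trig_sum f \<and> trig_sum h" for f h :: "complex \<Rightarrow> real"
          using that trig_sum_mult by blast
        show "continuous_on (cball 0 R) g" using g continuous_on_subset by blast
        show "\<exists>f. trig_sum f \<and> f x \<noteq> f y" if "x \<in> cball 0 R \<and> y \<in> cball 0 R \<and> x \<noteq> y" for x y :: complex
          using that trig_sum_separates by blast
      qed (simp_all add: trig_sum_const trig_sum_continuous e)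
      then show ?thesis using that by blast
    qed
    define h where "h = (\<lambda>z. max (-B) (min B (f z)))"
    have h: "test_limit h" unfolding h_def using B by (intro test_limit_clip f) auto
    have hc: "continuous_on UNIV h" unfolding h_def by (intro continuous_intros trig_sum_continuous f)
    have hb: "\<bar>h z\<bar> \<le> B" for z using B(1) by (auto simp: h_def)
    have "\<bar>g z - h z\<bar> \<le> e + 2 * B * \<kappa> z" for z
    proof (cases "z \<in> cball 0 R")
      case True
      have "\<bar>g z - h z\<bar> \<le> \<bar>g z - f z\<bar>" using B(2)[of z] unfolding h_def by (auto simp: abs_if min_def max_def split: if_splits)
      moreover have "\<kappa> z \<ge> 0" using k(3) by (simp add: \<kappa>_def)
      ultimately show ?thesis using f(2)[OF True] B(1) by (smt (verit) mult_nonneg_nonneg)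
    next
      case False
      have "norm z \<le> \<bar>Re z\<bar> + \<bar>Im z\<bar>" by (rule cmod_le)
      then have "\<bar>Re z\<bar> \<ge> T1 + 1 \<or> \<bar>Im z\<bar> \<ge> T2 + 1" using False by (auto simp: R_def)
      then have "k T1 (inner 1 z) = 1 \<or> k T2 (inner \<i> z) = 1" by (auto simp: k_def inner_complex_def)
      then have "\<kappa> z \<ge> 1" using k(3)[of T1 "inner 1 z"] k(3)[of T2 "inner \<i> z"] by (auto simp: \<kappa>_def)
      then have "2 * B * \<kappa> z \<ge> 2 * B * 1" using B by (intro mult_left_mono) auto
      moreover have "\<bar>g z - h z\<bar> \<le> 2 * B" using B(2)[of z] hb[of z] by linarith
      ultimately show ?thesis using e by linarith
    qed
    note bnd = this
    show "\<exists>h \<kappa> c. test_limit h \<and> continuous_on UNIV h \<and> (\<exists>C. \<forall>z. \<bar>h z\<bar> \<le> C)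
      \<and> test_limit \<kappa> \<and> continuous_on UNIV \<kappa> \<and> (\<exists>C. \<forall>z. \<bar>\<kappa> z\<bar> \<le> C)
      \<and> (\<forall>z. \<bar>g z - h z\<bar> \<le> e + c * \<kappa> z) \<and> c * integral\<^sup>L M' (\<lambda>\<omega>. \<kappa> (Y \<omega>)) < e"
    proof (rule exI[of _ h], rule exI[of _ \<kappa>], rule exI[of _ "2 * B"], intro conjI)
      show "\<exists>C. \<forall>z. \<bar>h z\<bar> \<le> C" using hb by blast
      show "\<exists>C. \<forall>z. \<bar>\<kappa> z\<bar> \<le> C" using \<kappa>b by blast
    qed (simp_all add: h hc \<kappa> \<kappa>c small bnd)
  qed (use g B in auto)
  then show "(\<lambda>n. integral\<^sup>L (M n) (\<lambda>\<omega>. g (X n \<omega>))) \<longlonglongrightarrow> integral\<^sup>L M' (\<lambda>\<omega>. g (Y \<omega>))"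
    unfolding test_limit_def .
qed

end

section \<open>Complex normal variables\<close>

text \<open>Two independent standard normals as coordinates of the plane. All limit variables are
  linear images of this pair.\<close>

definition std_complex_normal :: "complex measure" where
  "std_complex_normal = distr (std_normal_distribution \<Otimes>\<^sub>M std_normal_distribution) borel (\<lambda>(x, y). Complex x y)"

lemma Complex_measurable [measurable]:
  "(\<lambda>(x, y). Complex x y) \<in> borel_measurable (borel \<Otimes>\<^sub>M borel)"
  unfolding borel_prod
  by (rule borel_measurable_continuous_onI)
     (simp add: case_prod_beta' Complex_eq, intro continuous_intros)

interpretation std: real_distribution std_normal_distribution
  by (rule real_dist_normal_dist)

interpretation std_pair: pair_prob_space std_normal_distribution std_normal_distribution ..

lemma sets_std_pair [measurable_cong]:
  "sets (std_normal_distribution \<Otimes>\<^sub>M std_normal_distribution) = sets (borel \<Otimes>\<^sub>M borel)"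
  by (rule sets_pair_measure_cong) simp_all

interpretation scn: prob_space std_complex_normal
  unfolding std_complex_normal_def by (rule std_pair.prob_space_distr) measurable

lemma sets_scn [measurable_cong, simp]: "sets std_complex_normal = sets borel"
  by (simp add: std_complex_normal_def)

lemma distr_scn_Re: "distr std_complex_normal borel Re = std_normal_distribution"
proof -
  have "distr std_complex_normal borel Re = distr (std_normal_distribution \<Otimes>\<^sub>M std_normal_distribution) borel (Re \<circ> (\<lambda>(x, y). Complex x y))"
    unfolding std_complex_normal_def by (rule distr_distr) measurable
  also have "\<dots> = distr (std_normal_distribution \<Otimes>\<^sub>M std_normal_distribution) std_normal_distribution fst"
    by (rule distr_cong) (auto simp: comp_def)
  also have "\<dots> = std_normal_distribution" by (rule std.distr_pair_fst)
  finally show ?thesis .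
qed

lemma distr_scn_Im: "distr std_complex_normal borel Im = std_normal_distribution"
proof -
  have "distr std_complex_normal borel Im = distr (std_normal_distribution \<Otimes>\<^sub>M std_normal_distribution) borel (Im \<circ> (\<lambda>(x, y). Complex x y))"
    unfolding std_complex_normal_def by (rule distr_distr) measurable
  also have "\<dots> = distr (std_normal_distribution \<Otimes>\<^sub>M std_normal_distribution) borel (fst \<circ> (\<lambda>(x, y). (y, x)))"
    by (rule distr_cong) (auto simp: comp_def)
  also have "\<dots> = distr (distr (std_normal_distribution \<Otimes>\<^sub>M std_normal_distribution) (std_normal_distribution \<Otimes>\<^sub>M std_normal_distribution) (\<lambda>(x, y). (y, x))) borel fst"
    by (rule distr_distr [symmetric]) measurable
  also have "\<dots> = distr (std_normal_distribution \<Otimes>\<^sub>M std_normal_distribution) borel fst"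
    unfolding std_pair.distr_pair_swap [symmetric] ..
  also have "\<dots> = distr (std_normal_distribution \<Otimes>\<^sub>M std_normal_distribution) std_normal_distribution fst"
    by (rule distr_cong) auto
  also have "\<dots> = std_normal_distribution" by (rule std.distr_pair_fst)
  finally show ?thesis .
qed

lemma indep_scn: "scn.indep_var borel Re borel Im"
  unfolding scn.indep_var_distribution_eq
proof (intro conjI)
  have "distr std_complex_normal (borel \<Otimes>\<^sub>M borel) (\<lambda>x. (Re x, Im x)) =
     distr (std_normal_distribution \<Otimes>\<^sub>M std_normal_distribution) (borel \<Otimes>\<^sub>M borel) ((\<lambda>x. (Re x, Im x)) \<circ> (\<lambda>(x, y). Complex x y))"
    unfolding std_complex_normal_def by (rule distr_distr) measurable
  also have "\<dots> = distr (std_normal_distribution \<Otimes>\<^sub>M std_normal_distribution) (std_normal_distribution \<Otimes>\<^sub>M std_normal_distribution) (\<lambda>z. z)"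
    by (rule distr_cong) (auto simp: comp_def sets_std_pair)
  finally show "distr std_complex_normal borel Re \<Otimes>\<^sub>M distr std_complex_normal borel Im = distr std_complex_normal (borel \<Otimes>\<^sub>M borel) (\<lambda>x. (Re x, Im x))"
    by (simp add: distr_scn_Re distr_scn_Im distr_id)
qed simp_all

lemma distributed_scn:
  "distributed std_complex_normal lborel Re std_normal_density"
  "distributed std_complex_normal lborel Im std_normal_density"
proof -
  have "distr std_complex_normal lborel Re = distr std_complex_normal borel Re"
    "distr std_complex_normal lborel Im = distr std_complex_normal borel Im"
    by (rule distr_cong; simp)+
  then show "distributed std_complex_normal lborel Re std_normal_density"
    "distributed std_complex_normal lborel Im std_normal_density"
    by (simp_all add: distributed_def distr_scn_Re distr_scn_Im)
qed

lemma scn_moments: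
  "integrable std_complex_normal Re" "integrable std_complex_normal Im"
  "integrable std_complex_normal (\<lambda>z. (Re z)\<^sup>2)" "integrable std_complex_normal (\<lambda>z. Re z * Im z)"
  "scn.expectation Re = 0" "scn.expectation Im = 0"
  "scn.expectation (\<lambda>z. (Re z)\<^sup>2) = 1" "scn.expectation (\<lambda>z. Re z * Im z) = 0"
proof -
  have i: "integrable std_normal_distribution (\<lambda>x. x)" "integrable std_normal_distribution (\<lambda>x. x\<^sup>2)"
    using integrable_std_normal_distribution_moment[of 1] integrable_std_normal_distribution_moment[of 2]
    unfolding power_one_right by this+
  have e: "integral\<^sup>L std_normal_distribution (\<lambda>x. x) = 0" "integral\<^sup>L std_normal_distribution (\<lambda>x. x\<^sup>2) = 1"
  proof -
    show "integral\<^sup>L std_normal_distribution (\<lambda>x. x) = 0"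
      using integral_std_normal_distribution_moment_odd[OF odd_one] unfolding power_one_right .
    have "integral\<^sup>L std_normal_distribution (\<lambda>x. x ^ (2 * 1)) = 1"
      unfolding std_normal_distribution_even_moments(1)[of 1] by (simp add: fact_2)
    then show "integral\<^sup>L std_normal_distribution (\<lambda>x. x\<^sup>2) = 1" by (simp only: mult_1_right)
  qed
  have R: "integrable std_complex_normal (\<lambda>z. f (Re z)) \<longleftrightarrow> integrable std_normal_distribution f"
    "integrable std_complex_normal (\<lambda>z. f (Im z)) \<longleftrightarrow> integrable std_normal_distribution f"
    "scn.expectation (\<lambda>z. f (Re z)) = integral\<^sup>L std_normal_distribution f"
    "scn.expectation (\<lambda>z. f (Im z)) = integral\<^sup>L std_normal_distribution f"
    if "f \<in> borel_measurable borel" for f :: "real \<Rightarrow> real"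
  proof -
    have m: "Re \<in> measurable std_complex_normal borel" "Im \<in> measurable std_complex_normal borel" by measurable
    show "integrable std_complex_normal (\<lambda>z. f (Re z)) \<longleftrightarrow> integrable std_normal_distribution f"
      using integrable_distr_eq[OF m(1) that] unfolding distr_scn_Re by (rule sym)
    show "integrable std_complex_normal (\<lambda>z. f (Im z)) \<longleftrightarrow> integrable std_normal_distribution f"
      using integrable_distr_eq[OF m(2) that] unfolding distr_scn_Im by (rule sym)
    show "scn.expectation (\<lambda>z. f (Re z)) = integral\<^sup>L std_normal_distribution f"
      using integral_distr[OF m(1) that] unfolding distr_scn_Re by (rule sym)
    show "scn.expectation (\<lambda>z. f (Im z)) = integral\<^sup>L std_normal_distribution f"
      using integral_distr[OF m(2) that] unfolding distr_scn_Im by (rule sym)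
  qed
  have m: "(\<lambda>x. x) \<in> borel_measurable (borel :: real measure)" "(\<lambda>x. x\<^sup>2) \<in> borel_measurable (borel :: real measure)"
    by measurable
  show 1: "integrable std_complex_normal Re" "integrable std_complex_normal Im"
    using i(1) R(1,2)[OF m(1)] by blast+
  show "integrable std_complex_normal (\<lambda>z. (Re z)\<^sup>2)" using i(2) R(1)[OF m(2)] by blast
  show 2: "scn.expectation Re = 0" "scn.expectation Im = 0"
    unfolding R(3,4)[OF m(1)] by (rule e(1))+
  show "scn.expectation (\<lambda>z. (Re z)\<^sup>2) = 1" unfolding R(3)[OF m(2)] by (rule e(2))
  show "integrable std_complex_normal (\<lambda>z. Re z * Im z)" by (rule scn.indep_var_integrable[OF indep_scn 1])
  show "scn.expectation (\<lambda>z. Re z * Im z) = 0"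
    unfolding scn.indep_var_lebesgue_integral[OF indep_scn 1] 2 by simp
qed

text \<open>A multiple of a coordinate has a normal density only for a nonzero factor. The sum of
  independent normals therefore covers one case of four, and the combination is constant when both
  factors vanish.\<close>

lemma real_normal_scn: "real_normal std_complex_normal (\<lambda>z. p * Re z + q * Im z)"
proof -
  have aff: "distributed std_complex_normal lborel (\<lambda>z. p * Re z) (normal_density 0 \<bar>p\<bar>)" if "p \<noteq> 0" for p
    using scn.normal_density_affine[OF distributed_scn(1), of p 0] that by simp
  have aff': "distributed std_complex_normal lborel (\<lambda>z. q * Im z) (normal_density 0 \<bar>q\<bar>)" if "q \<noteq> 0" for q
    using scn.normal_density_affine[OF distributed_scn(2), of q 0] that by simp
  have "(\<exists>\<mu> \<sigma>. 0 < \<sigma> \<and> distributed std_complex_normal lborel (\<lambda>z. p * Re z + q * Im z) (\<lambda>y. ennreal (normal_density \<mu> \<sigma> y)))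
      \<or> (\<exists>\<mu>. AE z in std_complex_normal. p * Re z + q * Im z = \<mu>)"
  proof (cases "p = 0"; cases "q = 0")
    assume "p = 0" "q = 0"
    then show ?thesis by simp
  next
    assume "p = 0" "q \<noteq> 0"
    then show ?thesis using aff'[of q] by (intro disjI1 exI[of _ 0] exI[of _ "\<bar>q\<bar>"]) simp
  next
    assume "p \<noteq> 0" "q = 0"
    then show ?thesis using aff[of p] by (intro disjI1 exI[of _ 0] exI[of _ "\<bar>p\<bar>"]) simp
  next
    assume pq: "p \<noteq> 0" "q \<noteq> 0"
    have "scn.indep_var borel ((\<lambda>x. p * x) \<circ> Re) borel ((\<lambda>x. q * x) \<circ> Im)"
      by (rule scn.indep_var_compose[OF indep_scn]) simp_all
    then have "distributed std_complex_normal lborel (\<lambda>z. p * Re z + q * Im z) (normal_density (0 + 0) (sqrt (\<bar>p\<bar>\<^sup>2 + \<bar>q\<bar>\<^sup>2)))"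
      using pq by (intro scn.add_indep_normal aff aff') (auto simp: comp_def)
    moreover have "sqrt (\<bar>p\<bar>\<^sup>2 + \<bar>q\<bar>\<^sup>2) > 0" using pq by (simp add: sum_power2_gt_zero_iff)
    ultimately show ?thesis by blast
  qed
  then show ?thesis by (simp add: real_normal_def)
qed

lemma char_scn:
  "scn.expectation (\<lambda>z. iexp (p * Re z + q * Im z)) = of_real (exp (- (p\<^sup>2 + q\<^sup>2) / 2))"
proof -
  have "scn.indep_var borel ((\<lambda>x. p * x) \<circ> Re) borel ((\<lambda>x. q * x) \<circ> Im)"
    by (rule scn.indep_var_compose[OF indep_scn]) simp_all
  then have ind: "scn.indep_var borel (\<lambda>z. p * Re z) borel (\<lambda>z. q * Im z)" by (simp add: comp_def)
  have "scn.expectation (\<lambda>z. iexp (p * Re z + q * Im z)) = char (distr std_complex_normal borel (\<lambda>z. p * Re z + q * Im z)) 1"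
    unfolding char_def by (subst integral_distr) simp_all
  also have "\<dots> = char (distr std_complex_normal borel (\<lambda>z. p * Re z)) 1 * char (distr std_complex_normal borel (\<lambda>z. q * Im z)) 1"
    by (rule scn.char_distr_add[OF ind])
  also have "char (distr std_complex_normal borel (\<lambda>z. p * Re z)) 1 = char (distr std_complex_normal borel Re) p"
    unfolding char_def by (subst (1 2) integral_distr) simp_all
  also have "char (distr std_complex_normal borel (\<lambda>z. q * Im z)) 1 = char (distr std_complex_normal borel Im) q"
    unfolding char_def by (subst (1 2) integral_distr) simp_all
  finally show ?thesis
    unfolding distr_scn_Re distr_scn_Im char_std_normal_distribution
    by (simp add: exp_add [symmetric] of_real_mult [symmetric] add_divide_distrib del: of_real_mult of_real_exp)
qed

text \<open>\<alpha>, \<beta>, \<gamma> are the entries of the triangular (Cholesky) root of the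
  matrix with rows A, c and c, D. If A = 0 the inequality forces c = 0, and \<beta> = 0 is
  consistent. For c = 0 the two parts depend on different coordinates and are independent;
  conversely independence makes the covariance vanish.\<close>

lemma complex_normal_exists:
  fixes A c D :: real
  assumes A: "A \<ge> 0" and cs: "c\<^sup>2 \<le> A * D" and D: "D \<ge> 0"
  obtains N :: "complex \<Rightarrow> complex" where
    "N \<in> borel_measurable std_complex_normal" "complex_normal std_complex_normal N"
    "covariance std_complex_normal (\<lambda>\<omega>. Re (N \<omega>)) (\<lambda>\<omega>. Im (N \<omega>)) = c"
    "scn.indep_var borel (\<lambda>\<omega>. Re (N \<omega>)) borel (\<lambda>\<omega>. Im (N \<omega>)) \<longleftrightarrow> c = 0"
    "\<And>u. scn.expectation (\<lambda>\<omega>. iexp (inner u (N \<omega>))) =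
       of_real (exp (- (A * (Re u)\<^sup>2 + 2 * c * Re u * Im u + D * (Im u)\<^sup>2) / 2))"
proof -
  define \<alpha> where "\<alpha> = sqrt A"
  define \<beta> where "\<beta> = (if A = 0 then 0 else c / \<alpha>)"
  define \<gamma> where "\<gamma> = sqrt (D - \<beta>\<^sup>2)"
  define N where "N = (\<lambda>z. Complex (\<alpha> * Re z) (\<beta> * Re z + \<gamma> * Im z))"
  have c0: "c = 0" if "A = 0" using cs that by simp
  have \<alpha>2: "\<alpha>\<^sup>2 = A" using A by (simp add: \<alpha>_def)
  have \<alpha>\<beta>: "\<alpha> * \<beta> = c" using c0 \<alpha>2 by (auto simp: \<beta>_def)
  have "\<beta>\<^sup>2 \<le> D"
  proof (cases "A = 0")
    case False
    then have "\<beta>\<^sup>2 = c\<^sup>2 / A" by (simp add: \<beta>_def power_divide \<alpha>2)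
    also have "\<dots> \<le> D" using cs A False by (simp add: field_simps)
    finally show ?thesis .
  qed (use D in \<open>simp add: \<beta>_def\<close>)
  then have \<gamma>2: "\<gamma>\<^sup>2 = D - \<beta>\<^sup>2" by (simp add: \<gamma>_def)
  have N: "Re (N z) = \<alpha> * Re z" "Im (N z) = \<beta> * Re z + \<gamma> * Im z" for z by (simp_all add: N_def)
  have Nm: "N \<in> borel_measurable std_complex_normal"
    unfolding N_def Complex_eq by measurable
  have cov: "covariance std_complex_normal (\<lambda>\<omega>. Re (N \<omega>)) (\<lambda>\<omega>. Im (N \<omega>)) = c"
  proof -
    have m0: "scn.expectation (\<lambda>z. \<alpha> * Re z) = 0" "scn.expectation (\<lambda>z. \<beta> * Re z + \<gamma> * Im z) = 0"
      using scn_moments by simp_all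
    have "covariance std_complex_normal (\<lambda>\<omega>. Re (N \<omega>)) (\<lambda>\<omega>. Im (N \<omega>)) =
        scn.expectation (\<lambda>z. (\<alpha> * \<beta>) * (Re z)\<^sup>2 + (\<alpha> * \<gamma>) * (Re z * Im z))"
      unfolding covariance_def N m0 by (intro Bochner_Integration.integral_cong refl) (simp add: algebra_simps power2_eq_square)
    also have "\<dots> = c" using scn_moments \<alpha>\<beta> by simp
    finally show ?thesis .
  qed
  show thesis
  proof (rule that[of N])
    show "N \<in> borel_measurable std_complex_normal" by (rule Nm)
    have "real_normal std_complex_normal (\<lambda>\<omega>. a * Re (N \<omega>) + b * Im (N \<omega>))" for a b
      using real_normal_scn[of "a * \<alpha> + b * \<beta>" "b * \<gamma>"] by (simp add: N algebra_simps)
    then show "complex_normal std_complex_normal N" using Nm by (simp add: complex_normal_def)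
    show "covariance std_complex_normal (\<lambda>\<omega>. Re (N \<omega>)) (\<lambda>\<omega>. Im (N \<omega>)) = c" by (rule cov)
    show "scn.indep_var borel (\<lambda>\<omega>. Re (N \<omega>)) borel (\<lambda>\<omega>. Im (N \<omega>)) \<longleftrightarrow> c = 0"
    proof
      assume ind: "scn.indep_var borel (\<lambda>\<omega>. Re (N \<omega>)) borel (\<lambda>\<omega>. Im (N \<omega>))"
      have m0: "scn.expectation (\<lambda>z. Re (N z)) = 0" "scn.expectation (\<lambda>z. Im (N z)) = 0"
        unfolding N using scn_moments by simp_all
      have "scn.expectation (\<lambda>\<omega>. Re (N \<omega>) * Im (N \<omega>)) = 0"
        using scn.indep_var_lebesgue_integral[OF ind] m0 scn_moments by (simp add: N)
      then show "c = 0" using cov by (simp add: covariance_def m0)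
    next
      assume "c = 0"
      then have "\<beta> = 0" by (simp add: \<beta>_def)
      have "scn.indep_var borel ((\<lambda>x. \<alpha> * x) \<circ> Re) borel ((\<lambda>x. \<gamma> * x) \<circ> Im)"
        by (rule scn.indep_var_compose[OF indep_scn]) simp_all
      then show "scn.indep_var borel (\<lambda>\<omega>. Re (N \<omega>)) borel (\<lambda>\<omega>. Im (N \<omega>))"
        unfolding N by (simp add: comp_def \<open>\<beta> = 0\<close>)
    qed
    fix u :: complex
    have "inner u (N z) = (Re u * \<alpha> + Im u * \<beta>) * Re z + (Im u * \<gamma>) * Im z" for z
      by (simp add: inner_complex_def N algebra_simps)
    then have "scn.expectation (\<lambda>\<omega>. iexp (inner u (N \<omega>))) =
        of_real (exp (- ((Re u * \<alpha> + Im u * \<beta>)\<^sup>2 + (Im u * \<gamma>)\<^sup>2) / 2))"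
      using char_scn[of "Re u * \<alpha> + Im u * \<beta>" "Im u * \<gamma>"] by (simp only:)
    also have "(Re u * \<alpha> + Im u * \<beta>)\<^sup>2 + (Im u * \<gamma>)\<^sup>2 = A * (Re u)\<^sup>2 + 2 * c * Re u * Im u + D * (Im u)\<^sup>2"
    proof -
      have "(Re u * \<alpha> + Im u * \<beta>)\<^sup>2 + (Im u * \<gamma>)\<^sup>2 = \<alpha>\<^sup>2 * (Re u)\<^sup>2 + 2 * (\<alpha> * \<beta>) * Re u * Im u + (\<beta>\<^sup>2 + \<gamma>\<^sup>2) * (Im u)\<^sup>2"
        by (simp add: power2_eq_square algebra_simps)
      then show ?thesis by (simp add: \<alpha>2 \<alpha>\<beta> \<gamma>2)
    qed
    finally show "scn.expectation (\<lambda>\<omega>. iexp (inner u (N \<omega>))) =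
       of_real (exp (- (A * (Re u)\<^sup>2 + 2 * c * Re u * Im u + D * (Im u)\<^sup>2) / 2))" .
  qed
qed

section \<open>The limit theorem for cycle sums\<close>

lemma power_mean_equidistributes:
  assumes eq: "equidistributes x G 0 1" and x: "\<And>m. 0 \<le> x m" "\<And>m. x m < 1"
  obtains c0 where "c0 > 0" "\<And>c A \<psi>. 0 < c \<Longrightarrow> c \<le> c0 \<Longrightarrow> exp_growth A c \<psi> \<Longrightarrow>
    set_integrable lborel {0..<1} (\<lambda>s. \<psi> (G s)) \<and> power_mean (\<lambda>m. \<psi> (G (x m))) (LINT s:{0..<1}|lborel. \<psi> (G s))"
proof -
  obtain c0 where c0: "c0 > 0" "\<And>c A \<psi>. 0 < c \<Longrightarrow> c \<le> c0 \<Longrightarrow> exp_growth A c \<psi> \<Longrightarrow>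
     set_integrable lborel {0..<1} (\<lambda>s. \<psi> (G s)) \<and>
     (\<exists>C \<delta>. \<delta> > 0 \<and> (\<forall>n\<ge>1. \<bar>disc_err x (\<lambda>s. \<psi> (G s)) n 0 1\<bar> \<le> C * real n powr (1 - \<delta>)))"
    using eq unfolding equidistributes_def by auto
  show thesis
  proof (rule that[OF c0(1)])
    fix c A \<psi> assume c: "0 < c" "c \<le> c0" "exp_growth A c \<psi>"
    have "disc_err x (\<lambda>s. \<psi> (G s)) n 0 1 = (\<Sum>m=1..n. \<psi> (G (x m))) - real n * (LINT s:{0..<1}|lborel. \<psi> (G s))" for n
      unfolding disc_err_def using x by (simp add: indicator_def)
    then show "set_integrable lborel {0..<1} (\<lambda>s. \<psi> (G s)) \<and> power_mean (\<lambda>m. \<psi> (G (x m))) (LINT s:{0..<1}|lborel. \<psi> (G s))"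
      using c0(2)[OF c] unfolding power_mean_def by simp
  qed
qed

text \<open>The deviation of the partial sums from n l has period p and is therefore bounded, so
  that even \<delta> = 1 is possible.\<close>

lemma power_mean_periodic:
  assumes p: "p \<ge> 1" and per: "\<And>m. \<phi> (m + p) = \<phi> m"
  shows "power_mean \<phi> ((\<Sum>m=1..p. \<phi> m) / real p)"
proof -
  define l where "l = (\<Sum>m=1..p. \<phi> m) / real p"
  define S where "S n = (\<Sum>m=1..n. \<phi> m) - real n * l" for n
  define C where "C = Max ((\<lambda>r. \<bar>S r\<bar>) ` {..<p})"
  have per': "S (n + p) = S n" for n
  proof -
    have "(\<Sum>m=1..n + p. \<phi> m) = (\<Sum>m=1..n. \<phi> m) + (\<Sum>m=1..p. \<phi> m)"
    proof (induction n)
      case (Suc n)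
      have "(\<Sum>m=1..Suc n + p. \<phi> m) = (\<Sum>m=1..n + p. \<phi> m) + \<phi> (Suc n + p)" by simp
      then show ?case using Suc per[of "Suc n"] by simp
    qed simp
    moreover have "real p * l = (\<Sum>m=1..p. \<phi> m)" using p by (simp add: l_def)
    moreover have "real (n + p) * l = real n * l + real p * l" by (simp add: distrib_right)
    ultimately show ?thesis unfolding S_def by linarith
  qed
  have bd: "\<bar>S n\<bar> \<le> C" for n
  proof (induction n rule: less_induct)
    case (less n)
    show ?case
    proof (cases "n < p")
      case True
      then show ?thesis unfolding C_def by (intro Max_ge) auto
    next
      case False
      then show ?thesis using less[of "n - p"] per'[of "n - p"] p by simp
    qed
  qed
  show ?thesis unfolding power_mean_def l_def [symmetric]
    using bd by (intro exI[of _ C] exI[of _ 1]) (auto simp: S_def)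
qed

section \<open>Logarithmic means and second moments\<close>

definition log_mean_value :: "(nat \<Rightarrow> real) \<Rightarrow> real \<Rightarrow> bool" where
  "log_mean_value \<phi> l \<longleftrightarrow> (\<exists>C. \<forall>n\<ge>1. \<bar>(\<Sum>m=1..n. \<phi> m / real m) - l * ln (real n)\<bar> \<le> C)"

lemma log_mean_value_add:
  assumes "log_mean_value \<phi> k" "log_mean_value \<psi> l"
  shows "log_mean_value (\<lambda>m. \<phi> m + \<psi> m) (k + l)"
proof -
  obtain C D where h: "\<And>n. n \<ge> 1 \<Longrightarrow> \<bar>(\<Sum>m=1..n. \<phi> m / real m) - k * ln (real n)\<bar> \<le> C"
    "\<And>n. n \<ge> 1 \<Longrightarrow> \<bar>(\<Sum>m=1..n. \<psi> m / real m) - l * ln (real n)\<bar> \<le> D"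
    using assms unfolding log_mean_value_def by blast
  have "\<bar>(\<Sum>m=1..n. (\<phi> m + \<psi> m) / real m) - (k + l) * ln (real n)\<bar> \<le> C + D" if "n \<ge> 1" for n
    using h(1)[OF that] h(2)[OF that] unfolding add_divide_distrib sum.distrib distrib_right by linarith
  then show ?thesis unfolding log_mean_value_def by blast
qed

lemma log_mean_value_cmult:
  assumes "log_mean_value \<phi> l"
  shows "log_mean_value (\<lambda>m. a * \<phi> m) (a * l)"
proof -
  obtain C where h: "\<And>n. n \<ge> 1 \<Longrightarrow> \<bar>(\<Sum>m=1..n. \<phi> m / real m) - l * ln (real n)\<bar> \<le> C"
    using assms unfolding log_mean_value_def by blast
  have "\<bar>(\<Sum>m=1..n. a * \<phi> m / real m) - a * l * ln (real n)\<bar> \<le> \<bar>a\<bar> * C" if "n \<ge> 1" for n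
  proof -
    have "(\<Sum>m=1..n. a * \<phi> m / real m) - a * l * ln (real n) = a * ((\<Sum>m=1..n. \<phi> m / real m) - l * ln (real n))"
      by (simp add: sum_distrib_left right_diff_distrib)
    then show ?thesis using h[OF that] by (simp add: abs_mult mult_left_mono)
  qed
  then show ?thesis unfolding log_mean_value_def by blast
qed

lemma ln_le_harmonic:
  assumes "n \<ge> 1" shows "ln (real n) \<le> (\<Sum>m=1..n. 1 / real m)"
proof -
  have "ln (real (Suc n)) \<le> (\<Sum>m=1..n. 1 / real m)" for n
  proof (induction n)
    case (Suc n)
    have "ln (real (Suc (Suc n)) / real (Suc n)) \<le> real (Suc (Suc n)) / real (Suc n) - 1"
      by (intro ln_le_minus_one) auto
    also have "\<dots> = 1 / real (Suc n)" by (simp add: field_simps)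
    also have "ln (real (Suc (Suc n)) / real (Suc n)) = ln (real (Suc (Suc n))) - ln (real (Suc n))"
      by (simp add: ln_div)
    finally show ?case using Suc by simp
  qed simp
  moreover have "ln (real n) \<le> ln (real (Suc n))" using assms by simp
  ultimately show ?thesis by (rule order.trans[rotated])
qed

text \<open>Summation by parts: the deviation O(m^(1 - \<delta>)) of the partial sums meets the
  differences 1 / m - 1 / (m + 1), which are O(m^(-2)), and the series of m^(-1 - \<delta>)
  converges. The constant part contributes l times a harmonic sum.\<close>

lemma log_mean_value_power_mean:
  assumes "power_mean \<phi> l"
  shows "log_mean_value \<phi> l"
proof -
  obtain C \<delta> where \<delta>: "\<delta> > 0" and C: "\<And>n. n \<ge> 1 \<Longrightarrow> \<bar>(\<Sum>m=1..n. \<phi> m) - real n * l\<bar> \<le> C * real n powr (1 - \<delta>)"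
    using assms unfolding power_mean_def by blast
  define S where "S n = (\<Sum>m=1..n. \<phi> m - l)" for n
  have S: "\<bar>S n\<bar> \<le> C * real n powr (1 - \<delta>)" if "n \<ge> 1" for n
    using C[OF that] by (simp add: S_def sum_subtractf)
  have C0: "C \<ge> 0" using S[of 1] by simp
  have abel: "(\<Sum>m=1..n. (\<phi> m - l) / real m) = S n / real (Suc n) + (\<Sum>m=1..n. S m * (1 / real m - 1 / real (Suc m)))" for n
  proof (induction n)
    case (Suc n)
    have "S (Suc n) = S n + (\<phi> (Suc n) - l)" by (simp add: S_def)
    then have "S (Suc n) / real (Suc n) = S n / real (Suc n) + (\<phi> (Suc n) - l) / real (Suc n)"
      by (simp add: add_divide_distrib diff_divide_distrib)
    then show ?case using Suc by (simp add: right_diff_distrib)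
  qed (simp add: S_def)
  have sm: "summable (\<lambda>m. real m powr (-1 - \<delta>))" using \<delta> by (simp add: summable_real_powr_iff)
  define Z where "Z = (\<Sum>m. real m powr (-1 - \<delta>))"
  have tm: "\<bar>S m * (1 / real m - 1 / real (Suc m))\<bar> \<le> C * real m powr (-1 - \<delta>)" if m: "m \<ge> 1" for m
  proof -
    have "1 / real m - 1 / real (Suc m) = 1 / (real m * real (Suc m))" using m by (simp add: field_simps)
    also have "\<dots> \<le> 1 / (real m * real m)" using m by (intro divide_left_mono mult_left_mono) auto
    also have "\<dots> = real m powr (-2)" using m by (simp add: powr_minus powr_numeral power2_eq_square divide_inverse)
    finally have 1: "1 / real m - 1 / real (Suc m) \<le> real m powr (-2)" .
    have 2: "0 \<le> 1 / real m - 1 / real (Suc m)" using m by (simp add: frac_le)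
    have "\<bar>S m * (1 / real m - 1 / real (Suc m))\<bar> \<le> (C * real m powr (1 - \<delta>)) * real m powr (-2)"
      unfolding abs_mult abs_of_nonneg[OF 2] using S[OF m] C0 1 2 by (intro mult_mono) auto
    also have "\<dots> = C * real m powr (-1 - \<delta>)" by (simp add: powr_add [symmetric] mult.assoc)
    finally show ?thesis .
  qed
  have bd: "\<bar>\<Sum>m=1..n. (\<phi> m - l) / real m\<bar> \<le> C + C * Z" if n: "n \<ge> 1" for n
  proof -
    have "\<bar>S n / real (Suc n)\<bar> \<le> C"
    proof -
      have "\<bar>S n\<bar> \<le> C * real n powr (1 - \<delta>)" by (rule S[OF n])
      also have "\<dots> \<le> C * real n powr 1" using C0 \<delta> n by (intro mult_left_mono powr_mono) auto
      also have "\<dots> \<le> C * real (Suc n)" using C0 n by (intro mult_left_mono) auto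
      finally show ?thesis by (simp add: abs_divide pos_divide_le_eq)
    qed
    moreover have "\<bar>\<Sum>m=1..n. S m * (1 / real m - 1 / real (Suc m))\<bar> \<le> C * Z"
    proof -
      have "\<bar>\<Sum>m=1..n. S m * (1 / real m - 1 / real (Suc m))\<bar> \<le> (\<Sum>m=1..n. C * real m powr (-1 - \<delta>))"
        using tm by (intro order.trans[OF sum_abs] sum_mono) auto
      also have "\<dots> = C * (\<Sum>m=1..n. real m powr (-1 - \<delta>))" by (simp add: sum_distrib_left)
      also have "\<dots> \<le> C * Z" unfolding Z_def using C0 by (intro mult_left_mono sum_le_suminf sm) auto
      finally show ?thesis .
    qed
    ultimately show ?thesis unfolding abel by linarith
  qed
  have "\<bar>(\<Sum>m=1..n. \<phi> m / real m) - l * ln (real n)\<bar> \<le> C + C * Z + \<bar>l\<bar>" if n: "n \<ge> 1" for n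
  proof -
    have "(\<Sum>m=1..n. \<phi> m / real m) = (\<Sum>m=1..n. (\<phi> m - l) / real m) + l * (\<Sum>m=1..n. 1 / real m)"
      by (simp add: sum_distrib_left sum.distrib [symmetric] diff_divide_distrib)
    then have "(\<Sum>m=1..n. \<phi> m / real m) - l * ln (real n) = (\<Sum>m=1..n. (\<phi> m - l) / real m) + l * ((\<Sum>m=1..n. 1 / real m) - ln (real n))"
      by (simp add: right_diff_distrib)
    moreover have "\<bar>l * ((\<Sum>m=1..n. 1 / real m) - ln (real n))\<bar> \<le> \<bar>l\<bar> * 1"
      unfolding abs_mult using harmonic_le[OF n] ln_le_harmonic[OF n] by (intro mult_left_mono) auto
    ultimately show ?thesis using bd[OF n] by linarith
  qed
  then show ?thesis unfolding log_mean_value_def by blast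
qed

lemma power_mean_tendsto:
  assumes "power_mean \<phi> l"
  shows "(\<lambda>n. (\<Sum>m=1..n. \<phi> m) / real n) \<longlonglongrightarrow> l"
proof -
  obtain C \<delta> where \<delta>: "\<delta> > 0" and C: "\<And>n. n \<ge> 1 \<Longrightarrow> \<bar>(\<Sum>m=1..n. \<phi> m) - real n * l\<bar> \<le> C * real n powr (1 - \<delta>)"
    using assms unfolding power_mean_def by blast
  have "(\<lambda>n. C * real n powr (- \<delta>)) \<longlonglongrightarrow> C * 0"
    by (intro tendsto_mult tendsto_const tendsto_neg_powr filterlim_real_sequentially) (use \<delta> in simp)
  then have lim: "(\<lambda>n. C * real n powr (- \<delta>)) \<longlonglongrightarrow> 0" by simp
  have "(\<lambda>n. (\<Sum>m=1..n. \<phi> m) / real n - l) \<longlonglongrightarrow> 0"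
  proof (rule Lim_null_comparison[OF _ lim])
    show "\<forall>\<^sub>F n in sequentially. norm ((\<Sum>m=1..n. \<phi> m) / real n - l) \<le> C * real n powr (- \<delta>)"
    proof (rule eventually_sequentiallyI[of 1])
      fix n :: nat assume n: "1 \<le> n"
      have "(\<Sum>m=1..n. \<phi> m) / real n - l = ((\<Sum>m=1..n. \<phi> m) - real n * l) / real n"
        using n by (simp add: diff_divide_distrib)
      then have "norm ((\<Sum>m=1..n. \<phi> m) / real n - l) = \<bar>(\<Sum>m=1..n. \<phi> m) - real n * l\<bar> / real n"
        by (simp only: real_norm_def abs_divide abs_of_nat)
      also have "\<dots> \<le> C * real n powr (1 - \<delta>) / real n" using C[OF n] by (intro divide_right_mono) auto
      also have "\<dots> = C * real n powr (- \<delta>)" using n by (simp add: powr_diff powr_minus divide_inverse)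
      finally show "norm ((\<Sum>m=1..n. \<phi> m) / real n - l) \<le> C * real n powr (- \<delta>)" .
    qed
  qed
  then show ?thesis by (simp add: LIM_zero_iff)
qed

text \<open>The form a^2 A + 2 a b c + b^2 D is a limit of means of squares, hence nonnegative. Its
  value at (-c, A) is A (A D - c^2); for A = 0 the form is affine in a, which forces c = 0.\<close>

lemma power_mean_cov_nonneg:
  assumes "power_mean (\<lambda>m. X m * X m) A" "power_mean (\<lambda>m. X m * Y m) c" "power_mean (\<lambda>m. Y m * Y m) D"
  shows "A \<ge> 0" "D \<ge> 0" "c\<^sup>2 \<le> A * D"
proof -
  have Q: "a\<^sup>2 * A + 2 * a * b * c + b\<^sup>2 * D \<ge> 0" for a b
  proof (rule LIMSEQ_le_const)
    have "(\<lambda>n. a\<^sup>2 * ((\<Sum>m=1..n. X m * X m) / real n) + 2 * a * b * ((\<Sum>m=1..n. X m * Y m) / real n) + b\<^sup>2 * ((\<Sum>m=1..n. Y m * Y m) / real n))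
       \<longlonglongrightarrow> a\<^sup>2 * A + 2 * a * b * c + b\<^sup>2 * D"
      by (intro tendsto_intros power_mean_tendsto assms)
    moreover have "a\<^sup>2 * ((\<Sum>m=1..n. X m * X m) / real n) + 2 * a * b * ((\<Sum>m=1..n. X m * Y m) / real n) + b\<^sup>2 * ((\<Sum>m=1..n. Y m * Y m) / real n)
      = (\<Sum>m=1..n. (a * X m + b * Y m)\<^sup>2) / real n" for n
    proof -
      have "(\<Sum>m=1..n. (a * X m + b * Y m)\<^sup>2) = a\<^sup>2 * (\<Sum>m=1..n. X m * X m) + 2 * a * b * (\<Sum>m=1..n. X m * Y m) + b\<^sup>2 * (\<Sum>m=1..n. Y m * Y m)"
        unfolding sum_distrib_left sum.distrib [symmetric]
        by (intro sum.cong refl) (simp add: power2_eq_square algebra_simps)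
      then show ?thesis by (simp add: add_divide_distrib)
    qed
    ultimately show "(\<lambda>n. (\<Sum>m=1..n. (a * X m + b * Y m)\<^sup>2) / real n) \<longlonglongrightarrow> a\<^sup>2 * A + 2 * a * b * c + b\<^sup>2 * D"
      by simp
    show "\<exists>N. \<forall>n\<ge>N. 0 \<le> (\<Sum>m=1..n. (a * X m + b * Y m)\<^sup>2) / real n"
      by (auto intro!: divide_nonneg_nonneg sum_nonneg)
  qed
  show A: "A \<ge> 0" using Q[of 1 0] by simp
  show D: "D \<ge> 0" using Q[of 0 1] by simp
  have "A * (A * D - c\<^sup>2) \<ge> 0" using Q[of "-c" A] by (simp add: power2_eq_square algebra_simps)
  show "c\<^sup>2 \<le> A * D"
  proof (cases "A = 0")
    case True
    have "c = 0"
    proof (rule ccontr)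
      assume "c \<noteq> 0"
      \<comment> \<open>For A = 0 and b = 1 this value of a is the one at which the form equals
        -1.\<close>
      then have "2 * (- ((D + 1) / (2 * c))) * 1 * c + 1\<^sup>2 * D = -1" by (simp add: field_simps)
      moreover have "2 * (- ((D + 1) / (2 * c))) * 1 * c + 1\<^sup>2 * D \<ge> 0"
        using Q[of "- ((D + 1) / (2 * c))" 1] True by simp
      ultimately show False by linarith
    qed
    then show ?thesis using True by simp
  next
    case False
    then have "A > 0" using A by simp
    then show ?thesis using \<open>A * (A * D - c\<^sup>2) \<ge> 0\<close> by (simp add: zero_le_mult_iff)
  qed
qed

section \<open>Long cycles with exceptional lengths, and the choice of the cut\<close>

text \<open>J is a sparse set of lengths above b, with density at most r up to n. The expectation
  sums \<theta> p (n - m) / (m p n) with 1 / m \<le> 1 / b. For \<theta> < 1 the largest p (n - m)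
  occur at small n - m; those with n - m < y are summed completely, to y p y / \<theta>. The others
  have a uniform bound, and the count r n is used. The threshold y stays free.\<close>

lemma ewens_long_cycle_expectation:
  fixes \<theta> :: real
  assumes \<theta>: "\<theta> > 0"
  obtains C where "C \<ge> 0" "\<And>(J :: nat set) b n y r. 1 \<le> b \<Longrightarrow> 1 \<le> y \<Longrightarrow> y \<le> n \<Longrightarrow>
    real (card (J \<inter> {1..n})) \<le> r * real n \<Longrightarrow> (\<And>m. m \<in> J \<Longrightarrow> b < m) \<Longrightarrow>
    integral\<^sup>L (ewens \<theta> n) (\<lambda>\<sigma>. \<Sum>c\<in>perm_cycles n \<sigma>. indicator J (card c))
      \<le> C * (real n / real b) * ((real y / real n) powr \<theta> + r * (real n / real y))"
proof -
  obtain c1 C1 where c: "c1 > 0" "C1 > 0"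
    "\<And>n. n \<ge> 1 \<Longrightarrow> c1 * real n powr (\<theta> - 1) \<le> exp_coeff (\<lambda>_. \<theta>) n"
    "\<And>n. n \<ge> 1 \<Longrightarrow> exp_coeff (\<lambda>_. \<theta>) n \<le> C1 * real n powr (\<theta> - 1)"
    using exp_coeff_const_asymp[OF \<theta>] by metis
  define C where "C = \<theta> * (C1 / \<theta> + C1) / c1"
  show thesis
  proof (rule that[of C])
    show "C \<ge> 0" using \<theta> c by (simp add: C_def)
    fix J :: "nat set" and b n y :: nat and r :: real
    assume b: "1 \<le> b" and y: "1 \<le> y" "y \<le> n" and r: "real (card (J \<inter> {1..n})) \<le> r * real n" and J: "\<And>m. m \<in> J \<Longrightarrow> b < m"
    define p where "p = exp_coeff (\<lambda>_. \<theta>)"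
    have p0: "p k > 0" for k unfolding p_def by (rule exp_coeff_const_pos[OF \<theta>])
    have n: "n \<ge> 1" using y by simp
    define M where "M = C1 * (real n / real y) * real n powr (\<theta> - 1)"
    have M0: "M \<ge> 0" using c by (simp add: M_def)
    have pM: "p j \<le> M" if j: "y \<le> j" "j \<le> n" for j
    proof -
      have "real j powr (\<theta> - 1) \<le> (real n / real y) * real n powr (\<theta> - 1)"
      \<comment> \<open>For \<theta> \<ge> 1 the power increases and the factor n / y \<ge> 1 is a
        mere loss; for \<theta> < 1 it decreases, and (n / y)^(1 - \<theta>) \<le> n / y.\<close>
      proof (cases "\<theta> \<ge> 1")
        case True
        have "real j powr (\<theta> - 1) \<le> 1 * real n powr (\<theta> - 1)" using j True by (simp add: powr_mono2)
        also have "\<dots> \<le> (real n / real y) * real n powr (\<theta> - 1)" using y by (intro mult_right_mono) auto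
        finally show ?thesis .
      next
        case False
        have "real j powr (\<theta> - 1) \<le> real y powr (\<theta> - 1)" using j y False by (intro powr_mono2') auto
        also have "\<dots> = (real n / real y) powr (1 - \<theta>) * real n powr (\<theta> - 1)"
        proof -
          have "real n powr (1 - \<theta>) * real n powr (\<theta> - 1) = 1" using n by (simp add: powr_add [symmetric])
          then have "(real n powr (1 - \<theta>) / real y powr (1 - \<theta>)) * real n powr (\<theta> - 1) = 1 / real y powr (1 - \<theta>)"
            by (simp only: times_divide_eq_left)
          moreover have "real y powr (\<theta> - 1) = 1 / real y powr (1 - \<theta>)" using powr_minus[of "real y" "1 - \<theta>"] by (simp add: divide_inverse)
          ultimately show ?thesis by (simp only: powr_divide of_nat_0_le_iff)
        qed
        also have "\<dots> \<le> (real n / real y) powr 1 * real n powr (\<theta> - 1)"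
          using y \<theta> by (intro mult_right_mono powr_mono) auto
        finally show ?thesis using y n by simp
      qed
      then have "C1 * real j powr (\<theta> - 1) \<le> C1 * ((real n / real y) * real n powr (\<theta> - 1))"
        using c by (intro mult_left_mono) auto
      then have "C1 * real j powr (\<theta> - 1) \<le> M" by (simp only: M_def mult.assoc)
      then show ?thesis using c(4)[of j] j y by (simp add: p_def)
    qed
    have "(\<Sum>m\<in>J \<inter> {1..n}. p (n - m)) \<le> (\<Sum>m\<in>J \<inter> {1..n}. (if n - m < y then p (n - m) else 0) + M)"
      using pM p0 M0 by (intro sum_mono) (auto simp: less_imp_le)
    also have "\<dots> = (\<Sum>m\<in>J \<inter> {1..n}. if n - m < y then p (n - m) else 0) + real (card (J \<inter> {1..n})) * M"
      by (simp add: sum.distrib)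
    also have "(\<Sum>m\<in>J \<inter> {1..n}. if n - m < y then p (n - m) else 0) \<le> (\<Sum>m\<in>{1..n}. if n - m < y then p (n - m) else 0)"
      using p0 by (intro sum_mono2) (auto simp: less_imp_le)
    also have "\<dots> = (\<Sum>j<n. if j < y then p j else 0)"
      by (rule sum.reindex_bij_witness[of _ "\<lambda>j. n - j" "\<lambda>m. n - m"]) auto
    also have "\<dots> = (\<Sum>j<y. p j)" using y by (intro sum.mono_neutral_cong_right) auto
    also have "\<dots> = real y * p y / \<theta>"
      using exp_coeff_const_sum[of \<theta> y] \<theta> by (simp add: p_def field_simps sum_distrib_left [symmetric])
    also have "\<dots> \<le> real y * (C1 * real y powr (\<theta> - 1)) / \<theta>"
      using c(4)[OF y(1)] \<theta> by (intro divide_right_mono mult_left_mono) (auto simp: p_def)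
    also have "\<dots> = C1 / \<theta> * real y powr \<theta>" using y by (simp add: powr_diff)
    also have "real (card (J \<inter> {1..n})) * M \<le> (r * real n) * M" using r M0 by (intro mult_right_mono) auto
    finally have S: "(\<Sum>m\<in>J \<inter> {1..n}. p (n - m)) \<le> C1 / \<theta> * real y powr \<theta> + (r * real n) * M" by simp
    have "0 \<le> r * real n" using r of_nat_0_le_iff order.trans by blast
    then have rr: "r \<ge> 0" using n by (simp add: zero_le_mult_iff)
    have "integral\<^sup>L (ewens \<theta> n) (\<lambda>\<sigma>. \<Sum>c\<in>perm_cycles n \<sigma>. indicator J (card c)) = (\<Sum>m=1..n. indicator J m * \<theta> / real m * p (n - m)) / p n"
      unfolding p_def by (rule ewens_expectation_sum[OF \<theta>])
    also have "(\<Sum>m=1..n. indicator J m * \<theta> / real m * p (n - m)) = (\<Sum>m\<in>J \<inter> {1..n}. \<theta> / real m * p (n - m))"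
      by (intro sum.mono_neutral_cong_right) (auto simp: indicator_def)
    also have "\<dots> / p n \<le> (\<theta> / real b * (C1 / \<theta> * real y powr \<theta> + (r * real n) * M)) / (c1 * real n powr (\<theta> - 1))"
    proof (rule frac_le)
      have "(\<Sum>m\<in>J \<inter> {1..n}. \<theta> / real m * p (n - m)) \<le> (\<Sum>m\<in>J \<inter> {1..n}. \<theta> / real b * p (n - m))"
      proof (intro sum_mono mult_right_mono)
        fix m assume "m \<in> J \<inter> {1..n}"
        then show "\<theta> / real m \<le> \<theta> / real b" using J[of m] \<theta> b by (intro divide_left_mono) auto
      qed (use p0 in \<open>auto simp: less_imp_le\<close>)
      also have "\<dots> = \<theta> / real b * (\<Sum>m\<in>J \<inter> {1..n}. p (n - m))" by (simp add: sum_distrib_left)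
      also have "\<dots> \<le> \<theta> / real b * (C1 / \<theta> * real y powr \<theta> + (r * real n) * M)" using S \<theta> by (intro mult_left_mono) auto
      finally show "(\<Sum>m\<in>J \<inter> {1..n}. \<theta> / real m * p (n - m)) \<le> \<theta> / real b * (C1 / \<theta> * real y powr \<theta> + (r * real n) * M)" .
      show "0 < c1 * real n powr (\<theta> - 1)" using c n by simp
      show "c1 * real n powr (\<theta> - 1) \<le> p n" unfolding p_def by (rule c(3)[OF n])
      show "0 \<le> \<theta> / real b * (C1 / \<theta> * real y powr \<theta> + (r * real n) * M)"
        using \<theta> c rr M0 by (intro mult_nonneg_nonneg add_nonneg_nonneg) auto
    qed
    also have "\<dots> = \<theta> / c1 * (real n / real b) * (C1 / \<theta> * (real y / real n) powr \<theta> + C1 * (r * (real n / real y)))"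
    proof -
      have "real n powr (\<theta> - 1) = real n powr \<theta> / real n" using n by (simp add: powr_diff)
      then show ?thesis using n c b y by (simp add: M_def powr_divide field_simps)
    qed
    also have "\<dots> \<le> \<theta> / c1 * (real n / real b) * ((C1 / \<theta> + C1) * ((real y / real n) powr \<theta> + r * (real n / real y)))"
    proof (rule mult_left_mono)
      have "0 \<le> C1 * (real y / real n) powr \<theta>" "0 \<le> C1 / \<theta> * (r * (real n / real y))"
        using c \<theta> rr by (intro mult_nonneg_nonneg; simp)+
      then show "C1 / \<theta> * (real y / real n) powr \<theta> + C1 * (r * (real n / real y)) \<le> (C1 / \<theta> + C1) * ((real y / real n) powr \<theta> + r * (real n / real y))"
        unfolding distrib_left distrib_right by linarith
    qed (use \<theta> c in simp)
    also have "\<dots> = C * (real n / real b) * ((real y / real n) powr \<theta> + r * (real n / real y))"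
      by (simp add: C_def)
    finally show "integral\<^sup>L (ewens \<theta> n) (\<lambda>\<sigma>. \<Sum>c\<in>perm_cycles n \<sigma>. indicator J (card c))
      \<le> C * (real n / real b) * ((real y / real n) powr \<theta> + r * (real n / real y))" .
  qed
qed

text \<open>With a positive power of ln n as ratio n / b, b / n vanishes while ln (n / b) is only of
  order ln (ln n). The exponent 1/8 is small enough for long cycles with moderate values to
  disappear after division by sqrt (ln n).\<close>

lemma truncation_asymptotics:
  fixes b :: "nat \<Rightarrow> nat"
  defines "b \<equiv> \<lambda>n. nat \<lfloor>real n / ln (real n) powr (1/8)\<rfloor>"
  shows "eventually (\<lambda>n. 1 \<le> b n \<and> 4 * b n \<le> n \<and> real n / real (b n) \<le> 2 * ln (real n) powr (1/8)) sequentially"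
    "(\<lambda>n. real (b n) / real n) \<longlonglongrightarrow> 0"
    "(\<lambda>n. (ln (real (b n)) - ln (real n)) / sqrt (ln (real n))) \<longlonglongrightarrow> 0"
    "(\<lambda>n. ln (real (b n)) / ln (real n)) \<longlonglongrightarrow> 1"
proof -
  have e1: "eventually (\<lambda>n::nat. real n / ln (real n) powr (1/8) \<ge> 2) sequentially" by real_asymp
  have e2: "eventually (\<lambda>n::nat. ln (real n) powr (1/8) \<ge> 4) sequentially" by real_asymp
  have e3: "eventually (\<lambda>n::nat. n \<ge> 3) sequentially" by (rule eventually_ge_at_top)
  have bounds: "eventually (\<lambda>n. real n / (2 * ln (real n) powr (1/8)) \<le> real (b n) \<and> real (b n) \<le> real n / ln (real n) powr (1/8) \<and> 1 \<le> b n) sequentially"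
    using e1 e2
  proof eventually_elim
    case (elim n)
    define v where "v = real n / ln (real n) powr (1/8)"
    have v: "v \<ge> 2" using elim by (simp add: v_def)
    then have fv: "\<lfloor>v\<rfloor> \<ge> 1" by linarith
    have "b n = nat \<lfloor>v\<rfloor>" unfolding b_def v_def ..
    then have bv: "real (b n) = of_int \<lfloor>v\<rfloor>" "1 \<le> b n"
      using fv nat_mono[OF fv] by (simp_all only: of_nat_nat nat_1)
    have "v / 2 \<le> of_int \<lfloor>v\<rfloor>" "of_int \<lfloor>v\<rfloor> \<le> v" using v by linarith+
    then show ?case using bv by (simp add: v_def)
  qed
  show "eventually (\<lambda>n. 1 \<le> b n \<and> 4 * b n \<le> n \<and> real n / real (b n) \<le> 2 * ln (real n) powr (1/8)) sequentially"
    using bounds e2 e3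
  proof eventually_elim
    case (elim n)
    have L: "ln (real n) powr (1/8) > 0" using elim by linarith
    have "real (b n) \<le> real n / ln (real n) powr (1/8)" using elim by simp
    also have "\<dots> \<le> real n / 4" using elim L by (intro divide_left_mono) auto
    finally have "4 * b n \<le> n" by linarith
    moreover have "real n \<le> real (b n) * (2 * ln (real n) powr (1/8))"
      using elim L by (simp add: pos_divide_le_eq)
    then have "real n / real (b n) \<le> 2 * ln (real n) powr (1/8)" using elim by (simp add: pos_divide_le_eq mult.commute)
    ultimately show ?case using elim by simp
  qed
  show "(\<lambda>n. real (b n) / real n) \<longlonglongrightarrow> 0"
  proof (rule Lim_null_comparison)
    show "(\<lambda>n::nat. 1 / ln (real n) powr (1/8)) \<longlonglongrightarrow> 0" by real_asymp
    show "eventually (\<lambda>n. norm (real (b n) / real n) \<le> 1 / ln (real n) powr (1/8)) sequentially"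
      using bounds e3
    proof eventually_elim
      case (elim n)
      have "real (b n) / real n \<le> (real n / ln (real n) powr (1/8)) / real n" using elim by (intro divide_right_mono) auto
      then show ?case using elim by simp
    qed
  qed
  have lnb: "eventually (\<lambda>n. ln (real n) - ln 2 - ln (ln (real n)) / 8 \<le> ln (real (b n)) \<and> ln (real (b n)) \<le> ln (real n)) sequentially"
    using bounds e2 e3
  proof eventually_elim
    case (elim n)
    have L: "ln (real n) powr (1/8) > 0" using elim by linarith
    then have L': "ln (real n) > 0" using elim by (simp add: ln_gt_zero)
    have "ln (real n / (2 * ln (real n) powr (1/8))) \<le> ln (real (b n))" using elim L by (subst ln_le_cancel_iff) auto
    moreover have "ln (real n / (2 * ln (real n) powr (1/8))) = ln (real n) - ln 2 - ln (ln (real n)) / 8"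
      using elim L L' by (simp add: ln_div ln_mult ln_powr)
    moreover have "real (b n) \<le> real n"
    proof -
      have "real n / ln (real n) powr (1/8) \<le> real n / 1" using elim by (intro divide_left_mono) auto
      then show ?thesis using elim by simp
    qed
    then have "ln (real (b n)) \<le> ln (real n)" using elim by (subst ln_le_cancel_iff) auto
    ultimately show ?case by simp
  qed
  show lim: "(\<lambda>n. (ln (real (b n)) - ln (real n)) / sqrt (ln (real n))) \<longlonglongrightarrow> 0"
  proof (rule Lim_null_comparison)
    show "(\<lambda>n::nat. (ln 2 + ln (ln (real n)) / 8) / sqrt (ln (real n))) \<longlonglongrightarrow> 0" by real_asymp
    show "eventually (\<lambda>n. norm ((ln (real (b n)) - ln (real n)) / sqrt (ln (real n))) \<le> (ln 2 + ln (ln (real n)) / 8) / sqrt (ln (real n))) sequentially"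
      using lnb e3
    proof eventually_elim
      case (elim n)
      have "sqrt (ln (real n)) > 0" using elim by (simp add: ln_gt_zero)
      moreover have "\<bar>ln (real (b n)) - ln (real n)\<bar> \<le> ln 2 + ln (ln (real n)) / 8" using elim by (simp add: abs_le_iff)
      ultimately show ?case by (simp add: abs_divide divide_right_mono)
    qed
  qed
  have "(\<lambda>n. (ln (real (b n)) - ln (real n)) / sqrt (ln (real n)) * (1 / sqrt (ln (real n))) + 1) \<longlonglongrightarrow> 0 * 0 + 1"
    by (intro tendsto_intros lim) real_asymp
  then have "(\<lambda>n. (ln (real (b n)) - ln (real n)) / sqrt (ln (real n)) * (1 / sqrt (ln (real n))) + 1) \<longlonglongrightarrow> 1" by simp
  then show "(\<lambda>n. ln (real (b n)) / ln (real n)) \<longlonglongrightarrow> 1"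
  proof (rule Lim_transform_eventually)
    show "eventually (\<lambda>n. (ln (real (b n)) - ln (real n)) / sqrt (ln (real n)) * (1 / sqrt (ln (real n))) + 1 = ln (real (b n)) / ln (real n)) sequentially"
      using e3
    proof eventually_elim
      case (elim n)
      have "ln (real n) > 0" using elim by (simp add: ln_gt_zero)
      then show ?case by (simp add: diff_divide_distrib)
    qed
  qed
qed

lemma iexp_diff_le: "norm (iexp a - iexp b) \<le> \<bar>a - b\<bar>"
proof -
  have "iexp a - iexp b = iexp b * (iexp (a - b) - 1)"
    by (simp add: right_diff_distrib exp_add [symmetric] algebra_simps)
  then have "norm (iexp a - iexp b) = norm (iexp (a - b) - 1)" by (simp add: norm_mult)
  also have "\<dots> \<le> \<bar>a - b\<bar>" using iexp_approx1[of "a - b" 0] by simp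
  finally show ?thesis .
qed

lemma iexp_quadratic: "norm (iexp t - 1 - \<i> * of_real t + of_real (t\<^sup>2 / 2)) \<le> \<bar>t\<bar> ^ 3 / 6"
proof -
  have "(\<Sum>k\<le>2. (\<i> * of_real t) ^ k / fact k) = 1 + \<i> * of_real t - of_real (t\<^sup>2 / 2)"
  proof -
    have e: "(\<Sum>k\<le>2. z ^ k / fact k) = 1 + z + z\<^sup>2 / 2" for z :: complex
      by (simp add: eval_nat_numeral)
    show ?thesis unfolding e by (simp add: power_mult_distrib)
  qed
  then have eq: "iexp t - 1 - \<i> * of_real t + of_real (t\<^sup>2 / 2) = iexp t - (\<Sum>k\<le>2. (\<i> * of_real t) ^ k / fact k)"
    by simp
  have "norm (iexp t - (\<Sum>k\<le>2. (\<i> * of_real t) ^ k / fact k)) \<le> \<bar>t\<bar> ^ Suc 2 / fact (Suc 2)"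
    by (rule iexp_approx1)
  then show ?thesis unfolding eq by (simp add: eval_nat_numeral)
qed

lemma ewens_integrable: "integrable (ewens \<theta> n) (F :: _ \<Rightarrow> 'b::{banach, second_countable_topology})"
  unfolding ewens_def by (intro integrable_point_measure_finite finite_permutations) simp

lemma ewens_measurable: "F \<in> borel_measurable (ewens \<theta> n)"
  unfolding ewens_def by (simp add: measurable_point_measure_eq1)

lemma ewens_integral_diff_le:
  fixes F H :: "(nat \<Rightarrow> nat) \<Rightarrow> complex"
  assumes "\<And>\<sigma>. \<sigma> permutes {1..n} \<Longrightarrow> norm (F \<sigma> - H \<sigma>) \<le> B \<sigma>"
  shows "norm (integral\<^sup>L (ewens \<theta> n) F - integral\<^sup>L (ewens \<theta> n) H) \<le> integral\<^sup>L (ewens \<theta> n) B"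
proof -
  have "integral\<^sup>L (ewens \<theta> n) F - integral\<^sup>L (ewens \<theta> n) H = integral\<^sup>L (ewens \<theta> n) (\<lambda>\<sigma>. F \<sigma> - H \<sigma>)"
    by (rule Bochner_Integration.integral_diff [symmetric]; rule ewens_integrable)
  also have "norm \<dots> \<le> integral\<^sup>L (ewens \<theta> n) (\<lambda>\<sigma>. norm (F \<sigma> - H \<sigma>))" by (rule integral_norm_bound)
  also have "\<dots> \<le> integral\<^sup>L (ewens \<theta> n) B"
  proof (rule integral_mono[OF ewens_integrable ewens_integrable])
    fix \<sigma> assume "\<sigma> \<in> space (ewens \<theta> n)"
    then show "norm (F \<sigma> - H \<sigma>) \<le> B \<sigma>" using assms by (simp add: ewens_def space_point_measure)
  qed
  finally show ?thesis .
qed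

section \<open>Central limit theorem under mean value hypotheses\<close>

text \<open>A, c and D are uncentred second moments, as for a compound Poisson variable, where the
  random number of summands contributes the square of the mean. The exponential mean controls both
  the cubic remainder and the frequency of large values.\<close>

locale cycle_clt =
  fixes \<theta> :: real and g :: "nat \<Rightarrow> complex" and \<mu> :: complex and A c D \<kappa> l :: real
  assumes \<theta>: "\<theta> > 0" and \<kappa>: "\<kappa> > 0"
    and mean_Re: "power_mean (\<lambda>m. Re (g m)) (Re \<mu>)" and mean_Im: "power_mean (\<lambda>m. Im (g m)) (Im \<mu>)"
    and mean_sq: "power_mean (\<lambda>m. Re (g m) * Re (g m)) A" "power_mean (\<lambda>m. Re (g m) * Im (g m)) c"
      "power_mean (\<lambda>m. Im (g m) * Im (g m)) D"
    and mean_exp: "power_mean (\<lambda>m. exp (\<kappa> * norm (g m))) l"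
begin

definition Q :: "complex \<Rightarrow> real" where
  "Q u = A * (Re u)\<^sup>2 + 2 * c * Re u * Im u + D * (Im u)\<^sup>2"

definition normalized :: "nat \<Rightarrow> (nat \<Rightarrow> nat) \<Rightarrow> complex" where
  "normalized n \<sigma> = (\<Sum>c\<in>perm_cycles n \<sigma>. g (card c)) / of_real (sqrt (ln (real n)))
     - of_real (\<theta> * sqrt (ln (real n))) * \<mu>"

lemma linear_mean: "log_mean_value (\<lambda>m. inner u (g m)) (inner u \<mu>)"
  using log_mean_value_add[OF log_mean_value_cmult[OF log_mean_value_power_mean[OF mean_Re], of "Re u"]
      log_mean_value_cmult[OF log_mean_value_power_mean[OF mean_Im], of "Im u"]]
  by (simp add: inner_complex_def)

lemma square_mean: "log_mean_value (\<lambda>m. (inner u (g m))\<^sup>2) (Q u)"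
proof -
  have "log_mean_value (\<lambda>m. (Re u)\<^sup>2 * (Re (g m) * Re (g m)) + (2 * Re u * Im u * (Re (g m) * Im (g m)) + (Im u)\<^sup>2 * (Im (g m) * Im (g m))))
     ((Re u)\<^sup>2 * A + (2 * Re u * Im u * c + (Im u)\<^sup>2 * D))"
    by (intro log_mean_value_add log_mean_value_cmult log_mean_value_power_mean mean_sq)
  moreover have "(\<lambda>m. (Re u)\<^sup>2 * (Re (g m) * Re (g m)) + (2 * Re u * Im u * (Re (g m) * Im (g m)) + (Im u)\<^sup>2 * (Im (g m) * Im (g m))))
     = (\<lambda>m. (inner u (g m))\<^sup>2)"
    by (rule ext) (simp add: inner_complex_def power2_eq_square algebra_simps)
  moreover have "(Re u)\<^sup>2 * A + (2 * Re u * Im u * c + (Im u)\<^sup>2 * D) = Q u" by (simp add: Q_def algebra_simps)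
  ultimately show ?thesis by simp
qed

text \<open>The inequality y \<le> exp y at y = \<kappa> |g m| / 3, cubed, lets the logarithmic mean
  of the exponential bound that of the cube.\<close>

lemma cube_sum_bound:
  obtains C where "C \<ge> 0" "\<And>n. n \<ge> 1 \<Longrightarrow> (\<Sum>m=1..n. \<bar>inner u (g m)\<bar> ^ 3 / real m) \<le> C * (1 + ln (real n))"
proof -
  obtain C0 where C0: "\<And>n. n \<ge> 1 \<Longrightarrow> \<bar>(\<Sum>m=1..n. exp (\<kappa> * norm (g m)) / real m) - l * ln (real n)\<bar> \<le> C0"
    using log_mean_value_power_mean[OF mean_exp] unfolding log_mean_value_def by blast
  define K where "K = norm u ^ 3 * (27 / \<kappa> ^ 3)"
  have K: "K \<ge> 0" using \<kappa> by (simp add: K_def)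
  have C00: "C0 \<ge> 0" using C0[of 1] by linarith
  have cube: "\<bar>inner u (g m)\<bar> ^ 3 \<le> K * exp (\<kappa> * norm (g m))" for m
  proof -
    have "\<kappa> * norm (g m) / 3 \<le> exp (\<kappa> * norm (g m) / 3)"
      using exp_ge_add_one_self[of "\<kappa> * norm (g m) / 3"] by linarith
    then have "(\<kappa> * norm (g m) / 3) ^ 3 \<le> exp (\<kappa> * norm (g m) / 3) ^ 3"
      using \<kappa> by (intro power_mono) auto
    also have "\<dots> = exp (\<kappa> * norm (g m))" by (simp add: exp_of_nat_mult [symmetric])
    finally have "\<kappa> ^ 3 * norm (g m) ^ 3 \<le> 27 * exp (\<kappa> * norm (g m))" by (simp add: power_divide power_mult_distrib)
    then have 1: "norm (g m) ^ 3 \<le> 27 / \<kappa> ^ 3 * exp (\<kappa> * norm (g m))" using \<kappa> by (simp add: field_simps)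
    have "\<bar>inner u (g m)\<bar> ^ 3 \<le> (norm u * norm (g m)) ^ 3"
      by (intro power_mono Cauchy_Schwarz_ineq2) auto
    also have "\<dots> = norm u ^ 3 * norm (g m) ^ 3" by (rule power_mult_distrib)
    also have "\<dots> \<le> norm u ^ 3 * (27 / \<kappa> ^ 3 * exp (\<kappa> * norm (g m)))" using 1 by (intro mult_left_mono) auto
    finally show ?thesis by (simp only: K_def mult.assoc)
  qed
  show thesis
  proof (rule that[of "K * (\<bar>l\<bar> + C0)"])
    show "K * (\<bar>l\<bar> + C0) \<ge> 0" using K C00 by simp
    fix n :: nat assume n: "n \<ge> 1"
    have ln0: "ln (real n) \<ge> 0" using n by simp
    have "(\<Sum>m=1..n. \<bar>inner u (g m)\<bar> ^ 3 / real m) \<le> (\<Sum>m=1..n. K * (exp (\<kappa> * norm (g m)) / real m))"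
    proof (rule sum_mono)
      fix m assume "m \<in> {1..n}"
      show "\<bar>inner u (g m)\<bar> ^ 3 / real m \<le> K * (exp (\<kappa> * norm (g m)) / real m)"
        using divide_right_mono[OF cube[of m], of "real m"] by simp
    qed
    also have "\<dots> = K * (\<Sum>m=1..n. exp (\<kappa> * norm (g m)) / real m)" by (simp only: sum_distrib_left)
    also have "\<dots> \<le> K * ((\<bar>l\<bar> + C0) * (1 + ln (real n)))"
    proof (rule mult_left_mono[OF _ K])
      have "l * ln (real n) \<le> \<bar>l\<bar> * ln (real n)" using ln0 by (intro mult_right_mono) auto
      moreover have "0 \<le> C0 * ln (real n)" using C00 ln0 by simp
      moreover have "(\<bar>l\<bar> + C0) * (1 + ln (real n)) = \<bar>l\<bar> + \<bar>l\<bar> * ln (real n) + C0 + C0 * ln (real n)"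
        by (simp add: algebra_simps)
      ultimately show "(\<Sum>m=1..n. exp (\<kappa> * norm (g m)) / real m) \<le> (\<bar>l\<bar> + C0) * (1 + ln (real n))"
        using C0[OF n] by linarith
    qed
    finally show "(\<Sum>m=1..n. \<bar>inner u (g m)\<bar> ^ 3 / real m) \<le> K * (\<bar>l\<bar> + C0) * (1 + ln (real n))"
      by (simp only: mult.assoc)
  qed
qed

text \<open>Markov's inequality for exp (\<kappa> |g m|) under the uniform measure on 1, ...,
  n.\<close>

lemma large_value_count:
  obtains E where "E \<ge> 0" "\<And>n r. n \<ge> 1 \<Longrightarrow> real (card {m \<in> {1..n}. r < norm (g m)}) \<le> E * exp (- \<kappa> * r) * real n"
proof -
  obtain C \<delta> where C: "\<delta> > 0" "\<And>n. n \<ge> 1 \<Longrightarrow> \<bar>(\<Sum>m=1..n. exp (\<kappa> * norm (g m))) - real n * l\<bar> \<le> C * real n powr (1 - \<delta>)"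
    using mean_exp unfolding power_mean_def by blast
  have C0: "C \<ge> 0" using C(2)[of 1] by simp
  show thesis
  proof (rule that[of "\<bar>l\<bar> + C"])
    show "\<bar>l\<bar> + C \<ge> 0" using C0 by simp
    fix n :: nat and r :: real assume n: "n \<ge> 1"
    let ?J = "{m \<in> {1..n}. r < norm (g m)}"
    have "real (card ?J) * exp (\<kappa> * r) = (\<Sum>m\<in>?J. exp (\<kappa> * r))" by simp
    also have "\<dots> \<le> (\<Sum>m\<in>?J. exp (\<kappa> * norm (g m)))" using \<kappa> by (intro sum_mono) auto
    also have "\<dots> \<le> (\<Sum>m=1..n. exp (\<kappa> * norm (g m)))" by (intro sum_mono2) auto
    also have "\<dots> \<le> real n * l + C * real n powr (1 - \<delta>)" using C(2)[OF n] by linarith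
    also have "\<dots> \<le> real n * \<bar>l\<bar> + C * real n powr 1"
      using n C(1) C0 by (intro add_mono mult_left_mono powr_mono) auto
    also have "\<dots> = (\<bar>l\<bar> + C) * real n" using n by (simp add: algebra_simps)
    finally have "real (card ?J) * exp (\<kappa> * r) * exp (- \<kappa> * r) \<le> (\<bar>l\<bar> + C) * real n * exp (- \<kappa> * r)"
      by (intro mult_right_mono) auto
    then show "real (card ?J) \<le> (\<bar>l\<bar> + C) * exp (- \<kappa> * r) * real n"
      by (simp add: mult.assoc exp_add [symmetric] mult.commute[of "real n"])
  qed
qed

definition cutoff :: "nat \<Rightarrow> nat" where
  "cutoff n = nat \<lfloor>real n / ln (real n) powr (1/8)\<rfloor>"

lemmas cutoff_asymptotics = truncation_asymptotics[folded cutoff_def]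

text \<open>The exponent of the characteristic function of independent Poisson counts with means
  \<theta> / m, m up to the cut, weighted by inner u (g m) / sqrt (ln n).\<close>

definition short_exponent :: "complex \<Rightarrow> nat \<Rightarrow> complex" where
  "short_exponent u n = (\<Sum>m=1..cutoff n. of_real \<theta> * (iexp (inner u (g m) / sqrt (ln (real n))) - 1) / of_nat m)"

text \<open>In the second-order expansion of iexp the linear part gives the centring, because
  replacing ln (cutoff n) by ln n costs o(sqrt (ln n)). The quadratic part tends to -\<theta> Q u /
  2, and the cubic remainder is of order ln n / (ln n)^(3/2).\<close>

lemma short_exponent_tendsto:
  "(\<lambda>n. short_exponent u n - \<i> * of_real (\<theta> * sqrt (ln (real n)) * inner u \<mu>)) \<longlonglongrightarrow> of_real (- \<theta> * Q u / 2)"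
proof -
  define s1 where "s1 n = (\<Sum>m=1..cutoff n. inner u (g m) / real m)" for n
  define s2 where "s2 n = (\<Sum>m=1..cutoff n. (inner u (g m))\<^sup>2 / real m)" for n
  define R where "R n = (\<Sum>m=1..cutoff n. (iexp (inner u (g m) / sqrt (ln (real n))) - 1
     - \<i> * of_real (inner u (g m) / sqrt (ln (real n))) + of_real ((inner u (g m) / sqrt (ln (real n)))\<^sup>2 / 2)) / of_nat m)" for n
  let ?h = "\<lambda>n. sqrt (ln (real n))"
  obtain C1 where C1: "\<And>n. n \<ge> 1 \<Longrightarrow> \<bar>(\<Sum>m=1..n. inner u (g m) / real m) - inner u \<mu> * ln (real n)\<bar> \<le> C1"
    using linear_mean[of u] unfolding log_mean_value_def by blast
  obtain C2 where C2: "\<And>n. n \<ge> 1 \<Longrightarrow> \<bar>(\<Sum>m=1..n. (inner u (g m))\<^sup>2 / real m) - Q u * ln (real n)\<bar> \<le> C2"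
    using square_mean[of u] unfolding log_mean_value_def by blast
  obtain C3 where C3: "C3 \<ge> 0" "\<And>n. n \<ge> 1 \<Longrightarrow> (\<Sum>m=1..n. \<bar>inner u (g m)\<bar> ^ 3 / real m) \<le> C3 * (1 + ln (real n))"
    using cube_sum_bound[of u] by blast
  have ev1: "eventually (\<lambda>n. 1 \<le> cutoff n \<and> 4 * cutoff n \<le> n) sequentially"
    using cutoff_asymptotics(1) by eventually_elim simp
  have ev3: "eventually (\<lambda>n::nat. n \<ge> 3) sequentially" by (rule eventually_ge_at_top)
  have hpos: "?h n > 0" if "n \<ge> 3" for n using that by (simp add: ln_gt_zero)
  have lim1: "(\<lambda>n. s1 n / ?h n - ?h n * inner u \<mu>) \<longlonglongrightarrow> 0"
  proof -
    have "(\<lambda>n. (s1 n - inner u \<mu> * ln (real (cutoff n))) / ?h n) \<longlonglongrightarrow> 0"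
    proof (rule Lim_null_comparison)
      show "(\<lambda>n::nat. C1 / ?h n) \<longlonglongrightarrow> 0" by real_asymp
      show "eventually (\<lambda>n. norm ((s1 n - inner u \<mu> * ln (real (cutoff n))) / ?h n) \<le> C1 / ?h n) sequentially"
        using ev1 ev3
      proof eventually_elim
        case (elim n)
        show ?case using C1[of "cutoff n"] elim hpos[of n] by (simp add: s1_def abs_divide divide_right_mono)
      qed
    qed
    then have "(\<lambda>n. (s1 n - inner u \<mu> * ln (real (cutoff n))) / ?h n + inner u \<mu> * ((ln (real (cutoff n)) - ln (real n)) / ?h n)) \<longlonglongrightarrow> 0 + inner u \<mu> * 0"
      by (intro tendsto_intros cutoff_asymptotics(3))
    then have "(\<lambda>n. (s1 n - inner u \<mu> * ln (real (cutoff n))) / ?h n + inner u \<mu> * ((ln (real (cutoff n)) - ln (real n)) / ?h n)) \<longlonglongrightarrow> 0"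
      by simp
    then show ?thesis
    proof (rule Lim_transform_eventually)
      show "eventually (\<lambda>n. (s1 n - inner u \<mu> * ln (real (cutoff n))) / ?h n + inner u \<mu> * ((ln (real (cutoff n)) - ln (real n)) / ?h n)
         = s1 n / ?h n - ?h n * inner u \<mu>) sequentially"
        using ev3
      proof eventually_elim
        case (elim n)
        have "ln (real n) / ?h n = ?h n" using elim by (simp add: real_div_sqrt)
        moreover have "(s1 n - inner u \<mu> * ln (real (cutoff n))) / ?h n + inner u \<mu> * ((ln (real (cutoff n)) - ln (real n)) / ?h n)
          = s1 n / ?h n - inner u \<mu> * (ln (real n) / ?h n)"
          by (simp add: diff_divide_distrib right_diff_distrib)
        ultimately show ?case by simp
      qed
    qed
  qed
  have lim2: "(\<lambda>n. s2 n / ln (real n)) \<longlonglongrightarrow> Q u"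
  proof -
    have "(\<lambda>n. (s2 n - Q u * ln (real (cutoff n))) / ln (real n)) \<longlonglongrightarrow> 0"
    proof (rule Lim_null_comparison)
      show "(\<lambda>n::nat. C2 / ln (real n)) \<longlonglongrightarrow> 0" by real_asymp
      show "eventually (\<lambda>n. norm ((s2 n - Q u * ln (real (cutoff n))) / ln (real n)) \<le> C2 / ln (real n)) sequentially"
        using ev1 ev3
      proof eventually_elim
        case (elim n)
        have "ln (real n) > 0" using elim by (simp add: ln_gt_zero)
        then show ?case using C2[of "cutoff n"] elim by (simp add: s2_def abs_divide divide_right_mono)
      qed
    qed
    then have "(\<lambda>n. (s2 n - Q u * ln (real (cutoff n))) / ln (real n) + Q u * (ln (real (cutoff n)) / ln (real n))) \<longlonglongrightarrow> 0 + Q u * 1"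
      by (intro tendsto_intros cutoff_asymptotics(4))
    then show ?thesis by (simp add: diff_divide_distrib)
  qed
  have lim3: "R \<longlonglongrightarrow> 0"
  proof (rule Lim_null_comparison)
    show "(\<lambda>n::nat. C3 / 6 * ((1 + ln (real n)) / ?h n ^ 3)) \<longlonglongrightarrow> 0" by real_asymp
    show "eventually (\<lambda>n. norm (R n) \<le> C3 / 6 * ((1 + ln (real n)) / ?h n ^ 3)) sequentially"
      using ev1 ev3
    proof eventually_elim
      case (elim n)
      have "norm (R n) \<le> (\<Sum>m=1..cutoff n. \<bar>inner u (g m) / ?h n\<bar> ^ 3 / 6 / real m)"
        unfolding R_def
      proof (rule sum_norm_le)
        fix m
        show "norm ((iexp (inner u (g m) / ?h n) - 1 - \<i> * of_real (inner u (g m) / ?h n) + of_real ((inner u (g m) / ?h n)\<^sup>2 / 2)) / of_nat m)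
          \<le> \<bar>inner u (g m) / ?h n\<bar> ^ 3 / 6 / real m"
          unfolding norm_divide norm_of_nat by (intro divide_right_mono iexp_quadratic) simp
      qed
      also have "\<dots> = (\<Sum>m=1..cutoff n. \<bar>inner u (g m)\<bar> ^ 3 / real m) * (1 / (6 * ?h n ^ 3))"
        unfolding sum_distrib_right using hpos[OF elim(2)]
        by (intro sum.cong refl) (simp add: abs_divide power_divide)
      also have "\<dots> \<le> (C3 * (1 + ln (real (cutoff n)))) * (1 / (6 * ?h n ^ 3))"
        using C3(2)[of "cutoff n"] elim hpos[OF elim(2)] by (intro mult_right_mono) auto
      also have "\<dots> \<le> (C3 * (1 + ln (real n))) * (1 / (6 * ?h n ^ 3))"
        using elim hpos[OF elim(2)] C3(1) by (intro mult_right_mono mult_left_mono add_left_mono) auto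
      finally show ?case by simp
    qed
  qed
  have "(\<lambda>n. \<i> * of_real (\<theta> * (s1 n / ?h n - ?h n * inner u \<mu>)) - of_real (\<theta> * (s2 n / ln (real n)) / 2) + of_real \<theta> * R n)
    \<longlonglongrightarrow> \<i> * of_real (\<theta> * 0) - of_real (\<theta> * Q u / 2) + of_real \<theta> * 0"
    by (intro tendsto_intros lim1 lim2 lim3) simp
  then have lim: "(\<lambda>n. \<i> * of_real (\<theta> * (s1 n / ?h n - ?h n * inner u \<mu>)) - of_real (\<theta> * (s2 n / ln (real n)) / 2) + of_real \<theta> * R n)
    \<longlonglongrightarrow> of_real (- \<theta> * Q u / 2)" by simp
  then show ?thesis
  proof (rule Lim_transform_eventually)
    show "eventually (\<lambda>n. \<i> * of_real (\<theta> * (s1 n / ?h n - ?h n * inner u \<mu>)) - of_real (\<theta> * (s2 n / ln (real n)) / 2) + of_real \<theta> * R n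
       = short_exponent u n - \<i> * of_real (\<theta> * ?h n * inner u \<mu>)) sequentially"
      using ev3
    proof eventually_elim
      case (elim n)
      have h2: "(?h n)\<^sup>2 = ln (real n)" using elim by simp
      have e1: "of_real (s1 n / ?h n) = (\<Sum>m=1..cutoff n. of_real (inner u (g m) / ?h n) / (of_nat m :: complex))"
        by (simp add: s1_def sum_divide_distrib mult.commute)
      have e2: "of_real (s2 n / ln (real n) / 2) = (\<Sum>m=1..cutoff n. of_real ((inner u (g m) / ?h n)\<^sup>2 / 2) / (of_nat m :: complex))"
      proof -
        have "s2 n / ln (real n) / 2 = (\<Sum>m=1..cutoff n. (inner u (g m) / ?h n)\<^sup>2 / 2 / real m)"
          unfolding s2_def sum_divide_distrib power_divide h2 by (intro sum.cong refl) (simp add: mult_ac)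
        then show ?thesis by simp
      qed
      have "short_exponent u n = of_real \<theta> * (\<Sum>m=1..cutoff n. (iexp (inner u (g m) / ?h n) - 1) / of_nat m)"
        by (simp add: short_exponent_def sum_distrib_left)
      also have "(\<Sum>m=1..cutoff n. (iexp (inner u (g m) / ?h n) - 1) / of_nat m)
         = \<i> * of_real (s1 n / ?h n) - of_real (s2 n / ln (real n) / 2) + R n"
        unfolding e1 e2 R_def sum_distrib_left sum_subtractf [symmetric] sum.distrib [symmetric]
        by (intro sum.cong refl) (simp add: diff_divide_distrib add_divide_distrib)
      finally have *: "short_exponent u n = of_real \<theta> * (\<i> * of_real (s1 n / ?h n) - of_real (s2 n / ln (real n) / 2) + R n)" .
      show ?case unfolding * by (simp add: algebra_simps)
    qed
  qed
qed

end

context cycle_clt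
begin

text \<open>If some cycle has its length in J, the trivial bound 2 is paid by the indicator sum.
  Otherwise iexp is 1-Lipschitz, every long cycle changes the argument by at most |u| r / h, and at
  most n / b cycles are long.\<close>

lemma truncation_error:
  assumes \<sigma>: "\<sigma> permutes {1..n}" and b: "b > 0" and r: "r \<ge> 0" and h: "h > 0"
  defines "J \<equiv> {m. b < m \<and> r < norm (g m)}"
  shows "norm (iexp (\<Sum>c\<in>perm_cycles n \<sigma>. inner u (g (card c)) / h)
       - (\<Prod>c\<in>perm_cycles n \<sigma>. if card c \<le> b then iexp (inner u (g (card c)) / h) else 1))
     \<le> 2 * (\<Sum>c\<in>perm_cycles n \<sigma>. indicator J (card c)) + norm u * r / h * (real n / real b)"
proof -
  define y where "y m = inner u (g m) / h" for m
  let ?P = "perm_cycles n \<sigma>"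
  let ?T = "\<Sum>c\<in>?P. if card c \<le> b then y (card c) else 0"
  have prod: "(\<Prod>c\<in>?P. if card c \<le> b then iexp (y (card c)) else 1) = iexp ?T"
    unfolding of_real_sum sum_distrib_left exp_sum[OF finite_perm_cycles] by (intro prod.cong refl) simp
  have nn: "0 \<le> norm u * r / h * (real n / real b)" using r h by simp
  have "norm (iexp (\<Sum>c\<in>?P. y (card c)) - iexp ?T) \<le> 2 * (\<Sum>c\<in>?P. indicator J (card c)) + norm u * r / h * (real n / real b)"
  proof (cases "\<exists>c\<in>?P. card c \<in> J")
    case True
    then obtain c where c: "c \<in> ?P" "card c \<in> J" by blast
    have "(1::real) = indicator J (card c)" using c by simp
    also have "\<dots> \<le> (\<Sum>c\<in>?P. indicator J (card c))" by (rule member_le_sum[OF c(1)]) auto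
    finally have "1 \<le> (\<Sum>c\<in>?P. indicator J (card c) :: real)" .
    moreover have "norm (iexp (\<Sum>c\<in>?P. y (card c)) - iexp ?T) \<le> 1 + 1"
      by (rule order.trans[OF norm_triangle_ineq4]) simp
    ultimately show ?thesis using nn by linarith
  next
    case False
    have "norm (iexp (\<Sum>c\<in>?P. y (card c)) - iexp ?T) \<le> \<bar>(\<Sum>c\<in>?P. y (card c)) - ?T\<bar>" by (rule iexp_diff_le)
    also have "(\<Sum>c\<in>?P. y (card c)) - ?T = (\<Sum>c\<in>?P. if b < card c then y (card c) else 0)"
      unfolding sum_subtractf [symmetric] by (intro sum.cong) auto
    also have "\<bar>\<dots>\<bar> \<le> (\<Sum>c\<in>?P. if b < card c then norm u * r / h else 0)"
    proof (rule order.trans[OF sum_abs sum_mono])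
      fix c assume c: "c \<in> ?P"
      show "\<bar>if b < card c then y (card c) else 0\<bar> \<le> (if b < card c then norm u * r / h else 0)"
      proof (cases "b < card c")
        case True
        then have "norm (g (card c)) \<le> r" using False c by (auto simp: J_def)
        then have "norm u * norm (g (card c)) \<le> norm u * r" by (intro mult_left_mono) auto
        then have "\<bar>inner u (g (card c))\<bar> \<le> norm u * r" by (rule order.trans[OF Cauchy_Schwarz_ineq2])
        then show ?thesis using h True by (simp add: y_def abs_divide divide_right_mono)
      qed simp
    qed
    also have "\<dots> = real (card {c \<in> ?P. b < card c}) * (norm u * r / h)"
      by (simp add: sum.If_cases Int_def)
    also have "\<dots> \<le> (real n / real b) * (norm u * r / h)"
      using r h by (intro mult_right_mono card_long_cycles_le[OF \<sigma> b]) auto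
    finally have "norm (iexp (\<Sum>c\<in>?P. y (card c)) - iexp ?T) \<le> norm u * r / h * (real n / real b)"
      by (simp only: mult.commute)
    moreover have "0 \<le> (\<Sum>c\<in>?P. indicator J (card c) :: real)" by (intro sum_nonneg) auto
    ultimately show ?thesis by linarith
  qed
  then show ?thesis unfolding prod [symmetric] unfolding y_def .
qed

lemma vanishing_rates:
  assumes a: "a > 0"
  shows "(\<lambda>n::nat. ln (real n) powr (1/8) * exp (- a * ln (real n) powr (1/4))) \<longlonglongrightarrow> 0"
  using a by real_asymp

text \<open>The centring is left out here; it is a factor of modulus 1 and is restored in
  \<open>char_tendsto\<close>.\<close>

definition cycle_char :: "complex \<Rightarrow> nat \<Rightarrow> complex" where
  "cycle_char u n = integral\<^sup>L (ewens \<theta> n) (\<lambda>\<sigma>. iexp (\<Sum>c\<in>perm_cycles n \<sigma>. inner u (g (card c)) / sqrt (ln (real n))))"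

definition short_cycle_char :: "complex \<Rightarrow> nat \<Rightarrow> complex" where
  "short_cycle_char u n = integral\<^sup>L (ewens \<theta> n) (\<lambda>\<sigma>. \<Prod>c\<in>perm_cycles n \<sigma>. if card c \<le> cutoff n then iexp (inner u (g (card c)) / sqrt (ln (real n))) else 1)"

text \<open>With r = (ln n)^(1/4), lengths whose value exceeds r have density O(exp (- \<kappa> r))
  = O(w^2). For y about n w the two terms of the long cycle estimate are O(w^\<theta>) and O(w),
  which beat the factor n / b = O((ln n)^(1/8)). Moderate values leave O((ln n)^(1/4 - 1/2 +
  1/8)).\<close>

lemma truncated_char_diff:
  "(\<lambda>n. cycle_char u n - short_cycle_char u n)
   \<longlonglongrightarrow> 0"
proof -
  obtain C where C: "C \<ge> 0" "\<And>(J :: nat set) b n y r. 1 \<le> b \<Longrightarrow> 1 \<le> y \<Longrightarrow> y \<le> n \<Longrightarrow>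
    real (card (J \<inter> {1..n})) \<le> r * real n \<Longrightarrow> (\<And>m. m \<in> J \<Longrightarrow> b < m) \<Longrightarrow>
    integral\<^sup>L (ewens \<theta> n) (\<lambda>\<sigma>. \<Sum>c\<in>perm_cycles n \<sigma>. indicator J (card c))
      \<le> C * (real n / real b) * ((real y / real n) powr \<theta> + r * (real n / real y))"
    using ewens_long_cycle_expectation[OF \<theta>] by blast
  obtain E where E: "E \<ge> 0" "\<And>n r. n \<ge> 1 \<Longrightarrow> real (card {m \<in> {1..n}. r < norm (g m)}) \<le> E * exp (- \<kappa> * r) * real n"
    using large_value_count by blast
  define r where "r n = ln (real n) powr (1/4)" for n :: nat
  define w where "w n = exp (- (\<kappa> / 2) * r n)" for n :: nat
  define bound where "bound n = 2 * (C * (2 * ln (real n) powr (1/8)) * ((2 * w n) powr \<theta> + E * w n))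
     + norm u * r n / sqrt (ln (real n)) * (2 * ln (real n) powr (1/8))" for n :: nat
  have "(\<lambda>n. 4 * C * 2 powr \<theta> * (ln (real n) powr (1/8) * exp (- (\<theta> * \<kappa> / 2) * ln (real n) powr (1/4)))
      + 4 * C * E * (ln (real n) powr (1/8) * exp (- (\<kappa> / 2) * ln (real n) powr (1/4)))
      + 2 * norm u * (ln (real n) powr (1/4) / sqrt (ln (real n)) * ln (real n) powr (1/8)))
     \<longlonglongrightarrow> 4 * C * 2 powr \<theta> * 0 + 4 * C * E * 0 + 2 * norm u * 0"
  proof (intro tendsto_add tendsto_mult tendsto_const vanishing_rates)
    show "\<theta> * \<kappa> / 2 > 0" "\<kappa> / 2 > 0" using \<theta> \<kappa> by simp_all
    show "(\<lambda>n::nat. ln (real n) powr (1/4) / sqrt (ln (real n)) * ln (real n) powr (1/8)) \<longlonglongrightarrow> 0" by real_asymp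
  qed
  moreover have "bound = (\<lambda>n. 4 * C * 2 powr \<theta> * (ln (real n) powr (1/8) * exp (- (\<theta> * \<kappa> / 2) * ln (real n) powr (1/4)))
      + 4 * C * E * (ln (real n) powr (1/8) * exp (- (\<kappa> / 2) * ln (real n) powr (1/4)))
      + 2 * norm u * (ln (real n) powr (1/4) / sqrt (ln (real n)) * ln (real n) powr (1/8)))"
  proof
    fix n
    have "(2 * w n) powr \<theta> = 2 powr \<theta> * exp (- (\<theta> * \<kappa> / 2) * ln (real n) powr (1/4))"
      by (simp add: w_def r_def powr_mult exp_powr_real mult_ac)
    then show "bound n = 4 * C * 2 powr \<theta> * (ln (real n) powr (1/8) * exp (- (\<theta> * \<kappa> / 2) * ln (real n) powr (1/4)))
      + 4 * C * E * (ln (real n) powr (1/8) * exp (- (\<kappa> / 2) * ln (real n) powr (1/4)))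
      + 2 * norm u * (ln (real n) powr (1/4) / sqrt (ln (real n)) * ln (real n) powr (1/8))"
      unfolding bound_def by (simp add: w_def r_def algebra_simps)
  qed
  ultimately have lim: "bound \<longlonglongrightarrow> 0" by simp
  \<comment> \<open>This ensures that rounding n w up to the integer y costs at most a factor
    2.\<close>
  have ew: "eventually (\<lambda>n. 1 / real n \<le> w n) sequentially"
    unfolding w_def r_def using \<kappa> by real_asymp
  show ?thesis
  proof (rule Lim_null_comparison[OF _ lim])
    show "eventually (\<lambda>n. norm (cycle_char u n - short_cycle_char u n) \<le> bound n) sequentially"
      using cutoff_asymptotics(1) ew eventually_ge_at_top[of 3]
    proof eventually_elim
      case (elim n)
      let ?h = "sqrt (ln (real n))" and ?b = "cutoff n"
      define J where "J = {m. ?b < m \<and> r n < norm (g m)}"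
      define X where "X = (\<lambda>\<sigma>. \<Sum>c\<in>perm_cycles n \<sigma>. indicator J (card c) :: real)"
      have h: "?h > 0" using elim by (simp add: ln_gt_zero)
      have r0: "r n \<ge> 0" by (simp add: r_def)
      have n: "n \<ge> 1" using elim by simp
      have w: "0 < w n" "w n \<le> 1" using \<kappa> r0 by (auto simp: w_def)
      have "norm (cycle_char u n - short_cycle_char u n) \<le> integral\<^sup>L (ewens \<theta> n) (\<lambda>\<sigma>. 2 * X \<sigma> + norm u * r n / ?h * (real n / real ?b))"
        unfolding X_def J_def cycle_char_def short_cycle_char_def
        by (rule ewens_integral_diff_le, rule truncation_error) (use elim r0 h in auto)
      also have "\<dots> = 2 * integral\<^sup>L (ewens \<theta> n) X + norm u * r n / ?h * (real n / real ?b)"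
      proof -
        interpret prob_space "ewens \<theta> n" by (rule prob_space_ewens[OF \<theta>])
        show ?thesis
          using ewens_integrable[of \<theta> n X] by (simp add: prob_space)
      qed
      also have "\<dots> \<le> bound n"
        unfolding bound_def
      proof (intro add_mono mult_left_mono)
        define y where "y = nat \<lceil>real n * w n\<rceil>"
        have nw: "0 < real n * w n" "real n * w n \<le> real n" using n w by auto
        have "\<lceil>real n * w n\<rceil> \<ge> 1" using nw by linarith
        then have ry: "real y = of_int \<lceil>real n * w n\<rceil>" by (simp add: y_def)
        have y: "real n * w n \<le> real y" "real y \<le> real n * w n + 1" using ry by linarith+
        have y1: "1 \<le> y" using y(1) nw(1) by (cases y) auto
        have "\<lceil>real n * w n\<rceil> \<le> int n" by (simp only: ceiling_le_iff of_int_of_nat_eq nw(2))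
        then have yn: "y \<le> n" by (simp only: y_def nat_le_iff)
        have yw: "real y / real n \<le> 2 * w n"
        proof -
          have "real y / real n \<le> (real n * w n + 1) / real n" using y by (intro divide_right_mono) auto
          also have "\<dots> = w n + 1 / real n" using n by (simp add: add_divide_distrib)
          finally show ?thesis using elim by linarith
        qed
        have cardJ: "real (card (J \<inter> {1..n})) \<le> (E * (w n)\<^sup>2) * real n"
        proof -
          have "card (J \<inter> {1..n}) \<le> card {m \<in> {1..n}. r n < norm (g m)}" by (rule card_mono) (auto simp: J_def)
          also have "real \<dots> \<le> E * exp (- \<kappa> * r n) * real n" by (rule E(2)[OF n])
          also have "exp (- \<kappa> * r n) = (w n)\<^sup>2" by (simp add: w_def power2_eq_square exp_add [symmetric])
          finally show ?thesis by simp
        qed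
        have "integral\<^sup>L (ewens \<theta> n) X \<le> C * (real n / real ?b) * ((real y / real n) powr \<theta> + (E * (w n)\<^sup>2) * (real n / real y))"
          unfolding X_def by (rule C(2)[OF _ y1 yn cardJ]) (use elim in \<open>auto simp: J_def\<close>)
        also have "\<dots> \<le> C * (2 * ln (real n) powr (1/8)) * ((2 * w n) powr \<theta> + E * w n)"
        proof (rule mult_mono)
          show "C * (real n / real ?b) \<le> C * (2 * ln (real n) powr (1/8))"
            using elim C(1) by (intro mult_left_mono) auto
          have yw': "(real y / real n) powr \<theta> \<le> (2 * w n) powr \<theta>" using yw \<theta> by (intro powr_mono2) auto
          have "(E * (w n)\<^sup>2) * (real n / real y) = E * w n * ((real n * w n) / real y)" by (simp add: power2_eq_square)
          also have "\<dots> \<le> E * w n * 1" using y y1 E(1) w by (intro mult_left_mono) auto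
          finally have "(E * (w n)\<^sup>2) * (real n / real y) \<le> E * w n" by simp
          then show "(real y / real n) powr \<theta> + (E * (w n)\<^sup>2) * (real n / real y) \<le> (2 * w n) powr \<theta> + E * w n"
            by (rule add_mono[OF yw'])
        qed (use elim C(1) E(1) in auto)
        finally show "integral\<^sup>L (ewens \<theta> n) X \<le> C * (2 * ln (real n) powr (1/8)) * ((2 * w n) powr \<theta> + E * w n)" .
      qed (use elim h r0 in auto)
      finally show ?case .
    qed
  qed
qed

text \<open>Weight 1 beyond the cut makes \<open>short_cycle_char\<close> exactly a ratio of
  coefficients, to which \<open>exp_coeff_ratio\<close> applies with error O(cutoff n / n).\<close>

lemma truncated_char_tendsto:
  "(\<lambda>n. short_cycle_char u n - exp (short_exponent u n)) \<longlonglongrightarrow> 0"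
proof -
  obtain C where C: "\<And>(a :: nat \<Rightarrow> complex) b n. 1 \<le> b \<Longrightarrow> 4 * b \<le> n \<Longrightarrow> (\<And>m. norm (a m) \<le> 1) \<Longrightarrow>
    norm (exp_coeff (\<lambda>m. of_real \<theta> * (if m \<le> b then a m else 1)) n / of_real (exp_coeff (\<lambda>_. \<theta>) n)
      - exp (\<Sum>m=1..b. of_real \<theta> * (a m - 1) / of_nat m)) \<le> C * (real b / real n)"
    using exp_coeff_ratio[OF \<theta>] by blast
  show ?thesis
  proof (rule Lim_null_comparison)
    have "(\<lambda>n. C * (real (cutoff n) / real n)) \<longlonglongrightarrow> C * 0"
      by (intro tendsto_intros cutoff_asymptotics(2))
    then show "(\<lambda>n. C * (real (cutoff n) / real n)) \<longlonglongrightarrow> 0" by simp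
    show "eventually (\<lambda>n. norm (short_cycle_char u n - exp (short_exponent u n)) \<le> C * (real (cutoff n) / real n)) sequentially"
      using cutoff_asymptotics(1)
    proof eventually_elim
      case (elim n)
      have "norm (iexp t) \<le> 1" for t :: real by simp
      then show ?case
        unfolding short_cycle_char_def ewens_expectation_prod[OF \<theta>, of n "\<lambda>m. if m \<le> cutoff n then iexp (inner u (g m) / sqrt (ln (real n))) else 1"]
          short_exponent_def
        using elim by (intro C) auto
    qed
  qed
qed

text \<open>The centring factor \<open>k n\<close> has modulus 1, so errors tending to 0 still do so
  after multiplication; it cancels the growing imaginary part of the short exponent.\<close>

lemma char_tendsto:
  "(\<lambda>n. integral\<^sup>L (ewens \<theta> n) (\<lambda>\<sigma>. iexp (inner u (normalized n \<sigma>)))) \<longlonglongrightarrow> of_real (exp (- \<theta> * Q u / 2))"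
proof -
  let ?h = "\<lambda>n. sqrt (ln (real n))"
  define k where "k n = iexp (- (\<theta> * ?h n * inner u \<mu>))" for n
  have inner_sum: "inner u (normalized n \<sigma>) = (\<Sum>c\<in>perm_cycles n \<sigma>. inner u (g (card c)) / ?h n) - \<theta> * ?h n * inner u \<mu>" for n \<sigma>
  proof -
    have "normalized n \<sigma> = (1 / ?h n) *\<^sub>R (\<Sum>c\<in>perm_cycles n \<sigma>. g (card c)) - (\<theta> * ?h n) *\<^sub>R \<mu>"
      by (simp add: normalized_def scaleR_conv_of_real divide_inverse mult.commute)
    then show ?thesis
      by (simp add: inner_diff_right inner_sum_right sum_divide_distrib)
  qed
  have eq: "integral\<^sup>L (ewens \<theta> n) (\<lambda>\<sigma>. iexp (inner u (normalized n \<sigma>))) = k n * cycle_char u n" for n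
  proof -
    have "iexp (inner u (normalized n \<sigma>)) = k n * iexp (\<Sum>c\<in>perm_cycles n \<sigma>. inner u (g (card c)) / ?h n)" for \<sigma>
      unfolding inner_sum k_def exp_add [symmetric] by (rule arg_cong[where f=exp]) (simp add: algebra_simps)
    then show ?thesis unfolding cycle_char_def by simp
  qed
  have nk: "norm (k n) = 1" for n by (simp add: k_def)
  have null: "(\<lambda>n. k n * Z n) \<longlonglongrightarrow> 0" if "Z \<longlonglongrightarrow> 0" for Z
    using that by (subst tendsto_norm_zero_iff [symmetric]) (simp add: norm_mult nk tendsto_norm_zero)
  have "(\<lambda>n. exp (short_exponent u n - \<i> * of_real (\<theta> * ?h n * inner u \<mu>))) \<longlonglongrightarrow> exp (of_real (- \<theta> * Q u / 2))"
    by (intro tendsto_exp short_exponent_tendsto)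
  moreover have "exp (short_exponent u n - \<i> * of_real (\<theta> * ?h n * inner u \<mu>)) = k n * exp (short_exponent u n)" for n
    unfolding k_def exp_add [symmetric] by (rule arg_cong[where f=exp]) (simp add: algebra_simps)
  ultimately have main: "(\<lambda>n. k n * exp (short_exponent u n)) \<longlonglongrightarrow> exp (of_real (- \<theta> * Q u / 2))" by simp
  have "(\<lambda>n. k n * (cycle_char u n - short_cycle_char u n) + k n * (short_cycle_char u n - exp (short_exponent u n)) + k n * exp (short_exponent u n)) \<longlonglongrightarrow> 0 + 0 + exp (of_real (- \<theta> * Q u / 2))"
    by (intro tendsto_add null truncated_char_diff truncated_char_tendsto main)
  moreover have "k n * (cycle_char u n - short_cycle_char u n) + k n * (short_cycle_char u n - exp (short_exponent u n)) + k n * exp (short_exponent u n) = k n * cycle_char u n" for n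
    by (simp add: algebra_simps)
  moreover have "exp (of_real (- \<theta> * Q u / 2)) = complex_of_real (exp (- \<theta> * Q u / 2))" by (rule exp_of_real)
  ultimately show ?thesis unfolding eq by (simp only: add_0)
qed

text \<open>The matrix with entries \<theta> A, \<theta> c, \<theta> D is positive semidefinite, as
  a limit of empirical second moments, so a Gaussian variable with this covariance exists and
  convergence follows from the characteristic functions.\<close>

theorem clt:
  "\<exists>N :: complex \<Rightarrow> complex. complex_normal std_complex_normal N \<and>
     converges_in_distribution (ewens \<theta>) normalized std_complex_normal N \<and>
     covariance std_complex_normal (\<lambda>\<omega>. Re (N \<omega>)) (\<lambda>\<omega>. Im (N \<omega>)) = \<theta> * c \<and>
     (prob_space.indep_var std_complex_normal borel (\<lambda>\<omega>. Re (N \<omega>)) borel (\<lambda>\<omega>. Im (N \<omega>)) \<longleftrightarrow> \<theta> * c = 0)"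
proof -
  note cov = power_mean_cov_nonneg[OF mean_sq]
  have "0 \<le> \<theta> * A" "0 \<le> \<theta> * D" using cov \<theta> by simp_all
  moreover have "(\<theta> * c)\<^sup>2 \<le> \<theta> * A * (\<theta> * D)"
    using mult_left_mono[OF cov(3), of "\<theta>\<^sup>2"] by (simp add: power2_eq_square mult_ac)
  ultimately obtain N :: "complex \<Rightarrow> complex" where N:
    "N \<in> borel_measurable std_complex_normal" "complex_normal std_complex_normal N"
    "covariance std_complex_normal (\<lambda>\<omega>. Re (N \<omega>)) (\<lambda>\<omega>. Im (N \<omega>)) = \<theta> * c"
    "scn.indep_var borel (\<lambda>\<omega>. Re (N \<omega>)) borel (\<lambda>\<omega>. Im (N \<omega>)) \<longleftrightarrow> \<theta> * c = 0"
    "\<And>u. scn.expectation (\<lambda>\<omega>. iexp (inner u (N \<omega>))) =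
       of_real (exp (- (\<theta> * A * (Re u)\<^sup>2 + 2 * (\<theta> * c) * Re u * Im u + \<theta> * D * (Im u)\<^sup>2) / 2))"
    using complex_normal_exists[of "\<theta> * A" "\<theta> * c" "\<theta> * D"] by blast
  interpret distribution_limit "ewens \<theta>" normalized std_complex_normal N
  proof (rule distribution_limit.intro)
    show "prob_space std_complex_normal" by (rule scn.prob_space_axioms)
    show "prob_space (ewens \<theta> n)" for n by (rule prob_space_ewens[OF \<theta>])
    show "normalized n \<in> borel_measurable (ewens \<theta> n)" for n by (rule ewens_measurable)
    show "N \<in> borel_measurable std_complex_normal" by (rule N(1))
    show "(\<lambda>n. integral\<^sup>L (ewens \<theta> n) (\<lambda>\<omega>. iexp (inner u (normalized n \<omega>)))) \<longlonglongrightarrow> scn.expectation (\<lambda>\<omega>. iexp (inner u (N \<omega>)))" for u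
    proof -
      have "\<theta> * A * (Re u)\<^sup>2 + 2 * (\<theta> * c) * Re u * Im u + \<theta> * D * (Im u)\<^sup>2 = \<theta> * Q u"
        by (simp add: Q_def algebra_simps)
      then show ?thesis using char_tendsto[of u] unfolding N(5) by simp
    qed
  qed
  show ?thesis using N converges_in_distribution by blast
qed

end

section \<open>The two kinds of points x\<close>

lemma converges_in_distribution_cong:
  assumes "\<And>n \<omega>. \<omega> \<in> space (M n) \<Longrightarrow> X n \<omega> = Y n \<omega>"
  shows "converges_in_distribution M X M' Z \<longleftrightarrow> converges_in_distribution M Y M' Z"
proof -
  have "integral\<^sup>L (M n) (\<lambda>\<omega>. h (X n \<omega>)) = integral\<^sup>L (M n) (\<lambda>\<omega>. h (Y n \<omega>))" for h :: "complex \<Rightarrow> real" and n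
    using assms by (intro Bochner_Integration.integral_cong refl) simp
  then show ?thesis unfolding converges_in_distribution_def by simp
qed

lemma (in cycle_clt) clt_w_log:
  assumes g: "\<And>m. g m = Ln (f (x ^ m))"
  shows "\<exists>(M :: complex measure) (N :: complex \<Rightarrow> complex). prob_space M \<and> complex_normal M N \<and>
     converges_in_distribution (ewens \<theta>)
       (\<lambda>n \<sigma>. w_log n f x \<sigma> / of_real (sqrt (ln (real n))) - of_real (\<theta> * sqrt (ln (real n))) * \<mu>) M N \<and>
     covariance M (\<lambda>\<omega>. Re (N \<omega>)) (\<lambda>\<omega>. Im (N \<omega>)) = \<theta> * c \<and>
     (prob_space.indep_var M borel (\<lambda>\<omega>. Re (N \<omega>)) borel (\<lambda>\<omega>. Im (N \<omega>)) \<longleftrightarrow> \<theta> * c = 0)"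
proof -
  obtain N :: "complex \<Rightarrow> complex" where N: "complex_normal std_complex_normal N"
    "converges_in_distribution (ewens \<theta>) normalized std_complex_normal N"
    "covariance std_complex_normal (\<lambda>\<omega>. Re (N \<omega>)) (\<lambda>\<omega>. Im (N \<omega>)) = \<theta> * c"
    "prob_space.indep_var std_complex_normal borel (\<lambda>\<omega>. Re (N \<omega>)) borel (\<lambda>\<omega>. Im (N \<omega>)) \<longleftrightarrow> \<theta> * c = 0"
    using clt by blast
  have w: "w_log n f x \<sigma> = (\<Sum>c\<in>perm_cycles n \<sigma>. g (card c))" if "\<sigma> \<in> space (ewens \<theta> n)" for n \<sigma>
    using that sum_num_cycles_len[of \<sigma> n "\<lambda>m. Ln (f (x ^ m))"]
    by (simp add: w_log_def g ewens_def space_point_measure)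
  have "converges_in_distribution (ewens \<theta>)
       (\<lambda>n \<sigma>. w_log n f x \<sigma> / of_real (sqrt (ln (real n))) - of_real (\<theta> * sqrt (ln (real n))) * \<mu>) std_complex_normal N"
    by (rule iffD1[OF converges_in_distribution_cong N(2)]) (simp add: normalized_def w)
  then show ?thesis using N scn.prob_space_axioms by blast
qed

lemma set_integral_complex:
  fixes G :: "real \<Rightarrow> complex"
  assumes R: "set_integrable lborel S (\<lambda>s. Re (G s))" and I: "set_integrable lborel S (\<lambda>s. Im (G s))"
  shows "(LINT s:S|lborel. G s) = Complex (LINT s:S|lborel. Re (G s)) (LINT s:S|lborel. Im (G s))"
proof -
  have r: "integrable lborel (\<lambda>s. indicator S s *\<^sub>R Re (G s))" and i: "integrable lborel (\<lambda>s. indicator S s *\<^sub>R Im (G s))"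
    using R I unfolding set_integrable_def by blast+
  have "indicator S s *\<^sub>R G s = of_real (indicator S s *\<^sub>R Re (G s)) + \<i> * of_real (indicator S s *\<^sub>R Im (G s))" for s
    by (simp add: complex_eq_iff)
  then have "(LINT s:S|lborel. G s) = (LINT s|lborel. of_real (indicator S s *\<^sub>R Re (G s)) + \<i> * of_real (indicator S s *\<^sub>R Im (G s)))"
    unfolding set_lebesgue_integral_def by (simp only:)
  also have "\<dots> = (LINT s|lborel. of_real (indicator S s *\<^sub>R Re (G s))) + \<i> * (LINT s|lborel. of_real (indicator S s *\<^sub>R Im (G s)))"
    using r i by (subst Bochner_Integration.integral_add) (auto simp del: of_real_mult intro!: integrable_of_real)
  also have "\<dots> = of_real (LINT s:S|lborel. Re (G s)) + \<i> * of_real (LINT s:S|lborel. Im (G s))"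
    unfolding set_lebesgue_integral_def integral_complex_of_real ..
  finally show ?thesis by (simp add: Complex_eq)
qed

text \<open>An integer is either at most the floor of m t or at least the floor plus 1; its distance
  to m t is then at least the fractional part or at least 1 minus it.\<close>

lemma finite_type_badly_approximable:
  assumes "finite_type x"
  obtains t K \<gamma> where "x = cis (2 * pi * t)" "K > 0" "\<gamma> > 0" "badly_approximable K \<gamma> t"
proof -
  obtain t K \<gamma> where t: "x = cis (2 * pi * t)" "K > 0" "\<gamma> > 0" and
    h: "\<And>m :: int. m \<noteq> 0 \<Longrightarrow> min (frac (of_int m * t)) (1 - frac (of_int m * t)) > K / \<bar>of_int m\<bar> powr \<gamma>"
    using assms unfolding finite_type_def by blast
  have "badly_approximable K \<gamma> t" unfolding badly_approximable_def
  proof (intro allI impI)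
    fix m z :: int assume m: "m \<noteq> 0"
    have "min (frac (of_int m * t)) (1 - frac (of_int m * t)) \<le> \<bar>of_int m * t - of_int z\<bar>"
    proof (cases "z \<le> \<lfloor>of_int m * t\<rfloor>")
      case True
      then have "(of_int z :: real) \<le> of_int \<lfloor>of_int m * t\<rfloor>" by simp
      then show ?thesis by (simp add: frac_def)
    next
      case False
      then have "\<lfloor>of_int m * t\<rfloor> + 1 \<le> z" by simp
      then have "of_int \<lfloor>of_int m * t\<rfloor> + 1 \<le> (of_int z :: real)" by linarith
      then show ?thesis unfolding frac_def by linarith
    qed
    then show "K / \<bar>of_int m\<bar> powr \<gamma> < \<bar>of_int m * t - of_int z\<bar>" using h[OF m] by linarith
  qed
  then show thesis using that t by blast
qed

text \<open>The imaginary part of a square is 2 Re Im, so that of the integrated square of the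
  logarithm is 2 c; this is where the factor \<theta> / 2 in the covariance comes from. All mean
  values come from the test functions Re, Im, their products and exp (\<kappa> |z|) with one
  \<kappa>.\<close>

lemma clt_finite_type:
  fixes f :: "complex \<Rightarrow> complex"
  assumes \<theta>: "\<theta> > 0" and an: "real_analytic_on_circle f" and ft: "finite_type x"
    and zeros: "\<And>z. z \<in> sphere 0 1 \<Longrightarrow> f z = 0 \<Longrightarrow> root_of_unity z"
  shows "\<exists>A c D \<kappa> l. cycle_clt \<theta> (\<lambda>m. Ln (f (x ^ m))) (LINT s:{0..1}|lborel. Ln (f (cis (2 * pi * s)))) A c D \<kappa> l \<and>
     Im (LINT s:{0..1}|lborel. (Ln (f (cis (2 * pi * s))))\<^sup>2) = 2 * c"
proof -
  obtain t K \<gamma> where t: "x = cis (2 * pi * t)" "K > 0" "\<gamma> > 0" "badly_approximable K \<gamma> t"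
    by (rule finite_type_badly_approximable[OF ft])
  define G where "G = (\<lambda>s. Ln (f (cis (2 * pi * s))))"
  define S where "S = {0..<1::real}"
  have G: "G (frac (real m * t)) = Ln (f (x ^ m))" for m
  proof -
    have "x ^ m = cis (2 * pi * (real m * t))" by (simp add: t(1) Complex.DeMoivre mult_ac)
    also have "\<dots> = cis (2 * pi * frac (real m * t) + 2 * pi * of_int \<lfloor>real m * t\<rfloor>)"
      by (simp add: frac_def algebra_simps)
    also have "\<dots> = cis (2 * pi * frac (real m * t)) * cis (2 * pi * of_int \<lfloor>real m * t\<rfloor>)" by (rule cis_mult [symmetric])
    also have "cis (2 * pi * of_int \<lfloor>real m * t\<rfloor>) = 1" by (rule cis_multiple_2pi) simp
    finally show ?thesis by (simp add: G_def)
  qed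
  have "equidistributes (\<lambda>m. frac (real m * t)) G 0 1"
    unfolding G_def by (rule circle_equidistributes[OF an zeros t(2-4)])
  then obtain \<kappa> where \<kappa>: "\<kappa> > 0" and pm: "\<And>c A \<psi>. 0 < c \<Longrightarrow> c \<le> \<kappa> \<Longrightarrow> exp_growth A c \<psi> \<Longrightarrow>
    set_integrable lborel {0..<1} (\<lambda>s. \<psi> (G s)) \<and> power_mean (\<lambda>m. \<psi> (G (frac (real m * t)))) (LINT s:{0..<1}|lborel. \<psi> (G s))"
    by (rule power_mean_equidistributes) (simp_all add: frac_lt_1)
  have Re_lip: "\<bar>Re z\<bar> \<le> norm z" "\<bar>Re z - Re w\<bar> \<le> norm (z - w)"
    and Im_lip: "\<bar>Im z\<bar> \<le> norm z" "\<bar>Im z - Im w\<bar> \<le> norm (z - w)" for z w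
    using abs_Re_le_cmod[of "z - w"] abs_Im_le_cmod[of "z - w"] by (simp_all add: abs_Re_le_cmod abs_Im_le_cmod)
  note pm' = pm[OF \<kappa> order.refl]
  note R = pm'[OF exp_growth_lipschitz[where u=Re, OF Re_lip \<kappa>], folded S_def, unfolded G]
  note I = pm'[OF exp_growth_lipschitz[where u=Im, OF Im_lip \<kappa>], folded S_def, unfolded G]
  note RR = pm'[OF exp_growth_prod[where u=Re and v=Re, OF Re_lip Re_lip \<kappa>], folded S_def, unfolded G]
  note RI = pm'[OF exp_growth_prod[where u=Re and v=Im, OF Re_lip Im_lip \<kappa>], folded S_def, unfolded G]
  note II = pm'[OF exp_growth_prod[where u=Im and v=Im, OF Im_lip Im_lip \<kappa>], folded S_def, unfolded G]
  note X = pm'[OF exp_growth_exp[OF \<kappa>], folded S_def, unfolded G]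
  \<comment> \<open>The sample points lie in [0, 1) while the integral runs over [0, 1]; the point 1
    is a null set.\<close>
  have S01: "(LINT s:{0..1}|lborel. H s) = (LINT s:S|lborel. H s)" for H :: "real \<Rightarrow> complex"
    by (rule set_integral_discrete_difference[where X="{1}"]) (auto simp: S_def)
  have mu: "(LINT s:{0..1}|lborel. G s) = Complex (LINT s:S|lborel. Re (G s)) (LINT s:S|lborel. Im (G s))"
    unfolding S01 using R I by (intro set_integral_complex) simp_all
  have "set_integrable lborel S (\<lambda>s. Re (G s) * Re (G s) - Im (G s) * Im (G s))"
    "set_integrable lborel S (\<lambda>s. 2 * (Re (G s) * Im (G s)))"
    using RR RI II by (auto intro: set_integral_diff(1))
  then have sq: "Im (LINT s:S|lborel. (G s)\<^sup>2) = (LINT s:S|lborel. 2 * (Re (G s) * Im (G s)))"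
    by (subst set_integral_complex) (simp_all add: power2_eq_square mult.commute)
  have "cycle_clt \<theta> (\<lambda>m. Ln (f (x ^ m))) (LINT s:{0..1}|lborel. G s) (LINT s:S|lborel. Re (G s) * Re (G s))
      (LINT s:S|lborel. Re (G s) * Im (G s)) (LINT s:S|lborel. Im (G s) * Im (G s)) \<kappa> (LINT s:S|lborel. exp (\<kappa> * norm (G s)))"
    by (rule cycle_clt.intro) (use \<theta> \<kappa> R I RR RI II X mu in simp_all)
  moreover have "Im (LINT s:{0..1}|lborel. (G s)\<^sup>2) = 2 * (LINT s:S|lborel. Re (G s) * Im (G s))"
    unfolding S01 sq by simp
  ultimately show ?thesis unfolding G_def by blast
qed

text \<open>Every function of \<open>g m\<close> is periodic in m, so all mean values exist and
  \<kappa> = 1 can be taken; c is the average of Re Im over one period, half the imaginary part of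
  the average square.\<close>

lemma clt_root_of_unity:
  fixes f :: "complex \<Rightarrow> complex"
  assumes \<theta>: "\<theta> > 0" and ru: "root_of_unity x" and p: "unity_order x = p"
  shows "\<exists>A c D \<kappa> l. cycle_clt \<theta> (\<lambda>m. Ln (f (x ^ m))) ((\<Sum>m=1..p. Ln (f (x ^ m))) / of_nat p) A c D \<kappa> l \<and>
     Im ((\<Sum>m=1..p. (Ln (f (x ^ m)))\<^sup>2) / of_nat p) = 2 * c"
proof -
  have "\<exists>q. 1 \<le> q \<and> x ^ q = 1" using ru unfolding root_of_unity_def by blast
  then have "1 \<le> unity_order x \<and> x ^ unity_order x = 1" unfolding unity_order_def by (rule LeastI_ex)
  then have p1: "1 \<le> p" "x ^ p = 1" using p by auto
  define g where "g = (\<lambda>m. Ln (f (x ^ m)))"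
  have per: "g (m + p) = g m" for m by (simp add: g_def power_add p1)
  have pm: "power_mean (\<lambda>m. \<psi> (g m)) ((\<Sum>m=1..p. \<psi> (g m)) / real p)" for \<psi> :: "complex \<Rightarrow> real"
    by (rule power_mean_periodic[OF p1(1)]) (simp add: per)
  have "cycle_clt \<theta> g ((\<Sum>m=1..p. g m) / of_nat p) ((\<Sum>m=1..p. Re (g m) * Re (g m)) / real p)
      ((\<Sum>m=1..p. Re (g m) * Im (g m)) / real p) ((\<Sum>m=1..p. Im (g m) * Im (g m)) / real p) 1 ((\<Sum>m=1..p. exp (1 * norm (g m))) / real p)"
    by (rule cycle_clt.intro)
       (use \<theta> pm[of Re] pm[of Im] pm[of "\<lambda>z. Re z * Re z"] pm[of "\<lambda>z. Re z * Im z"] pm[of "\<lambda>z. Im z * Im z"]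
         pm[of "\<lambda>z. exp (1 * norm z)"] in simp_all)
  moreover have "Im ((\<Sum>m=1..p. (g m)\<^sup>2) / of_nat p) = 2 * ((\<Sum>m=1..p. Re (g m) * Im (g m)) / real p)"
    by (simp add: power2_eq_square sum_distrib_left mult_ac)
  ultimately show ?thesis unfolding g_def by blast
qed

theorem theorem2p7:
  fixes \<theta> :: real and f :: "complex \<Rightarrow> complex" and x :: complex
  assumes "\<theta> > 0"
    and "real_analytic_on_circle f"
    and "x \<in> sphere 0 1"
  shows "(\<not> root_of_unity x \<longrightarrow> finite_type x \<longrightarrow>
            (\<forall>z\<in>sphere 0 1. f z = 0 \<longrightarrow> root_of_unity z) \<longrightarrow>
            (\<exists>(M :: complex measure) (N :: complex \<Rightarrow> complex).
               prob_space M \<and> complex_normal M N \<and>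
               converges_in_distribution (ewens \<theta>)
                 (\<lambda>n \<sigma>. w_log n f x \<sigma> / of_real (sqrt (ln (real n)))
                        - of_real (\<theta> * sqrt (ln (real n))) * log_mean f x) M N \<and>
               covariance M (\<lambda>\<omega>. Re (N \<omega>)) (\<lambda>\<omega>. Im (N \<omega>))
                 = \<theta> / 2 * Im (LINT s:{0..1}|lborel. (Ln (f (cis (2 * pi * s))))\<^sup>2) \<and>
               (prob_space.indep_var M borel (\<lambda>\<omega>. Re (N \<omega>)) borel (\<lambda>\<omega>. Im (N \<omega>))
                 \<longleftrightarrow> \<theta> / 2 * Im (LINT s:{0..1}|lborel. (Ln (f (cis (2 * pi * s))))\<^sup>2) = 0)))
       \<and> (\<forall>p. root_of_unity x \<longrightarrow> unity_order x = p \<longrightarrow>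
            (\<forall>m\<in>{1..p}. f (x ^ m) \<noteq> 0) \<longrightarrow>
            (\<exists>(M :: complex measure) (N :: complex \<Rightarrow> complex).
               prob_space M \<and> complex_normal M N \<and>
               converges_in_distribution (ewens \<theta>)
                 (\<lambda>n \<sigma>. w_log n f x \<sigma> / of_real (sqrt (ln (real n)))
                        - of_real (\<theta> * sqrt (ln (real n))) * log_mean f x) M N \<and>
               covariance M (\<lambda>\<omega>. Re (N \<omega>)) (\<lambda>\<omega>. Im (N \<omega>))
                 = \<theta> / 2 * Im ((\<Sum>m=1..p. (Ln (f (x ^ m)))\<^sup>2) / of_nat p) \<and>
               (prob_space.indep_var M borel (\<lambda>\<omega>. Re (N \<omega>)) borel (\<lambda>\<omega>. Im (N \<omega>))
                 \<longleftrightarrow> \<theta> / 2 * Im ((\<Sum>m=1..p. (Ln (f (x ^ m)))\<^sup>2) / of_nat p) = 0)))"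
proof (intro conjI impI allI, goal_cases)
  case 1
  obtain A c D \<kappa> l where clt: "cycle_clt \<theta> (\<lambda>m. Ln (f (x ^ m))) (LINT s:{0..1}|lborel. Ln (f (cis (2 * pi * s)))) A c D \<kappa> l"
    and cov: "Im (LINT s:{0..1}|lborel. (Ln (f (cis (2 * pi * s))))\<^sup>2) = 2 * c"
    using clt_finite_type[OF assms(1,2) 1(2)] 1(3) by blast
  have "log_mean f x = (LINT s:{0..1}|lborel. Ln (f (cis (2 * pi * s))))" using 1(1) by (simp add: log_mean_def)
  moreover have "\<theta> / 2 * (2 * c) = \<theta> * c" by simp
  ultimately show ?case using cycle_clt.clt_w_log[OF clt, of f x] unfolding cov by (simp only: simp_thms)
next
  case (2 p)
  obtain A c D \<kappa> l where clt: "cycle_clt \<theta> (\<lambda>m. Ln (f (x ^ m))) ((\<Sum>m=1..p. Ln (f (x ^ m))) / of_nat p) A c D \<kappa> l"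
    and cov: "Im ((\<Sum>m=1..p. (Ln (f (x ^ m)))\<^sup>2) / of_nat p) = 2 * c"
    using clt_root_of_unity[OF assms(1) 2(1,2)] by blast
  have "log_mean f x = (\<Sum>m=1..p. Ln (f (x ^ m))) / of_nat p" using 2(1,2) by (simp add: log_mean_def)
  moreover have "\<theta> / 2 * (2 * c) = \<theta> * c" by simp
  ultimately show ?case using cycle_clt.clt_w_log[OF clt, of f x] unfolding cov by (simp only: simp_thms)
qed

end
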